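(* The increasing process and the quadratic variation process of the time-changed $Q$-Wiener process $W_{E_t}=\sum_{j=1}^{\infty}\lambda_j^{1/2}w_j(E_t)f_j$ are respectively $$\langle W_E\rangle_t=\mathrm{tr}(Q)\,E_t\qquad\text{and}\qquad \langle\langle W_E\rangle\rangle_t=Q\,E_t .$$
   Context: $K$ is a real separable Hilbert space, $Q$ a nonnegative definite, symmetric, trace-class operator on $K$, $\{f_j\}_{j\ge1}$ an orthonormal basis of $K$ diagonalizing $Q$, with eigenvalues $Qf_j=\lambda_jf_j$. On a probability space $(\Omega,\mathcal F,\mathbb P)$, $\{w_j(t)\}_{t\ge0}$, $j=1,2,\dots$, are independent standard real Brownian motions. For $\beta\in(0,1)$, $U_\beta$ is a $\beta$-stable subordinator with $\mathbb E(e^{-uU_\beta(\tau)})=e^{-\tau u^\beta}$, and $E_t=\inf\{\tau>0:U_\beta(\tau)>t\}$ is its inverse; the Brownian motions $w_j$ are independent of $E$. The filtration is $\tilde{\mathcal F}_t=\bigcap_{u>t}\{\sigma[w_j(s):0\le s\le u,\ j=1,2,\dots]\vee\sigma[E_s:s\ge0]\}$, with $\tilde{\mathcal F}_0$ assumed complete, and $\mathcal G_t=\tilde{\mathcal F}_{E_t}$ is the $\sigma$-field at the $\tilde{\mathcal F}$-stopping time $E_t$. Martingale properties are with respect to $\{\mathcal G_t\}$. $\mathcal M_T^2(K)$ is the set of continuous square integrable $K$-valued martingales on $[0,T]$. For $M\in\mathcal M_T^2(K)$, the increasing process $\langle M\rangle_t$ is the unique adapted continuous increasing process starting from $0$ such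 that $\|M_t\|_K^2-\langle M\rangle_t$ is a continuous martingale. The quadratic variation process $\langle\langle M\rangle\rangle_t$ is the (unique) adapted continuous process starting from $0$, with values in the nonnegative definite trace-class operators on $K$, such that for all $h,g\in K$ the process $\langle M_t,h\rangle_K\langle M_t,g\rangle_K-\langle\langle\langle M\rangle\rangle_t(h),g\rangle_K$ is a martingale.
   Formalization: The quadratic variation is also required to be nondecreasing in the operator order, and its uniqueness is claimed only among such processes; without this it is not unique, since the rank-one process W_{E_t}⊗W_{E_t} also has all the listed properties. *)

theory Defs
  imports "HOL-Probability.Probability"
begin

section \<open>Operators on a real Hilbert space\<close>

definition orthonormal_basis :: "'k::real_inner set \<Rightarrow> bool" where
  "orthonormal_basis B \<longleftrightarrow>
     pairwise orthogonal B \<and> (\<forall>e\<in>B. norm e = 1) \<and> closure (span B) = UNIV"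

definition symmetric_op :: "('k::real_inner \<Rightarrow>\<^sub>L 'k) \<Rightarrow> bool" where
  "symmetric_op T \<longleftrightarrow> (\<forall>x y. T x \<bullet> y = x \<bullet> T y)"

definition nonneg_op :: "('k::real_inner \<Rightarrow>\<^sub>L 'k) \<Rightarrow> bool" where
  "nonneg_op T \<longleftrightarrow> (\<forall>x. 0 \<le> T x \<bullet> x)"

text \<open>
  Trace-class operators are taken in their nuclear form: absolutely convergent series of
  rank-one operators, normed by the infimum of the absolute sums over all such representations.
  By the Riesz theorem the functionals are given as inner products.
\<close>

definition nuclear_rep ::
    "('k::real_inner \<Rightarrow>\<^sub>L 'k) \<Rightarrow> (nat \<Rightarrow> 'k) \<Rightarrow> (nat \<Rightarrow> 'k) \<Rightarrow> bool" where
  "nuclear_rep T a b \<longleftrightarrow>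
     summable (\<lambda>i. norm (a i) * norm (b i)) \<and> (\<forall>x. (\<lambda>i. (a i \<bullet> x) *\<^sub>R b i) sums T x)"

definition trace_class :: "('k::real_inner \<Rightarrow>\<^sub>L 'k) \<Rightarrow> bool" where
  "trace_class T \<longleftrightarrow> (\<exists>a b. nuclear_rep T a b)"

definition trace_norm :: "('k::real_inner \<Rightarrow>\<^sub>L 'k) \<Rightarrow> real" where
  "trace_norm T = Inf {(\<Sum>i. norm (a i) * norm (b i)) | a b. nuclear_rep T a b}"

text \<open>The common value over all orthonormal bases.\<close>

definition op_trace :: "('k::real_inner \<Rightarrow>\<^sub>L 'k) \<Rightarrow> real" where
  "op_trace T = (THE r. \<forall>B. orthonormal_basis B \<longrightarrow> ((\<lambda>e. T e \<bullet> e) has_sum r) B)"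

section \<open>Brownian motion, stable subordinator and its inverse\<close>

definition process_sigma ::
    "'w measure \<Rightarrow> 'i set \<Rightarrow> ('i \<Rightarrow> 'w \<Rightarrow> real) \<Rightarrow> 'w set set" where
  "process_sigma M I X =
     sigma_sets (space M) {X i -` A \<inter> space M | i A. i \<in> I \<and> A \<in> sets borel}"

definition independent_increments :: "'w measure \<Rightarrow> (real \<Rightarrow> 'w \<Rightarrow> real) \<Rightarrow> bool" where
  "independent_increments M X \<longleftrightarrow>
     (\<forall>n (s :: nat \<Rightarrow> real). 0 \<le> s 0 \<and> incseq s \<longrightarrow>
        prob_space.indep_vars M (\<lambda>_. borel) (\<lambda>i \<omega>. X (s (Suc i)) \<omega> - X (s i) \<omega>) {..<n})"

definition standard_brownian_motion :: "'w measure \<Rightarrow> (real \<Rightarrow> 'w \<Rightarrow> real) \<Rightarrow> bool" where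
  "standard_brownian_motion M w \<longleftrightarrow>
     (\<forall>t\<ge>0. w t \<in> borel_measurable M) \<and>
     (AE \<omega> in M. w 0 \<omega> = 0) \<and>
     independent_increments M w \<and>
     (\<forall>s t. 0 \<le> s \<and> s < t \<longrightarrow>
        distributed M lborel (\<lambda>\<omega>. w t \<omega> - w s \<omega>) (normal_density 0 (sqrt (t - s)))) \<and>
     (AE \<omega> in M. continuous_on {0..} (\<lambda>t. w t \<omega>))"

text \<open>Left limits of the paths exist by monotonicity.\<close>

definition stable_subordinator ::
    "'w measure \<Rightarrow> real \<Rightarrow> (real \<Rightarrow> 'w \<Rightarrow> real) \<Rightarrow> bool" where
  "stable_subordinator M \<beta> U \<longleftrightarrow>
     (\<forall>\<tau>\<ge>0. U \<tau> \<in> borel_measurable M) \<and>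
     (AE \<omega> in M. U 0 \<omega> = 0) \<and>
     independent_increments M U \<and>
     (\<forall>\<sigma> \<tau>. 0 \<le> \<sigma> \<and> \<sigma> \<le> \<tau> \<longrightarrow>
        distr M borel (\<lambda>\<omega>. U \<tau> \<omega> - U \<sigma> \<omega>) = distr M borel (U (\<tau> - \<sigma>))) \<and>
     (AE \<omega> in M. mono_on {0..} (\<lambda>\<tau>. U \<tau> \<omega>) \<and>
        (\<forall>\<tau>\<ge>0. continuous (at_right \<tau>) (\<lambda>\<tau>. U \<tau> \<omega>))) \<and>
     (\<forall>\<tau>\<ge>0. \<forall>u\<ge>0.
        prob_space.expectation M (\<lambda>\<omega>. exp (- (u * U \<tau> \<omega>))) = exp (- (\<tau> * u powr \<beta>)))"

text \<open>
  For a stable subordinator the set below is almost surely nonempty for all \<open>t\<close>;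
  the remaining paths form a null set.
\<close>

definition inverse_process :: "(real \<Rightarrow> 'w \<Rightarrow> real) \<Rightarrow> real \<Rightarrow> 'w \<Rightarrow> real" where
  "inverse_process U t \<omega> = Inf {\<tau>. 0 < \<tau> \<and> t < U \<tau> \<omega>}"

section \<open>The filtrations\<close>

text \<open>
  The null sets of \<open>M\<close> are adjoined to the generators, so that for complete \<open>M\<close> the
  \<open>\<sigma>\<close>-field at time 0 is complete. If it is so already, adjoining them changes nothing.
\<close>

definition base_filtration ::
    "'w measure \<Rightarrow> (nat \<Rightarrow> real \<Rightarrow> 'w \<Rightarrow> real) \<Rightarrow> (real \<Rightarrow> 'w \<Rightarrow> real) \<Rightarrow> real \<Rightarrow> 'w measure" where
  "base_filtration M w E t = sigma (space M)
     (\<Inter>u\<in>{t<..}. sigma_sets (space M)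
        (process_sigma M (UNIV \<times> {0..u}) (\<lambda>(j, s). w j s) \<union>
         process_sigma M {0..} E \<union> null_sets M))"

definition time_changed_filtration ::
    "'w measure \<Rightarrow> (nat \<Rightarrow> real \<Rightarrow> 'w \<Rightarrow> real) \<Rightarrow> (real \<Rightarrow> 'w \<Rightarrow> real) \<Rightarrow> real \<Rightarrow> 'w measure" where
  "time_changed_filtration M w E t =
     filtration.pre_sigma (space M) (base_filtration M w E) (E t)"

section \<open>Martingales, increasing process and quadratic variation\<close>

text \<open>
  Pathwise properties are understood almost surely. The martingale property is
  \<open>E[X\<^sub>t | G\<^sub>s] = X\<^sub>s\<close> with the conditional expectation written out by its defining
  integral identity, because the conditional expectation of the library is only real-valued.
\<close>

definition martingale ::
    "'w measure \<Rightarrow> (real \<Rightarrow> 'w measure) \<Rightarrow> real \<Rightarrow>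
     (real \<Rightarrow> 'w \<Rightarrow> 'b::{banach, second_countable_topology}) \<Rightarrow> bool" where
  "martingale M G T X \<longleftrightarrow>
     (\<forall>t\<in>{0..T}. X t \<in> borel_measurable (G t) \<and> integrable M (X t)) \<and>
     (\<forall>s t. 0 \<le> s \<and> s \<le> t \<and> t \<le> T \<longrightarrow>
        (\<forall>A\<in>sets (G s). (LINT \<omega>:A|M. X t \<omega>) = (LINT \<omega>:A|M. X s \<omega>)))"

definition continuous_martingale ::
    "'w measure \<Rightarrow> (real \<Rightarrow> 'w measure) \<Rightarrow> real \<Rightarrow>
     (real \<Rightarrow> 'w \<Rightarrow> 'b::{banach, second_countable_topology}) \<Rightarrow> bool" where
  "continuous_martingale M G T X \<longleftrightarrow>
     martingale M G T X \<and> (AE \<omega> in M. continuous_on {0..T} (\<lambda>t. X t \<omega>))"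

definition continuous_L2_martingale ::
    "'w measure \<Rightarrow> (real \<Rightarrow> 'w measure) \<Rightarrow> real \<Rightarrow>
     (real \<Rightarrow> 'w \<Rightarrow> 'k::{real_inner, banach, second_countable_topology}) \<Rightarrow> bool" where
  "continuous_L2_martingale M G T X \<longleftrightarrow>
     continuous_martingale M G T X \<and> (\<forall>t\<in>{0..T}. integrable M (\<lambda>\<omega>. (norm (X t \<omega>))\<^sup>2))"

definition indistinguishable ::
    "'w measure \<Rightarrow> real \<Rightarrow> (real \<Rightarrow> 'w \<Rightarrow> 'c) \<Rightarrow> (real \<Rightarrow> 'w \<Rightarrow> 'c) \<Rightarrow> bool" where
  "indistinguishable M T X Y \<longleftrightarrow> (AE \<omega> in M. \<forall>t\<in>{0..T}. X t \<omega> = Y t \<omega>)"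

definition compensates_norm_square ::
    "'w measure \<Rightarrow> (real \<Rightarrow> 'w measure) \<Rightarrow> real \<Rightarrow>
     (real \<Rightarrow> 'w \<Rightarrow> 'k::{real_inner, banach, second_countable_topology}) \<Rightarrow>
     (real \<Rightarrow> 'w \<Rightarrow> real) \<Rightarrow> bool" where
  "compensates_norm_square M G T X A \<longleftrightarrow>
     (\<forall>t\<in>{0..T}. A t \<in> borel_measurable (G t)) \<and>
     (AE \<omega> in M. A 0 \<omega> = 0 \<and> continuous_on {0..T} (\<lambda>t. A t \<omega>) \<and> mono_on {0..T} (\<lambda>t. A t \<omega>)) \<and>
     continuous_martingale M G T (\<lambda>t \<omega>. (norm (X t \<omega>))\<^sup>2 - A t \<omega>)"

definition is_increasing_process ::
    "'w measure \<Rightarrow> (real \<Rightarrow> 'w measure) \<Rightarrow> real \<Rightarrow>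
     (real \<Rightarrow> 'w \<Rightarrow> 'k::{real_inner, banach, second_countable_topology}) \<Rightarrow>
     (real \<Rightarrow> 'w \<Rightarrow> real) \<Rightarrow> bool" where
  "is_increasing_process M G T X A \<longleftrightarrow>
     compensates_norm_square M G T X A \<and>
     (\<forall>A'. compensates_norm_square M G T X A' \<longrightarrow> indistinguishable M T A' A)"

text \<open>
  Continuity is with respect to the trace norm. Adaptedness may be stated with the operator-norm
  Borel sets, since on the separable space of trace-class operators both norms have the same
  Borel sets.
\<close>

definition compensates_tensor_square ::
    "'w measure \<Rightarrow> (real \<Rightarrow> 'w measure) \<Rightarrow> real \<Rightarrow>
     (real \<Rightarrow> 'w \<Rightarrow> 'k::{real_inner, banach, second_countable_topology}) \<Rightarrow>
     (real \<Rightarrow> 'w \<Rightarrow> 'k \<Rightarrow>\<^sub>L 'k) \<Rightarrow> bool" where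
  "compensates_tensor_square M G T X V \<longleftrightarrow>
     (\<forall>t\<in>{0..T}. V t \<in> borel_measurable (G t)) \<and>
     (AE \<omega> in M. V 0 \<omega> = 0 \<and>
        (\<forall>t\<in>{0..T}. symmetric_op (V t \<omega>) \<and> nonneg_op (V t \<omega>) \<and> trace_class (V t \<omega>)) \<and>
        (\<forall>t\<in>{0..T}. ((\<lambda>s. trace_norm (V s \<omega> - V t \<omega>)) \<longlongrightarrow> 0) (at t within {0..T}))) \<and>
     (\<forall>h g. martingale M G T (\<lambda>t \<omega>. (X t \<omega> \<bullet> h) * (X t \<omega> \<bullet> g) - V t \<omega> h \<bullet> g))"

definition nondecreasing_op_process ::
    "'w measure \<Rightarrow> real \<Rightarrow> (real \<Rightarrow> 'w \<Rightarrow> 'k::real_inner \<Rightarrow>\<^sub>L 'k) \<Rightarrow> bool" where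
  "nondecreasing_op_process M T V \<longleftrightarrow>
     (AE \<omega> in M. \<forall>s t. 0 \<le> s \<and> s \<le> t \<and> t \<le> T \<longrightarrow> nonneg_op (V t \<omega> - V s \<omega>))"

text \<open>
  The quadratic variation process is unique only among processes that are nondecreasing in the
  operator order: for a one-dimensional Brownian motion \<open>w\<close>, both \<open>t\<close> and \<open>w(t)\<^sup>2\<close> satisfy
  all the other conditions.
\<close>

definition is_quadratic_variation ::
    "'w measure \<Rightarrow> (real \<Rightarrow> 'w measure) \<Rightarrow> real \<Rightarrow>
     (real \<Rightarrow> 'w \<Rightarrow> 'k::{real_inner, banach, second_countable_topology}) \<Rightarrow>
     (real \<Rightarrow> 'w \<Rightarrow> 'k \<Rightarrow>\<^sub>L 'k) \<Rightarrow> bool" where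
  "is_quadratic_variation M G T X V \<longleftrightarrow>
     compensates_tensor_square M G T X V \<and> nondecreasing_op_process M T V \<and>
     (\<forall>V'. compensates_tensor_square M G T X V' \<and> nondecreasing_op_process M T V' \<longrightarrow>
        indistinguishable M T V' V)"

section \<open>The time-changed Q-Wiener process\<close>

definition time_changed_Wiener ::
    "(nat \<Rightarrow> real) \<Rightarrow> (nat \<Rightarrow> 'k::real_normed_vector) \<Rightarrow> (nat \<Rightarrow> real \<Rightarrow> 'w \<Rightarrow> real) \<Rightarrow>
     (real \<Rightarrow> 'w \<Rightarrow> real) \<Rightarrow> real \<Rightarrow> 'w \<Rightarrow> 'k" where
  "time_changed_Wiener lam f w E t \<omega> = (\<Sum>j. (sqrt (lam j) * w j (E t \<omega>) \<omega>) *\<^sub>R f j)"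

end

theory Submission
  imports Defs
begin

text \<open>
  The time change \<open>E\<close> is almost surely finite, continuous and nondecreasing, and it is measurable
  with respect to the \<open>\<sigma>\<close>-field at time 0. The random times \<open>E s \<le> E t\<close> are therefore known before
  the Brownian motions start to move, and conditionally on them the time-changed process is a
  \<open>Q\<close>-Wiener process seen at fixed times.

  For a fixed vector \<open>h\<close> the real process \<open>B u = W u \<bullet> h\<close> has increments with mean zero and variance
  \<open>Q h \<bullet> h\<close> per unit of time, also when they are restricted to an event of the past of all Brownian
  motions, the whole of \<open>E\<close>, and the null sets (\<open>increments_indep_past\<close>,
  \<open>W_inner_orthogonal_increments\<close>). Replace \<open>E s\<close> and \<open>E t\<close> by the next point of a dyadic grid.
  An event \<open>A\<close> of the \<open>\<sigma>\<close>-field at \<open>E s\<close> splits into countably many cells on which both grid times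
  are constant, and each cell is known at the earlier of the two times. Adding up the moments of the
  ordinary increments over the cells and refining the grid gives
  \<open>E[B(E t) - B(E s); A] = 0\<close> and \<open>E[(B(E t) - B(E s))\<^sup>2; A] = (Q h \<bullet> h) E[E t - E s; A]\<close>
  (\<open>time_changed_orthogonal_increments\<close>). Hence \<open>(X t \<bullet> h)\<^sup>2 - (Q h \<bullet> h) E t\<close> is a martingale;
  polarization gives the quadratic variation \<open>Q E\<close>, and summation over an orthonormal basis gives
  the increasing process \<open>tr Q E\<close>.

  Two compensators differ by a continuous martingale \<open>N\<close> that is a difference of nondecreasing
  integrable processes, and such a martingale vanishes
  (\<open>continuous_finite_variation_martingale_zero\<close>). Expand \<open>sqrt (1 + N\<^sup>2)\<close> along a partition: the
  first-order terms have mean zero, and since the derivatives of \<open>sqrt (1 + x\<^sup>2)\<close> are bounded,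
  the remainder is at most the sum of \<open>\<bar>\<Delta>N\<bar> min \<bar>\<Delta>N\<bar> 2\<close>. This is dominated by twice the
  integrable total variation and tends to 0 by continuity, so that \<open>E[sqrt (1 + N\<^sup>2)] \<le> 1\<close>. No
  localization by stopping times is involved. For the quadratic variation the
  argument is applied to the forms \<open>V h \<bullet> h\<close> with \<open>h = f i + f j\<close>, which determine \<open>V\<close>.

  Continuity of the paths of \<open>W\<close> follows from uniform convergence of its defining series on bounded
  intervals. By orthogonality it suffices that the sum of \<open>lam j\<close> times the supremum of \<open>(w j)\<^sup>2\<close> is
  finite, and dyadic chaining with fourth moments bounds the mean of that supremum independently of
  \<open>j\<close>.
\<close>

section \<open>Orthonormal expansions\<close>

lemma orthonormal_residual_orthogonal:
  fixes x :: "'k::real_inner"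
  assumes "pairwise orthogonal F" "\<And>e. e \<in> F \<Longrightarrow> norm e = 1" "finite F" "y \<in> span F"
  shows "(x - (\<Sum>e\<in>F. (x \<bullet> e) *\<^sub>R e)) \<bullet> y = 0"
proof -
  have *: "(\<Sum>e\<in>F. (x \<bullet> e) *\<^sub>R e) \<bullet> d = x \<bullet> d" if d: "d \<in> F" for d
  proof -
    have "(\<Sum>e\<in>F. (x \<bullet> e) *\<^sub>R e) \<bullet> d = (\<Sum>e\<in>F. if e = d then x \<bullet> d else 0)"
      unfolding inner_sum_left
      using assms(1,2) d
      by (intro sum.cong) (auto simp: pairwise_def orthogonal_def dot_square_norm)
    then show ?thesis using assms(3) d by simp
  qed
  have "orthogonal (x - (\<Sum>e\<in>F. (x \<bullet> e) *\<^sub>R e)) y"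
    by (rule orthogonal_to_span[OF assms(4)]) (auto simp: orthogonal_def inner_diff_left *)
  then show ?thesis by (simp add: orthogonal_def)
qed

lemma orthonormal_residual_norm:
  fixes x :: "'k::real_inner"
  assumes "pairwise orthogonal F" "\<And>e. e \<in> F \<Longrightarrow> norm e = 1" "finite F"
  shows "(norm (x - (\<Sum>e\<in>F. (x \<bullet> e) *\<^sub>R e)))\<^sup>2 = (norm x)\<^sup>2 - (\<Sum>e\<in>F. (x \<bullet> e)\<^sup>2)"
proof -
  let ?p = "\<Sum>e\<in>F. (x \<bullet> e) *\<^sub>R e"
  have p: "?p \<in> span F" by (intro span_sum span_scale span_base)
  have "(norm (x - ?p))\<^sup>2 = (x - ?p) \<bullet> x - (x - ?p) \<bullet> ?p"
    by (simp add: power2_norm_eq_inner inner_diff_right)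
  also have "\<dots> = (norm x)\<^sup>2 - ?p \<bullet> x"
    using orthonormal_residual_orthogonal[OF assms p, of x]
    by (simp add: inner_diff_left power2_norm_eq_inner)
  also have "?p \<bullet> x = (\<Sum>e\<in>F. (x \<bullet> e)\<^sup>2)"
    by (subst inner_commute) (simp add: inner_sum_right power2_eq_square)
  finally show ?thesis .
qed

text \<open>The residual of the projection is orthogonal to the span, so Pythagoras applies.\<close>

lemma orthonormal_best_approximation:
  fixes x :: "'k::real_inner"
  assumes "pairwise orthogonal F" "\<And>e. e \<in> F \<Longrightarrow> norm e = 1" "finite F" "y \<in> span F"
  shows "norm (x - (\<Sum>e\<in>F. (x \<bullet> e) *\<^sub>R e)) \<le> norm (x - y)"
proof -
  let ?p = "\<Sum>e\<in>F. (x \<bullet> e) *\<^sub>R e"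
  have p: "?p \<in> span F" by (intro span_sum span_scale span_base)
  have "(x - ?p) \<bullet> (?p - y) = 0"
    by (rule orthonormal_residual_orthogonal[OF assms(1-3) span_diff[OF p assms(4)]])
  then have "(norm ((x - ?p) + (?p - y)))\<^sup>2 = (norm (x - ?p))\<^sup>2 + (norm (?p - y))\<^sup>2"
    by (intro norm_add_Pythagorean) (simp add: orthogonal_def)
  then have "(norm (x - ?p))\<^sup>2 \<le> (norm (x - y))\<^sup>2" by simp
  then show ?thesis by (rule power2_le_imp_le) (rule norm_ge_zero)
qed

lemma orthonormal_basis_subset:
  assumes "orthonormal_basis B" "F \<subseteq> B"
  shows "pairwise orthogonal F" "e \<in> F \<Longrightarrow> norm e = 1"
  using assms by (auto simp: orthonormal_basis_def intro: pairwise_subset)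

lemma bessel_inequality:
  assumes "orthonormal_basis B" "finite F" "F \<subseteq> B"
  shows "(\<Sum>e\<in>F. (x \<bullet> e)\<^sup>2) \<le> (norm x)\<^sup>2"
  using orthonormal_residual_norm[OF orthonormal_basis_subset[OF assms(1,3)] assms(2), of x]
    zero_le_power2[of "norm (x - (\<Sum>e\<in>F. (x \<bullet> e) *\<^sub>R e))"] by linarith

text \<open>
  Density of the span provides one good approximant; by the best approximation property, the
  partial expansion over every larger finite set is at least as good.
\<close>

lemma orthonormal_basis_residual_small:
  fixes x :: "'k::real_inner"
  assumes B: "orthonormal_basis B" and "\<epsilon> > 0"
  obtains F where "finite F" "F \<subseteq> B"
    "\<And>F'. finite F' \<Longrightarrow> F \<subseteq> F' \<Longrightarrow> F' \<subseteq> B \<Longrightarrow> norm (x - (\<Sum>e\<in>F'. (x \<bullet> e) *\<^sub>R e)) < \<epsilon>"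
proof -
  have "x \<in> closure (span B)" using B by (simp add: orthonormal_basis_def)
  then obtain y where y: "y \<in> span B" "norm (x - y) < \<epsilon>"
    using \<open>\<epsilon> > 0\<close> unfolding closure_approachable by (auto simp: dist_norm norm_minus_commute)
  obtain F where F: "finite F" "F \<subseteq> B" "y \<in> span F"
  proof -
    obtain F r where "finite F" "F \<subseteq> B" "y = (\<Sum>a\<in>F. r a *\<^sub>R a)"
      using y(1) unfolding span_explicit mem_Collect_eq by metis
    moreover from this have "y \<in> span F"
      by (simp add: span_sum span_scale span_base)
    ultimately show ?thesis using that by blast
  qed
  show thesis
  proof (rule that[OF F(1,2)])
    fix F' assume F': "finite F'" "F \<subseteq> F'" "F' \<subseteq> B"
    have "y \<in> span F'" using F(3) F'(2) span_mono by blast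
    then have "norm (x - (\<Sum>e\<in>F'. (x \<bullet> e) *\<^sub>R e)) \<le> norm (x - y)"
      using orthonormal_basis_subset[OF B F'(3)] F'(1) by (intro orthonormal_best_approximation) auto
    with y(2) show "norm (x - (\<Sum>e\<in>F'. (x \<bullet> e) *\<^sub>R e)) < \<epsilon>" by simp
  qed
qed

text \<open>
  Upper bounds come from Bessel, lower bounds from the smallness of the residual. The basis is a
  set without a chosen enumeration, whence the unordered sum.
\<close>

lemma parseval_has_sum:
  fixes x :: "'k::real_inner"
  assumes B: "orthonormal_basis B"
  shows "((\<lambda>e. (x \<bullet> e)\<^sup>2) has_sum (norm x)\<^sup>2) B"
  unfolding has_sum_def
proof (rule order_tendstoI)
  fix a assume "a < (norm x)\<^sup>2"
  then have "0 < sqrt ((norm x)\<^sup>2 - a)" by simp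
  from orthonormal_basis_residual_small[OF B this, of x] obtain F where
    F: "finite F" "F \<subseteq> B" and
    *: "\<And>F'. finite F' \<Longrightarrow> F \<subseteq> F' \<Longrightarrow> F' \<subseteq> B \<Longrightarrow>
        norm (x - (\<Sum>e\<in>F'. (x \<bullet> e) *\<^sub>R e)) < sqrt ((norm x)\<^sup>2 - a)" by blast
  have "a < (\<Sum>e\<in>F'. (x \<bullet> e)\<^sup>2)" if F': "finite F'" "F \<subseteq> F'" "F' \<subseteq> B" for F'
  proof -
    have "(norm (x - (\<Sum>e\<in>F'. (x \<bullet> e) *\<^sub>R e)))\<^sup>2 < (sqrt ((norm x)\<^sup>2 - a))\<^sup>2"
      using *[OF F'] by (intro power_strict_mono) auto
    also have "\<dots> = (norm x)\<^sup>2 - a" using \<open>a < (norm x)\<^sup>2\<close> by simp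
    finally show ?thesis
      using orthonormal_residual_norm[OF orthonormal_basis_subset[OF B F'(3)] F'(1), of x] by simp
  qed
  then show "\<forall>\<^sub>F F in finite_subsets_at_top B. a < (\<Sum>e\<in>F. (x \<bullet> e)\<^sup>2)"
    unfolding eventually_finite_subsets_at_top using F by (intro exI[of _ F]) simp
next
  fix a assume "(norm x)\<^sup>2 < a"
  then show "\<forall>\<^sub>F F in finite_subsets_at_top B. (\<Sum>e\<in>F. (x \<bullet> e)\<^sup>2) < a"
    by (intro eventually_finite_subsets_at_top_weakI le_less_trans[OF bessel_inequality[OF B]])
qed

lemma orthonormal_expansion_sums:
  fixes x :: "'k::real_inner"
  assumes B: "orthonormal_basis (range f)" and "inj (f :: nat \<Rightarrow> 'k)"
  shows "(\<lambda>j. (x \<bullet> f j) *\<^sub>R f j) sums x"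
  unfolding sums_def LIMSEQ_iff
proof (intro allI impI)
  fix r :: real assume "r > 0"
  from orthonormal_basis_residual_small[OF B this, of x] obtain F where
    F: "finite F" "F \<subseteq> range f" and
    *: "\<And>F'. finite F' \<Longrightarrow> F \<subseteq> F' \<Longrightarrow> F' \<subseteq> range f \<Longrightarrow>
        norm (x - (\<Sum>e\<in>F'. (x \<bullet> e) *\<^sub>R e)) < r" by blast
  obtain J where J: "finite J" "F = f ` J" using F by (meson finite_subset_image)
  obtain N where N: "\<And>j. j \<in> J \<Longrightarrow> j < N"
    using J(1) by (meson finite_nat_set_iff_bounded)
  show "\<exists>no. \<forall>n\<ge>no. norm ((\<Sum>j<n. (x \<bullet> f j) *\<^sub>R f j) - x) < r"
  proof (intro exI[of _ N] allI impI)
    fix n assume "N \<le> n"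
    have "F \<subseteq> f ` {..<n}" using J N \<open>N \<le> n\<close> by fastforce
    then have "norm (x - (\<Sum>e\<in>f ` {..<n}. (x \<bullet> e) *\<^sub>R e)) < r" by (intro *) auto
    also have "(\<Sum>e\<in>f ` {..<n}. (x \<bullet> e) *\<^sub>R e) = (\<Sum>j<n. (x \<bullet> f j) *\<^sub>R f j)"
      by (subst sum.reindex) (auto intro: inj_on_subset[OF \<open>inj f\<close>])
    finally show "norm ((\<Sum>j<n. (x \<bullet> f j) *\<^sub>R f j) - x) < r" by (simp add: norm_minus_commute)
  qed
qed

lemma sequence_orthonormal:
  assumes "orthonormal_basis (range f)" "inj f"
  shows "f i \<bullet> f j = (if i = j then 1 else (0::real))"
  using assms unfolding orthonormal_basis_def pairwise_def orthogonal_def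
  by (auto simp: dot_square_norm inj_eq)

section \<open>The spectral form and the trace of the covariance operator\<close>

lemma eigenvalues_nonneg:
  fixes Q :: "'k::real_inner \<Rightarrow>\<^sub>L 'k"
  assumes "nonneg_op Q" "orthonormal_basis (range f)" "Q (f j) = lam j *\<^sub>R f j"
  shows "0 \<le> lam j"
proof -
  have "0 \<le> Q (f j) \<bullet> f j" using assms(1) by (simp add: nonneg_op_def)
  moreover have "norm (f j) = 1" using assms(2) by (auto simp: orthonormal_basis_def)
  ultimately show ?thesis using assms(3) by (simp add: dot_square_norm)
qed

lemma nuclear_rep_inner_sums:
  assumes "nuclear_rep T a b"
  shows "(\<lambda>i. (a i \<bullet> x) * (b i \<bullet> y)) sums (T x \<bullet> y)"
proof -
  have "(\<lambda>i. (a i \<bullet> x) *\<^sub>R b i) sums T x" using assms by (simp add: nuclear_rep_def)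
  from bounded_linear.sums[OF bounded_linear_inner_left this, of y] show ?thesis by simp
qed

text \<open>
  By Cauchy--Schwarz and Bessel, each rank-one term of a nuclear representation contributes at
  most the product of its norms to a partial trace.
\<close>

lemma trace_class_eigenvalues_summable:
  fixes Q :: "'k::real_inner \<Rightarrow>\<^sub>L 'k"
  assumes "nonneg_op Q" "trace_class Q" and B: "orthonormal_basis (range f)" and inj: "inj f"
    and eig: "\<And>j. Q (f j) = lam j *\<^sub>R f j"
  shows "summable lam"
proof -
  obtain a b where rep: "nuclear_rep Q a b" using assms(2) by (auto simp: trace_class_def)
  have "(\<Sum>j<n. lam j) \<le> (\<Sum>i. norm (a i) * norm (b i))" for n
  proof -
    have s: "(\<lambda>i. \<Sum>j<n. (a i \<bullet> f j) * (b i \<bullet> f j)) sums (\<Sum>j<n. Q (f j) \<bullet> f j)"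
      by (intro sums_sum nuclear_rep_inner_sums[OF rep])
    have bd: "(\<Sum>j<n. (a i \<bullet> f j) * (b i \<bullet> f j)) \<le> norm (a i) * norm (b i)" for i
    proof (rule power2_le_imp_le)
      have bes: "(\<Sum>j<n. (y \<bullet> f j)\<^sup>2) \<le> (norm y)\<^sup>2" for y
        using bessel_inequality[OF B, of "f ` {..<n}" y]
        by (simp add: sum.reindex inj_on_subset[OF inj] image_mono)
      have "(\<Sum>j<n. (a i \<bullet> f j) * (b i \<bullet> f j))\<^sup>2 \<le> (\<Sum>j<n. (a i \<bullet> f j)\<^sup>2) * (\<Sum>j<n. (b i \<bullet> f j)\<^sup>2)"
        by (rule Cauchy_Schwarz_ineq_sum)
      also have "\<dots> \<le> (norm (a i))\<^sup>2 * (norm (b i))\<^sup>2"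
        by (intro mult_mono bes sum_nonneg) auto
      finally show "(\<Sum>j<n. (a i \<bullet> f j) * (b i \<bullet> f j))\<^sup>2 \<le> (norm (a i) * norm (b i))\<^sup>2"
        by (simp add: power_mult_distrib)
    qed simp
    have "(\<Sum>j<n. Q (f j) \<bullet> f j) \<le> (\<Sum>i. norm (a i) * norm (b i))"
      using rep s unfolding nuclear_rep_def
      by (intro sums_le[OF bd s]) (auto intro: summable_sums)
    moreover have "Q (f j) \<bullet> f j = lam j" for j
      by (simp add: eig sequence_orthonormal[OF B inj])
    ultimately show ?thesis by simp
  qed
  then show ?thesis
    using eigenvalues_nonneg[where f=f and lam=lam, OF assms(1) B eig]
    by (intro bounded_imp_summable[where B="\<Sum>i. norm (a i) * norm (b i)"])
       (auto simp: lessThan_Suc_atMost[symmetric] simp del: sum.lessThan_Suc)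
qed

text \<open>Apply the operator to the orthonormal expansion of its argument.\<close>

lemma spectral_form_sums:
  fixes Q :: "'k::real_inner \<Rightarrow>\<^sub>L 'k"
  assumes "orthonormal_basis (range f)" "inj f" and eig: "\<And>j. Q (f j) = lam j *\<^sub>R f j"
  shows "(\<lambda>j. lam j * (f j \<bullet> x) * (f j \<bullet> y)) sums (Q x \<bullet> y)"
proof -
  have "(\<lambda>j. Q ((x \<bullet> f j) *\<^sub>R f j) \<bullet> y) sums (Q x \<bullet> y)"
    by (intro bounded_linear.sums[OF bounded_linear_inner_left]
        bounded_linear.sums[OF blinfun.bounded_linear_right] orthonormal_expansion_sums assms)
  then show ?thesis
    by (simp add: blinfun.scaleR_right eig inner_commute mult_ac)
qed

text \<open>
  Over a finite part of the second basis the diagonal sum is the series of \<open>lam j\<close> weighted by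
  \<open>\<Sum>e\<in>F. (f j \<bullet> e)\<^sup>2 \<le> 1\<close>. The weights increase to 1 by Parseval, so finitely many eigenvalues
  bound the limit from below and all of them bound it from above.
\<close>

lemma trace_has_sum:
  fixes Q :: "'k::real_inner \<Rightarrow>\<^sub>L 'k"
  assumes "nonneg_op Q" "trace_class Q" and B0: "orthonormal_basis (range f)" and inj: "inj f"
    and eig: "\<And>j. Q (f j) = lam j *\<^sub>R f j" and B: "orthonormal_basis B"
  shows "((\<lambda>e. Q e \<bullet> e) has_sum (\<Sum>j. lam j)) B"
  unfolding has_sum_def
proof (rule order_tendstoI)
  have lam0: "0 \<le> lam j" for j by (rule eigenvalues_nonneg[where f=f, OF assms(1) B0 eig])
  note lsum = trace_class_eigenvalues_summable[OF assms(1-5)]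
  have s: "(\<lambda>j. lam j * (\<Sum>e\<in>F. (f j \<bullet> e)\<^sup>2)) sums (\<Sum>e\<in>F. Q e \<bullet> e)" for F
    unfolding sum_distrib_left
    using spectral_form_sums[OF B0 inj eig]
    by (intro sums_sum) (simp add: power2_eq_square mult_ac)
  { fix a assume "a < (\<Sum>j. lam j)"
    then obtain N where N: "a < (\<Sum>j<N. lam j)"
      using order_tendstoD(1)[OF summable_LIMSEQ[OF lsum], of a] eventually_happens'[OF sequentially_bot]
      by blast
    have "((\<lambda>F. \<Sum>j<N. lam j * (\<Sum>e\<in>F. (f j \<bullet> e)\<^sup>2)) \<longlongrightarrow> (\<Sum>j<N. lam j * (norm (f j))\<^sup>2))
        (finite_subsets_at_top B)"
      using parseval_has_sum[OF B] unfolding has_sum_def by (intro tendsto_intros)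
    then have "\<forall>\<^sub>F F in finite_subsets_at_top B. a < (\<Sum>j<N. lam j * (\<Sum>e\<in>F. (f j \<bullet> e)\<^sup>2))"
      using N B0 by (intro order_tendstoD(1)) (auto simp: orthonormal_basis_def)
    then show "\<forall>\<^sub>F F in finite_subsets_at_top B. a < (\<Sum>e\<in>F. Q e \<bullet> e)"
    proof eventually_elim
      case (elim F)
      have "(\<Sum>j<N. lam j * (\<Sum>e\<in>F. (f j \<bullet> e)\<^sup>2)) \<le> (\<Sum>e\<in>F. Q e \<bullet> e)"
        by (subst sums_unique[OF s], rule sum_le_suminf)
           (auto intro!: sums_summable[OF s] mult_nonneg_nonneg sum_nonneg lam0)
      with elim show ?case by simp
    qed }
  { fix a assume a: "(\<Sum>j. lam j) < a"
    have "(\<Sum>e\<in>F. Q e \<bullet> e) \<le> (\<Sum>j. lam j)" if F: "finite F" "F \<subseteq> B" for F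
    proof (rule sums_le[OF _ s summable_sums[OF lsum]])
      fix j
      have "(\<Sum>e\<in>F. (f j \<bullet> e)\<^sup>2) \<le> 1"
        using bessel_inequality[OF B F, of "f j"] B0 by (auto simp: orthonormal_basis_def)
      then show "lam j * (\<Sum>e\<in>F. (f j \<bullet> e)\<^sup>2) \<le> lam j"
        using mult_left_mono[OF _ lam0[of j], of "\<Sum>e\<in>F. (f j \<bullet> e)\<^sup>2" 1] by simp
    qed
    from le_less_trans[OF this a] show "\<forall>\<^sub>F F in finite_subsets_at_top B. (\<Sum>e\<in>F. Q e \<bullet> e) < a"
      by (intro eventually_finite_subsets_at_top_weakI) }
qed

lemma op_trace_eq_suminf:
  fixes Q :: "'k::real_inner \<Rightarrow>\<^sub>L 'k"
  assumes "nonneg_op Q" "trace_class Q" "orthonormal_basis (range f)" "inj f"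
    and "\<And>j. Q (f j) = lam j *\<^sub>R f j"
  shows "op_trace Q = (\<Sum>j. lam j)"
  unfolding op_trace_def
proof (rule the_equality)
  show "\<forall>B. orthonormal_basis B \<longrightarrow> ((\<lambda>e. Q e \<bullet> e) has_sum (\<Sum>j. lam j)) B"
    using trace_has_sum[OF assms] by blast
  then show "r = (\<Sum>j. lam j)"
    if "\<forall>B. orthonormal_basis B \<longrightarrow> ((\<lambda>e. Q e \<bullet> e) has_sum r) B" for r
    using that assms(3) by (meson has_sum_unique)
qed

section \<open>The trace norm\<close>

lemma nuclear_rep_sum_nonneg:
  "nuclear_rep S a b \<Longrightarrow> 0 \<le> (\<Sum>i. norm (a i) * norm (b i))"
  by (auto intro!: suminf_nonneg simp: nuclear_rep_def)

lemma trace_norm_nonneg: "0 \<le> trace_norm S" if "trace_class S"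
  unfolding trace_norm_def
proof (rule cInf_greatest)
  show "{\<Sum>i. norm (a i) * norm (b i) |a b. nuclear_rep S a b} \<noteq> {}"
    using that by (auto simp: trace_class_def)
qed (auto intro: nuclear_rep_sum_nonneg)

lemma trace_norm_le:
  assumes "nuclear_rep S a b"
  shows "trace_norm S \<le> (\<Sum>i. norm (a i) * norm (b i))"
  unfolding trace_norm_def
  using assms nuclear_rep_sum_nonneg by (intro cInf_lower bdd_belowI[of _ 0]) auto

lemma nuclear_rep_scaleR:
  assumes "nuclear_rep S a b"
  shows "nuclear_rep (c *\<^sub>R S) a (\<lambda>i. c *\<^sub>R b i)"
proof -
  have "summable (\<lambda>i. \<bar>c\<bar> * (norm (a i) * norm (b i)))"
    using assms by (intro summable_mult) (simp add: nuclear_rep_def)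
  moreover have "(\<lambda>i. c *\<^sub>R ((a i \<bullet> x) *\<^sub>R b i)) sums (c *\<^sub>R S x)" for x
    using assms by (intro sums_scaleR_right) (simp add: nuclear_rep_def)
  ultimately show ?thesis
    by (simp add: nuclear_rep_def blinfun.scaleR_left mult_ac scaleR_left_commute)
qed

lemma trace_class_scaleR: "trace_class S \<Longrightarrow> trace_class (c *\<^sub>R S)"
  unfolding trace_class_def using nuclear_rep_scaleR by blast

lemma trace_norm_scaleR_le:
  assumes "nuclear_rep S a b"
  shows "trace_norm (c *\<^sub>R S) \<le> \<bar>c\<bar> * (\<Sum>i. norm (a i) * norm (b i))"
proof -
  have "trace_norm (c *\<^sub>R S) \<le> (\<Sum>i. norm (a i) * norm (c *\<^sub>R b i))"
    by (rule trace_norm_le[OF nuclear_rep_scaleR[OF assms]])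
  also have "\<dots> = (\<Sum>i. \<bar>c\<bar> * (norm (a i) * norm (b i)))" by (simp add: mult_ac)
  also have "\<dots> = \<bar>c\<bar> * (\<Sum>i. norm (a i) * norm (b i))"
    using assms by (intro suminf_mult) (simp add: nuclear_rep_def)
  finally show ?thesis .
qed

text \<open>
  Every nuclear representation bounds the form by its absolute sum; take the infimum. This turns
  continuity in trace norm into continuity of all the forms.
\<close>

lemma abs_form_le_trace_norm:
  assumes "trace_class S"
  shows "\<bar>S x \<bullet> y\<bar> \<le> trace_norm S * (norm x * norm y)"
proof -
  have *: "\<bar>S x \<bullet> y\<bar> \<le> r * (norm x * norm y)"
    if "nuclear_rep S a b" "r = (\<Sum>i. norm (a i) * norm (b i))" for a b r
  proof -
    have "summable (\<lambda>i. norm (a i) * norm (b i))" using that by (simp add: nuclear_rep_def)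
    then have s: "(\<lambda>i. (norm (a i) * norm (b i)) * (norm x * norm y)) sums (r * (norm x * norm y))"
      unfolding that(2) by (intro sums_mult2 summable_sums)
    have le: "norm ((a i \<bullet> x) * (b i \<bullet> y)) \<le> (norm (a i) * norm (b i)) * (norm x * norm y)" for i
    proof -
      have "\<bar>a i \<bullet> x\<bar> * \<bar>b i \<bullet> y\<bar> \<le> (norm (a i) * norm x) * (norm (b i) * norm y)"
        by (intro mult_mono Cauchy_Schwarz_ineq2) auto
      then show ?thesis by (simp add: abs_mult mult_ac)
    qed
    have "norm (\<Sum>i. (a i \<bullet> x) * (b i \<bullet> y)) \<le> (\<Sum>i. (norm (a i) * norm (b i)) * (norm x * norm y))"
      by (rule norm_suminf_le[OF le sums_summable[OF s]])
    then show ?thesis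
      using nuclear_rep_inner_sums[OF that(1), of x y] s by (simp add: sums_iff)
  qed
  show ?thesis
  proof (cases "norm x * norm y = 0")
    case True
    then show ?thesis by auto
  next
    case False
    then have pos: "0 < norm x * norm y" by simp
    have "\<bar>S x \<bullet> y\<bar> / (norm x * norm y) \<le> trace_norm S"
      unfolding trace_norm_def
    proof (rule cInf_greatest)
      show "{\<Sum>i. norm (a i) * norm (b i) |a b. nuclear_rep S a b} \<noteq> {}"
        using assms by (auto simp: trace_class_def)
      fix r assume "r \<in> {\<Sum>i. norm (a i) * norm (b i) |a b. nuclear_rep S a b}"
      then show "\<bar>S x \<bullet> y\<bar> / (norm x * norm y) \<le> r"
        using * pos by (auto simp: pos_divide_le_eq)
    qed
    then show ?thesis using pos by (simp add: pos_divide_le_eq)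
  qed
qed

text \<open>
  Used to concatenate two nuclear representations, so that differences of trace-class operators
  are trace class.
\<close>

lemma interleave_sums:
  fixes g h :: "nat \<Rightarrow> 'a::real_normed_vector"
  assumes "g sums s" "h sums t"
  shows "(\<lambda>i. if even i then g (i div 2) else h (i div 2)) sums (s + t)"
proof -
  have even_range: "n \<in> range ((*) 2)" if "even n" for n :: nat
    using that by (metis evenE rangeI)
  have "(\<lambda>n. (\<lambda>i. if even i then g (i div 2) else 0) (2 * n)) sums s" using assms(1) by simp
  then have even_sums: "(\<lambda>i. if even i then g (i div 2) else 0) sums s"
    by (rule iffD1[OF sums_mono_reindex[where g="\<lambda>n. 2 * n"], rotated 2])
       (auto simp: strict_mono_def dest: even_range)
  have odd_range: "n \<in> range (\<lambda>n. Suc (2 * n))" if "odd n" for n :: nat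
    using that by (metis oddE Suc_eq_plus1 rangeI)
  have "(\<lambda>n. (\<lambda>i. if even i then 0 else h (i div 2)) (Suc (2 * n))) sums t" using assms(2) by simp
  then have "(\<lambda>i. if even i then 0 else h (i div 2)) sums t"
    by (rule iffD1[OF sums_mono_reindex[where g="\<lambda>n. Suc (2 * n)"], rotated 2])
       (auto simp: strict_mono_def dest: odd_range)
  from sums_add[OF even_sums this] have "(\<lambda>i. (if even i then g (i div 2) else 0) + (if even i then 0 else h (i div 2))) sums (s + t)" .
  then show ?thesis by (rule back_subst[where P="\<lambda>u. u sums _"]) auto
qed

lemma trace_class_diff:
  assumes "trace_class S" "trace_class S'"
  shows "trace_class (S - S')"
proof -
  obtain a b where ab: "nuclear_rep S a b" using assms(1) by (auto simp: trace_class_def)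
  obtain c d where cd: "nuclear_rep S' c d" using assms(2) by (auto simp: trace_class_def)
  let ?a = "\<lambda>i. if even i then a (i div 2) else c (i div 2)"
  let ?b = "\<lambda>i. if even i then b (i div 2) else - d (i div 2)"
  have "nuclear_rep (S - S') ?a ?b"
    unfolding nuclear_rep_def
  proof (intro conjI allI)
    have "summable (\<lambda>i. if even i then norm (a (i div 2)) * norm (b (i div 2))
        else norm (c (i div 2)) * norm (d (i div 2)))"
      using ab cd unfolding nuclear_rep_def
      by (intro sums_summable[OF interleave_sums] summable_sums) auto
    then show "summable (\<lambda>i. norm (?a i) * norm (?b i))"
      by (rule back_subst[where P=summable]) auto
    fix x
    have "(\<lambda>i. - ((c i \<bullet> x) *\<^sub>R d i)) sums (- S' x)"
      using cd unfolding nuclear_rep_def by (intro sums_minus) auto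
    then have "(\<lambda>i. if even i then (a (i div 2) \<bullet> x) *\<^sub>R b (i div 2)
        else - ((c (i div 2) \<bullet> x) *\<^sub>R d (i div 2))) sums (S x + - S' x)"
      using ab unfolding nuclear_rep_def by (intro interleave_sums) auto
    then have "(\<lambda>i. (?a i \<bullet> x) *\<^sub>R ?b i) sums (S x + - S' x)"
      by (rule back_subst[where P="\<lambda>u. u sums _"]) auto
    then show "(\<lambda>i. (?a i \<bullet> x) *\<^sub>R ?b i) sums ((S - S') x)"
      by (simp add: blinfun.diff_left)
  qed
  then show ?thesis by (auto simp: trace_class_def)
qed

section \<open>Continuous martingales of finite variation\<close>

text \<open>
  A second-order Taylor estimate for \<open>sqrt (1 + x\<^sup>2)\<close>, whose first derivative is bounded by 1
  and second derivative by 1: the remainder is quadratic for small and linear for large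
  increments.
\<close>

lemma sqrt_one_plus_square_taylor:
  fixes x y :: real
  shows "sqrt (1 + y\<^sup>2) - sqrt (1 + x\<^sup>2) - x / sqrt (1 + x\<^sup>2) * (y - x) \<le> \<bar>y - x\<bar> * min \<bar>y - x\<bar> 2"
proof -
  define a where "a = sqrt (1 + x\<^sup>2)"
  define b where "b = sqrt (1 + y\<^sup>2)"
  have a2: "a\<^sup>2 = 1 + x\<^sup>2" and b2: "b\<^sup>2 = 1 + y\<^sup>2" by (simp_all add: a_def b_def)
  have a1: "1 \<le> a" and b1: "1 \<le> b" by (simp_all add: a_def b_def)
  have xa: "\<bar>x\<bar> \<le> a" by (simp add: a_def real_le_rsqrt)
  have ab: "a * b \<le> 1 + (x\<^sup>2 + y\<^sup>2) / 2"
  proof -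
    have "2 * (a * b) \<le> a\<^sup>2 + b\<^sup>2" using sum_squares_bound[of a b] by simp
    then have "2 * (a * b) \<le> 2 * (1 + (x\<^sup>2 + y\<^sup>2) / 2)" unfolding a2 b2 by (simp add: add_divide_distrib)
    then show ?thesis by (subst (asm) mult_le_cancel_left_pos) auto
  qed
  have "b - a - x / a * (y - x) = (a * b - 1 - x * y) / a"
    using a1 a2 by (simp add: field_simps power2_eq_square)
  also have "\<dots> \<le> ((y - x)\<^sup>2 / 2) / a"
    using ab a1 by (intro divide_right_mono) (auto simp: power2_eq_square field_simps)
  also have "\<dots> \<le> (y - x)\<^sup>2 / 2"
    using divide_left_mono[of 1 a "(y - x)\<^sup>2 / 2"] a1 by simp
  also have "\<dots> \<le> (y - x)\<^sup>2" by simp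
  finally have 1: "b - a - x / a * (y - x) \<le> \<bar>y - x\<bar> * \<bar>y - x\<bar>" by (simp add: power2_eq_square)
  have "b \<le> a + \<bar>y - x\<bar>"
  proof (rule power2_le_imp_le)
    have "y\<^sup>2 \<le> x\<^sup>2 + 2 * (\<bar>x\<bar> * \<bar>y - x\<bar>) + (y - x)\<^sup>2"
    proof -
      have "x * (y - x) \<le> \<bar>x\<bar> * \<bar>y - x\<bar>" by (metis abs_ge_self abs_mult)
      then show ?thesis by (simp add: power2_eq_square algebra_simps)
    qed
    also have "\<dots> \<le> x\<^sup>2 + 2 * (a * \<bar>y - x\<bar>) + (y - x)\<^sup>2" using xa by (simp add: mult_right_mono)
    finally show "b\<^sup>2 \<le> (a + \<bar>y - x\<bar>)\<^sup>2" by (simp add: a2 b2 power2_sum)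
  qed (use a1 in simp)
  moreover have "- (x / a * (y - x)) \<le> \<bar>y - x\<bar>"
  proof -
    have "- (x / a * (y - x)) \<le> \<bar>x / a\<bar> * \<bar>y - x\<bar>" by (metis abs_ge_minus_self abs_mult)
    also have "\<dots> \<le> 1 * \<bar>y - x\<bar>" using xa a1 by (intro mult_right_mono) auto
    finally show ?thesis by simp
  qed
  ultimately have 2: "b - a - x / a * (y - x) \<le> \<bar>y - x\<bar> * 2" by simp
  show ?thesis
    using 1 2 unfolding a_def[symmetric] b_def[symmetric] by (simp add: min_def)
qed

text \<open>
  A function whose integral over each set of \<open>F\<close> vanishes has conditional expectation 0, and
  \<open>F\<close>-measurable factors can be taken out.
\<close>

lemma integral_mult_conditionally_centred:
  assumes "finite_measure M" "subalgebra M F"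
    and D: "integrable M D" "\<And>A. A \<in> sets F \<Longrightarrow> (LINT \<omega>:A|M. D \<omega>) = (0::real)"
    and g: "g \<in> borel_measurable F" and gD: "integrable M (\<lambda>\<omega>. g \<omega> * D \<omega>)"
  shows "(\<integral>\<omega>. g \<omega> * D \<omega> \<partial>M) = 0"
proof -
  interpret finite_measure_subalgebra M F
    using assms(1,2) by (simp add: finite_measure_subalgebra_def finite_measure_subalgebra_axioms_def)
  have "AE \<omega> in M. real_cond_exp M F D \<omega> = 0"
    using D by (intro real_cond_exp_charact) (auto simp: set_lebesgue_integral_def)
  then have "(\<integral>\<omega>. g \<omega> * real_cond_exp M F D \<omega> \<partial>M) = 0"
    by (intro integral_eq_zero_AE) auto
  moreover have "D \<in> borel_measurable M" using D(1) by auto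
  ultimately show ?thesis using real_cond_exp_intg(2)[OF gD g] by simp
qed

text \<open>
  The remainder in the Taylor expansion along an equidistant partition: its first factor is
  controlled by the variation \<open>V\<close>, its second by the modulus of continuity of \<open>N\<close>.
\<close>

lemma partition_oscillation_tendsto_zero:
  fixes N :: "real \<Rightarrow> real"
  assumes t: "0 < t" and cont: "continuous_on {0..t} N"
    and var: "\<And>u v. 0 \<le> u \<Longrightarrow> u \<le> v \<Longrightarrow> v \<le> t \<Longrightarrow> \<bar>N v - N u\<bar> \<le> V v - V u"
  shows "(\<lambda>n. \<Sum>k<n. \<bar>N (real (Suc k) * t / n) - N (real k * t / n)\<bar> *
           min \<bar>N (real (Suc k) * t / n) - N (real k * t / n)\<bar> 2) \<longlonglongrightarrow> 0" (is "?R \<longlonglongrightarrow> 0")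
    and "(\<Sum>k<n. \<bar>N (real (Suc k) * t / n) - N (real k * t / n)\<bar> *
           min \<bar>N (real (Suc k) * t / n) - N (real k * t / n)\<bar> 2) \<le> 2 * (V t - V 0)"
proof -
  let ?d = "\<lambda>n k. \<bar>N (real (Suc k) * t / real n) - N (real k * t / real n)\<bar>"
  have V0: "0 \<le> V t - V 0" using var[of 0 t] t by force
  have bound: "?R n \<le> e * (V t - V 0)" if "0 \<le> e"
    "\<And>k. k < n \<Longrightarrow> min (?d n k) 2 \<le> e" for n e
  proof (cases "n = 0")
    case True
    then show ?thesis using that V0 by simp
  next
    case False
    have "?R n \<le> (\<Sum>k<n. (V (real (Suc k) * t / n) - V (real k * t / n)) * e)"
    proof (rule sum_mono)
      fix k assume "k \<in> {..<n}"
      then have k: "k < n" and "real (Suc k) \<le> n" by simp_all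
      then have "real (Suc k) * t / n \<le> real n * t / n"
        using t by (intro divide_right_mono mult_right_mono) auto
      then have 1: "real (Suc k) * t / n \<le> t" using False by simp
      have 2: "real k * t / n \<le> real (Suc k) * t / n"
        using t by (intro divide_right_mono mult_right_mono) auto
      have 3: "0 \<le> real k * t / n" using t by simp
      show "?d n k *
           min (?d n k) 2
         \<le> (V (real (Suc k) * t / n) - V (real k * t / n)) * e"
        using var[OF 3 2 1] that(2)[OF k] by (intro mult_mono) auto
    qed
    also have "\<dots> = (\<Sum>k<n. V (real (Suc k) * t / n) - V (real k * t / n)) * e"
      by (simp add: sum_distrib_right)
    also have "(\<Sum>k<n. V (real (Suc k) * t / n) - V (real k * t / n)) = V t - V 0"
      using False by (subst sum_lessThan_telescope) simp
    finally show ?thesis by (simp add: mult.commute)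
  qed
  show "?R n \<le> 2 * (V t - V 0)" by (rule bound) auto
  have uc: "uniformly_continuous_on {0..t} N"
    using cont by (intro compact_uniformly_continuous) auto
  show "?R \<longlonglongrightarrow> 0"
  proof (rule LIMSEQ_I)
    fix r :: real assume "0 < r"
    define e where "e = r / (V t - V 0 + 1)"
    have e: "0 < e" using \<open>0 < r\<close> V0 by (simp add: e_def)
    obtain d where d: "0 < d" "\<And>u v. u \<in> {0..t} \<Longrightarrow> v \<in> {0..t} \<Longrightarrow> dist v u < d \<Longrightarrow> dist (N v) (N u) < e"
      using uc e unfolding uniformly_continuous_on_def by metis
    obtain n0 :: nat where n0: "t / d < n0" using reals_Archimedean2 by blast
    show "\<exists>no. \<forall>n\<ge>no. norm (?R n - 0) < r"
    proof (intro exI[of _ n0] allI impI)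
      fix n assume n: "n0 \<le> n"
      have "0 < t / d" using t d by simp
      then have npos: "0 < real n" "t / d < real n" using n0 n by linarith+
      have tn: "t / n < d" using npos d by (simp add: field_simps)
      have "?R n \<le> e * (V t - V 0)"
      proof (rule bound)
        fix k assume k: "k < n"
        have le: "real j * t / n \<le> t" if "j \<le> n" for j
          using that npos t by (simp add: pos_divide_le_eq mult.commute)
        have "real (Suc k) * t / n - real k * t / n = t / n"
          using npos by (simp add: field_simps)
        then have "dist (real (Suc k) * t / n) (real k * t / n) < d"
          using tn t npos by (simp add: dist_real_def)
        then have "dist (N (real (Suc k) * t / n)) (N (real k * t / n)) < e"
          by (intro d(2)) (use le[of k] le[of "Suc k"] k t npos in auto)
        then show "min (?d n k) 2 \<le> e"
          by (simp add: dist_real_def)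
      qed (use e in simp)
      also have "\<dots> < r"
        using \<open>0 < r\<close> V0 by (simp add: e_def field_simps)
      finally have "?R n < r" .
      moreover have "0 \<le> ?R n" by (intro sum_nonneg) auto
      ultimately show "norm (?R n - 0) < r" by simp
    qed
  qed
qed

text \<open>
  The expansion of \<open>sqrt (1 + N\<^sup>2)\<close> with \<open>N = A' - A\<close> shows that \<open>N\<close> vanishes at each fixed
  time; continuity extends this from the rational times to the whole interval.
\<close>

theorem continuous_finite_variation_martingale_zero:
  fixes A A' :: "real \<Rightarrow> 'w \<Rightarrow> real"
  assumes "prob_space M" and sub: "\<And>t. t \<in> {0..T} \<Longrightarrow> subalgebra M (G t)"
    and mart: "martingale M G T (\<lambda>t \<omega>. A' t \<omega> - A t \<omega>)"
    and int: "\<And>t. t \<in> {0..T} \<Longrightarrow> integrable M (A t)" "\<And>t. t \<in> {0..T} \<Longrightarrow> integrable M (A' t)"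
    and A: "AE \<omega> in M. A 0 \<omega> = 0 \<and> continuous_on {0..T} (\<lambda>t. A t \<omega>) \<and> mono_on {0..T} (\<lambda>t. A t \<omega>)"
    and A': "AE \<omega> in M. A' 0 \<omega> = 0 \<and> continuous_on {0..T} (\<lambda>t. A' t \<omega>) \<and> mono_on {0..T} (\<lambda>t. A' t \<omega>)"
  shows "indistinguishable M T A' A"
proof -
  interpret prob_space M by fact
  define N where "N t \<omega> = A' t \<omega> - A t \<omega>" for t \<omega>
  have intN: "t \<in> {0..T} \<Longrightarrow> integrable M (N t)" for t
    unfolding N_def using int by auto
  have fixed: "AE \<omega> in M. N t \<omega> = 0" if t: "t \<in> {0<..T}" for t
  proof -
    have t0: "0 < t" "t \<le> T" using t by auto
    define p where "p n k = real k * t / real n" for n k :: nat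
    have p: "p n k \<in> {0..T}" if "k \<le> n" for n k
    proof -
      have "p n k \<le> t"
        using that t0 unfolding p_def
        by (cases "n = 0") (auto simp: pos_divide_le_eq mult.commute)
      then show ?thesis using t0 by (auto simp: p_def)
    qed
    \<comment> \<open>The derivative of \<open>sqrt (1 + x\<^sup>2)\<close>.\<close>
    define \<phi>' where "\<phi>' x = x / sqrt (1 + x\<^sup>2)" for x :: real
    have \<phi>'_le: "\<bar>\<phi>' x\<bar> \<le> 1" for x
      by (simp add: \<phi>'_def divide_le_eq_1 real_le_rsqrt add_pos_nonneg)
    have \<phi>'_meas: "\<phi>' \<in> borel_measurable borel" unfolding \<phi>'_def by measurable
    define \<Delta> where "\<Delta> n k \<omega> = N (p n (Suc k)) \<omega> - N (p n k) \<omega>" for n k \<omega>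
    have int\<Delta>: "integrable M (\<Delta> n k)" if "k < n" for n k
      unfolding \<Delta>_def using that by (intro Bochner_Integration.integrable_diff intN p) auto
    have [measurable]: "k < n \<Longrightarrow> \<Delta> n k \<in> borel_measurable M" for n k using int\<Delta> by blast
    have N_meas: "k \<le> n \<Longrightarrow> N (p n k) \<in> borel_measurable M" for n k using intN[OF p] by blast
    have int\<phi>: "integrable M (\<lambda>\<omega>. \<phi>' (N (p n k) \<omega>) * \<Delta> n k \<omega>)" if "k < n" for n k
    proof (rule Bochner_Integration.integrable_bound[OF int\<Delta>[OF that]])
      show "AE \<omega> in M. norm (\<phi>' (N (p n k) \<omega>) * \<Delta> n k \<omega>) \<le> norm (\<Delta> n k \<omega>)"
        using mult_right_mono[OF \<phi>'_le abs_ge_zero] by (simp add: abs_mult)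
      show "(\<lambda>\<omega>. \<phi>' (N (p n k) \<omega>) * \<Delta> n k \<omega>) \<in> borel_measurable M"
        using that int\<Delta>
        by (intro borel_measurable_times measurable_compose[OF N_meas \<phi>'_meas]) auto
    qed
    have zero: "(\<integral>\<omega>. \<phi>' (N (p n k) \<omega>) * \<Delta> n k \<omega> \<partial>M) = 0" if k: "k < n" for n k
    proof (rule integral_mult_conditionally_centred[where F="G (p n k)"])
      have pk: "p n k \<in> {0..T}" "p n (Suc k) \<in> {0..T}" "p n k \<le> p n (Suc k)"
        using k t0 p[of k n] p[of "Suc k" n] by (auto simp: p_def intro!: divide_right_mono mult_right_mono)
      show "finite_measure M" by unfold_locales
      show subG: "subalgebra M (G (p n k))" by (rule sub) fact
      have "N (p n k) \<in> borel_measurable (G (p n k))"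
        using mart pk unfolding martingale_def N_def by blast
      then show "(\<lambda>\<omega>. \<phi>' (N (p n k) \<omega>)) \<in> borel_measurable (G (p n k))"
        by (rule measurable_compose[OF _ \<phi>'_meas])
      fix B assume B: "B \<in> sets (G (p n k))"
      then have "B \<in> sets M" using subG by (auto simp: subalgebra_def)
      moreover have "(LINT \<omega>:B|M. N (p n (Suc k)) \<omega>) = (LINT \<omega>:B|M. N (p n k) \<omega>)"
        using mart pk B unfolding martingale_def N_def by auto
      moreover have "set_integrable M B (N (p n k))" "set_integrable M B (N (p n (Suc k)))"
        unfolding set_integrable_def
        by (intro integrable_mult_indicator \<open>B \<in> sets M\<close> intN pk)+
      ultimately show "(LINT \<omega>:B|M. \<Delta> n k \<omega>) = 0"
        unfolding \<Delta>_def by (simp add: set_integral_diff)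
    qed (use int\<Delta> int\<phi> k in auto)
    define R where "R n \<omega> = (\<Sum>k<n. \<bar>\<Delta> n k \<omega>\<bar> * min \<bar>\<Delta> n k \<omega>\<bar> 2)" for n \<omega>
    have R_meas: "R n \<in> borel_measurable M" for n
      unfolding R_def by measurable
    define V where "V t \<omega> = A t \<omega> + A' t \<omega>" for t \<omega>
    have osc: "AE \<omega> in M. (\<lambda>n. R n \<omega>) \<longlonglongrightarrow> 0 \<and> (\<forall>n. R n \<omega> \<le> 2 * (V t \<omega> - V 0 \<omega>))"
      using A A'
    proof eventually_elim
      case (elim \<omega>)
      have c: "continuous_on {0..t} (\<lambda>t. N t \<omega>)"
        unfolding N_def using elim t0 
        by (intro continuous_intros) (auto elim: continuous_on_subset)
      have v: "\<bar>N v \<omega> - N u \<omega>\<bar> \<le> V v \<omega> - V u \<omega>" if "0 \<le> u" "u \<le> v" "v \<le> t" for u v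
      proof -
        have "A u \<omega> \<le> A v \<omega>" "A' u \<omega> \<le> A' v \<omega>"
          using elim that t0 by (auto elim!: mono_onD)
        then show ?thesis by (simp add: N_def V_def)
      qed
      show ?case
        using partition_oscillation_tendsto_zero[OF t0(1) c, of "\<lambda>t. V t \<omega>", OF v]
        unfolding R_def \<Delta>_def p_def by auto
    qed
    have intV: "integrable M (\<lambda>\<omega>. 2 * (V t \<omega> - V 0 \<omega>))"
      unfolding V_def using int t0 by (intro integrable_mult_right Bochner_Integration.integrable_diff Bochner_Integration.integrable_add) auto
    have R0: "0 \<le> R n \<omega>" for n \<omega> unfolding R_def by (intro sum_nonneg) auto
    have R_lim: "AE \<omega> in M. (\<lambda>n. R n \<omega>) \<longlonglongrightarrow> 0"
      using osc by eventually_elim simp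
    have R_le: "AE \<omega> in M. norm (R n \<omega>) \<le> 2 * (V t \<omega> - V 0 \<omega>)" for n
      using osc by eventually_elim (use R0 in simp)
    have "(\<lambda>n. \<integral>\<omega>. R n \<omega> \<partial>M) \<longlonglongrightarrow> (\<integral>\<omega>. 0 \<partial>M)"
      by (rule integral_dominated_convergence[OF _ R_meas intV R_lim R_le]) simp
    then have lim: "(\<lambda>n. \<integral>\<omega>. R n \<omega> \<partial>M) \<longlonglongrightarrow> 0" by simp
    have intR: "integrable M (R n)" for n
    proof (rule Bochner_Integration.integrable_bound[OF intV R_meas])
      show "AE \<omega> in M. norm (R n \<omega>) \<le> norm (2 * (V t \<omega> - V 0 \<omega>))"
        using R_le[of n] by eventually_elim simp
    qed
    have int\<phi>t: "integrable M (\<lambda>\<omega>. sqrt (1 + (N t \<omega>)\<^sup>2) - 1)"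
    proof (rule Bochner_Integration.integrable_bound[OF intN])
      show "AE \<omega> in M. norm (sqrt (1 + (N t \<omega>)\<^sup>2) - 1) \<le> norm (N t \<omega>)"
        using sqrt_add_le_add_sqrt[of 1 "(N t \<omega>)\<^sup>2" for \<omega>] by (intro AE_I2) (simp add: diff_le_eq add.commute)
      show "t \<in> {0..T}" using t by auto
      then show "(\<lambda>\<omega>. sqrt (1 + (N t \<omega>)\<^sup>2) - 1) \<in> borel_measurable M"
        using borel_measurable_integrable[OF intN] by measurable
    qed
    have le: "(\<integral>\<omega>. sqrt (1 + (N t \<omega>)\<^sup>2) - 1 \<partial>M) \<le> (\<integral>\<omega>. R n \<omega> \<partial>M)" if "0 < n" for n
    proof -
      have "(\<integral>\<omega>. sqrt (1 + (N t \<omega>)\<^sup>2) - 1 \<partial>M) \<le>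
          (\<integral>\<omega>. (\<Sum>k<n. \<phi>' (N (p n k) \<omega>) * \<Delta> n k \<omega>) + R n \<omega> \<partial>M)"
      proof (rule integral_mono_AE[OF int\<phi>t])
        show "integrable M (\<lambda>\<omega>. (\<Sum>k<n. \<phi>' (N (p n k) \<omega>) * \<Delta> n k \<omega>) + R n \<omega>)"
          using int\<phi> intR by (intro Bochner_Integration.integrable_add Bochner_Integration.integrable_sum) auto
        show "AE \<omega> in M. sqrt (1 + (N t \<omega>)\<^sup>2) - 1 \<le> (\<Sum>k<n. \<phi>' (N (p n k) \<omega>) * \<Delta> n k \<omega>) + R n \<omega>"
          using A A'
        proof eventually_elim
          case (elim \<omega>)
          have "sqrt (1 + (N t \<omega>)\<^sup>2) - 1 = (\<Sum>k<n. sqrt (1 + (N (p n (Suc k)) \<omega>)\<^sup>2) - sqrt (1 + (N (p n k) \<omega>)\<^sup>2))"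
            using \<open>0 < n\<close> elim
            by (subst sum_lessThan_telescope) (simp add: p_def N_def)
          also have "\<dots> \<le> (\<Sum>k<n. \<phi>' (N (p n k) \<omega>) * \<Delta> n k \<omega> + \<bar>\<Delta> n k \<omega>\<bar> * min \<bar>\<Delta> n k \<omega>\<bar> 2)"
          proof (rule sum_mono)
            fix k
            show "sqrt (1 + (N (p n (Suc k)) \<omega>)\<^sup>2) - sqrt (1 + (N (p n k) \<omega>)\<^sup>2)
              \<le> \<phi>' (N (p n k) \<omega>) * \<Delta> n k \<omega> + \<bar>\<Delta> n k \<omega>\<bar> * min \<bar>\<Delta> n k \<omega>\<bar> 2"
              using sqrt_one_plus_square_taylor[of "N (p n (Suc k)) \<omega>" "N (p n k) \<omega>"]
              unfolding \<phi>'_def \<Delta>_def by linarith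
          qed
          finally show ?case by (simp add: R_def sum.distrib)
        qed
      qed
      also have "\<dots> = (\<Sum>k<n. \<integral>\<omega>. \<phi>' (N (p n k) \<omega>) * \<Delta> n k \<omega> \<partial>M) + (\<integral>\<omega>. R n \<omega> \<partial>M)"
        using int\<phi> intR by (subst Bochner_Integration.integral_add) (auto simp: Bochner_Integration.integral_sum)
      also have "\<dots> = (\<integral>\<omega>. R n \<omega> \<partial>M)" using zero by simp
      finally show ?thesis .
    qed
    have "(\<integral>\<omega>. sqrt (1 + (N t \<omega>)\<^sup>2) - 1 \<partial>M) \<le> 0"
      by (rule LIMSEQ_le_const[OF lim]) (use le in \<open>auto intro!: exI[of _ 1]\<close>)
    moreover have nn: "0 \<le> sqrt (1 + x\<^sup>2) - 1" for x :: real by simp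
    then have "0 \<le> (\<integral>\<omega>. sqrt (1 + (N t \<omega>)\<^sup>2) - 1 \<partial>M)" by (intro integral_nonneg_AE) auto
    ultimately have "(\<integral>\<omega>. sqrt (1 + (N t \<omega>)\<^sup>2) - 1 \<partial>M) = 0" by simp
    then have "AE \<omega> in M. sqrt (1 + (N t \<omega>)\<^sup>2) - 1 = 0"
      using nn by (subst (asm) integral_nonneg_eq_0_iff_AE[OF int\<phi>t]) auto
    then show ?thesis by eventually_elim simp
  qed
  let ?D = "\<rat> \<inter> {0<..<T}"
  have "AE \<omega> in M. \<forall>t\<in>?D. N t \<omega> = 0"
    using fixed by (subst AE_ball_countable) (auto simp: countable_rat)
  then show ?thesis
    unfolding indistinguishable_def using A A'
  proof eventually_elim
    case (elim \<omega>)
    have c: "continuous_on {0..T} (\<lambda>t. N t \<omega>)"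
      unfolding N_def using elim by (intro continuous_intros) auto
    show ?case
    proof
      fix t assume t: "t \<in> {0..T}"
      show "A' t \<omega> = A t \<omega>"
      proof (cases "T = 0")
        case True
        then show ?thesis using t elim by simp
      next
        case False
        then have T: "0 < T" using t by auto
        have "closure ({0<..<T} \<inter> \<rat>) = closure {0<..<T}"
          by (rule closure_open_Int_superset) (auto simp: Rats_closure_real)
        then have D: "closure ?D = {0..T}" using T by (simp add: Int_commute)
        have "N t \<omega> = 0"
          by (rule continuous_constant_on_closure[of ?D "\<lambda>t. N t \<omega>" 0])
             (use c elim D t in auto)
        then show ?thesis by (simp add: N_def)
      qed
    qed
  qed
qed

section \<open>The inverse of the stable subordinator\<close>

text \<open>The exponential Markov inequality for the Laplace transform.\<close>

lemma subordinator_lower_tail: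
  assumes "prob_space M" "stable_subordinator M \<beta> U" "0 \<le> r" "0 \<le> u"
  shows "measure M {\<omega> \<in> space M. U r \<omega> \<le> a} \<le> exp (u * a - r * u powr \<beta>)"
proof -
  interpret prob_space M by fact
  have [measurable]: "U r \<in> borel_measurable M" using assms by (auto simp: stable_subordinator_def)
  have lap: "(\<integral>\<omega>. exp (- (u * U r \<omega>)) \<partial>M) = exp (- (r * u powr \<beta>))"
    using assms by (auto simp: stable_subordinator_def)
  \<comment> \<open>The transform is strictly positive, whereas a non-integrable function has integral 0.\<close>
  then have int: "integrable M (\<lambda>\<omega>. exp (- (u * U r \<omega>)))"
    using not_integrable_integral_eq by (metis exp_not_eq_zero)
  have "measure M {\<omega> \<in> space M. U r \<omega> \<le> a} = (\<integral>\<omega>. indicator {\<omega> \<in> space M. U r \<omega> \<le> a} \<omega> \<partial>M)"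
    by simp
  also have "\<dots> \<le> (\<integral>\<omega>. exp (u * a) * exp (- (u * U r \<omega>)) \<partial>M)"
  proof (rule integral_mono)
    fix \<omega> assume "\<omega> \<in> space M"
    show "indicator {\<omega> \<in> space M. U r \<omega> \<le> a} \<omega> \<le> exp (u * a) * exp (- (u * U r \<omega>))"
      using mult_left_mono[of "U r \<omega>" a u] \<open>0 \<le> u\<close>
      by (auto simp: indicator_def exp_add[symmetric])
  qed (use int in \<open>auto simp: integrable_indicator_iff less_top[symmetric]\<close>)
  also have "\<dots> = exp (u * a) * exp (- (r * u powr \<beta>))" using lap by simp
  finally show ?thesis by (simp add: exp_add[symmetric])
qed

text \<open>
  Letting the argument of the Laplace transform tend to infinity shows that an increment over an
  interval of positive length has no atom at 0. Monotonicity carries the strict inequality from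
  rational to real times.
\<close>

lemma subordinator_strictly_increasing:
  assumes "prob_space M" and U: "stable_subordinator M \<beta> U" and "0 < \<beta>"
  shows "AE \<omega> in M. \<forall>\<sigma> \<tau>. 0 \<le> \<sigma> \<and> \<sigma> < \<tau> \<longrightarrow> U \<sigma> \<omega> < U \<tau> \<omega>"
proof -
  interpret prob_space M by fact
  have meas: "0 \<le> r \<Longrightarrow> U r \<in> borel_measurable M" for r using U by (auto simp: stable_subordinator_def)
  \<comment> \<open>The argument \<open>u = n\<^sup>1\<^sup>/\<^sup>\<beta>\<close> turns the exponent \<open>r u\<^sup>\<beta>\<close> into \<open>r n\<close>.\<close>
  have zero: "measure M {\<omega> \<in> space M. U r \<omega> \<le> 0} = 0" if "0 < r" for r
  proof -
    have "measure M {\<omega> \<in> space M. U r \<omega> \<le> 0} \<le> exp (- (r * real n))" for n :: nat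
      using subordinator_lower_tail[OF assms(1) U, of r "real n powr (1 / \<beta>)" 0] that \<open>0 < \<beta>\<close>
      by (simp add: powr_powr)
    moreover have "(\<lambda>n. exp (- (r * real n))) \<longlonglongrightarrow> 0"
      using that by (intro filterlim_compose[OF exp_at_bot] filterlim_uminus_at_top_at_bot
        filterlim_compose[OF filterlim_uminus_at_bot_at_top]
        filterlim_tendsto_pos_mult_at_top[OF tendsto_const _ filterlim_real_sequentially])
    ultimately have "measure M {\<omega> \<in> space M. U r \<omega> \<le> 0} \<le> 0"
      by (intro LIMSEQ_le_const) auto
    then show ?thesis by (simp add: measure_le_0_iff)
  qed
  have pos: "AE \<omega> in M. U \<sigma> \<omega> < U \<tau> \<omega>" if st: "0 \<le> \<sigma>" "\<sigma> < \<tau>" for \<sigma> \<tau>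
  proof -
    have [measurable]: "U \<sigma> \<in> borel_measurable M" "U \<tau> \<in> borel_measurable M"
      "U (\<tau> - \<sigma>) \<in> borel_measurable M"
      using meas st by auto
    have "distr M borel (\<lambda>\<omega>. U \<tau> \<omega> - U \<sigma> \<omega>) = distr M borel (U (\<tau> - \<sigma>))"
      using U st by (auto simp: stable_subordinator_def)
    then have "measure (distr M borel (\<lambda>\<omega>. U \<tau> \<omega> - U \<sigma> \<omega>)) {..0} = measure (distr M borel (U (\<tau> - \<sigma>))) {..0}"
      by simp
    then have "measure M {\<omega> \<in> space M. U \<tau> \<omega> - U \<sigma> \<omega> \<le> 0} = measure M {\<omega> \<in> space M. U (\<tau> - \<sigma>) \<omega> \<le> 0}"
      by (subst (asm) (1 2) measure_distr) (auto simp: vimage_def Int_def conj_commute)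
    also have "\<dots> = 0" using st by (intro zero) auto
    finally have "AE \<omega> in M. \<omega> \<notin> {\<omega> \<in> space M. U \<tau> \<omega> - U \<sigma> \<omega> \<le> 0}"
      by (subst (asm) prob_eq_0) auto
    then show ?thesis using AE_space by eventually_elim simp
  qed
  have rat: "AE \<omega> in M. \<forall>(p, q) \<in> {(p, q). p \<in> \<rat> \<and> q \<in> \<rat> \<and> 0 \<le> p \<and> p < q}. U p \<omega> < U q \<omega>"
  proof (subst AE_ball_countable)
    show "countable {(p, q). p \<in> \<rat> \<and> q \<in> \<rat> \<and> 0 \<le> p \<and> p < (q::real)}"
      by (rule countable_subset[of _ "\<rat> \<times> \<rat>"]) (auto intro: countable_rat)
  qed (use pos in auto)
  have "AE \<omega> in M. mono_on {0..} (\<lambda>\<tau>. U \<tau> \<omega>)"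
    using U unfolding stable_subordinator_def by (auto elim: eventually_mono)
  with rat show ?thesis
  proof eventually_elim
    case (elim \<omega>)
    show ?case
    proof (intro allI impI)
      fix \<sigma> \<tau> :: real assume st: "0 \<le> \<sigma> \<and> \<sigma> < \<tau>"
      obtain p where p: "p \<in> \<rat>" "\<sigma> < p" "p < \<tau>" using Rats_dense_in_real[of \<sigma> \<tau>] st by auto
      obtain q where q: "q \<in> \<rat>" "p < q" "q < \<tau>" using Rats_dense_in_real[of p \<tau>] p by auto
      have "U \<sigma> \<omega> \<le> U p \<omega>" using elim(2) p st by (auto elim!: mono_onD)
      also have "U p \<omega> < U q \<omega>" using elim(1) p q st by auto
      also have "U q \<omega> \<le> U \<tau> \<omega>" using elim(2) p q st by (auto elim!: mono_onD)
      finally show "U \<sigma> \<omega> < U \<tau> \<omega>" .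
    qed
  qed
qed

text \<open>The lower tail bound \<open>P (U m \<le> n) \<le> exp (n - m)\<close> tends to 0 as \<open>m\<close> grows.\<close>

lemma subordinator_unbounded:
  assumes "prob_space M" and U: "stable_subordinator M \<beta> U"
  shows "AE \<omega> in M. \<forall>a. \<exists>m::nat. a < U m \<omega>"
proof -
  interpret prob_space M by fact
  have [measurable]: "U (real m) \<in> borel_measurable M" for m :: nat
    using U by (auto simp: stable_subordinator_def)
  have "AE \<omega> in M. \<exists>m::nat. real n < U m \<omega>" for n :: nat
  proof -
    have "measure M {\<omega> \<in> space M. \<forall>m::nat. U m \<omega> \<le> n} \<le> exp (real n - real m)" for m :: nat
    proof -
      have "measure M {\<omega> \<in> space M. \<forall>m::nat. U m \<omega> \<le> n} \<le> measure M {\<omega> \<in> space M. U m \<omega> \<le> n}"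
        by (intro finite_measure_mono) auto
      also have "\<dots> \<le> exp (real n - real m)"
        using subordinator_lower_tail[OF assms, of m 1 n] by simp
      finally show ?thesis .
    qed
    moreover have "(\<lambda>m. exp (real n - real m)) \<longlonglongrightarrow> 0"
    proof -
      have "(\<lambda>m. exp (real n) * inverse (exp 1 ^ m)) \<longlonglongrightarrow> exp (real n) * 0"
        by (intro tendsto_intros LIMSEQ_inverse_realpow_zero) simp
      then show ?thesis by (simp add: exp_diff exp_of_nat_mult[symmetric] divide_inverse)
    qed
    ultimately have "measure M {\<omega> \<in> space M. \<forall>m::nat. U m \<omega> \<le> n} \<le> 0"
      by (intro LIMSEQ_le_const) auto
    then have "measure M {\<omega> \<in> space M. \<forall>m::nat. U m \<omega> \<le> n} = 0" by (simp add: measure_le_0_iff)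
    then have "AE \<omega> in M. \<omega> \<notin> {\<omega> \<in> space M. \<forall>m::nat. U m \<omega> \<le> n}"
      by (subst (asm) prob_eq_0) auto
    then show ?thesis using AE_space by eventually_elim (simp add: not_le)
  qed
  then have "AE \<omega> in M. \<forall>n::nat. \<exists>m::nat. real n < U m \<omega>" by (simp add: AE_all_countable)
  then show ?thesis
    by eventually_elim (meson reals_Archimedean2 less_trans)
qed

text \<open>
  Strict monotonicity gives \<open>e (u \<sigma>) = \<sigma>\<close>. Hence \<open>e\<close> is a monotone map onto the half-line, and
  jumps of \<open>u\<close> become flat pieces of \<open>e\<close>.
\<close>

lemma inverse_of_strictly_increasing:
  fixes u :: "real \<Rightarrow> real" and e :: "real \<Rightarrow> real"
  assumes u0: "u 0 = 0" and strict: "\<And>\<sigma> \<tau>. 0 \<le> \<sigma> \<Longrightarrow> \<sigma> < \<tau> \<Longrightarrow> u \<sigma> < u \<tau>"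
    and unb: "\<And>a. \<exists>m::nat. a < u m"
    and e: "e = (\<lambda>t. Inf {\<tau>. 0 < \<tau> \<and> t < u \<tau>})"
  shows "e 0 = 0" "continuous_on {0..} e" "mono_on {0..} e" "0 < \<tau> \<Longrightarrow> t < u \<tau> \<Longrightarrow> e t \<le> \<tau>"
proof -
  have bdd: "bdd_below {\<tau>. 0 < \<tau> \<and> t < u \<tau>}" for t by (intro bdd_belowI[of _ 0]) auto
  have ne: "{\<tau>. 0 < \<tau> \<and> t < u \<tau>} \<noteq> {}" for t
  proof -
    obtain m :: nat where "max t 0 < u m" using unb by blast
    then have "0 < real m" "t < u m" using u0 by (cases m; auto)+
    then show ?thesis by blast
  qed
  show "0 < \<tau> \<Longrightarrow> t < u \<tau> \<Longrightarrow> e t \<le> \<tau>" unfolding e by (intro cInf_lower bdd) auto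
  have e_u: "e (u \<sigma>) = \<sigma>" if "0 \<le> \<sigma>" for \<sigma>
  proof -
    have "{\<tau>. 0 < \<tau> \<and> u \<sigma> < u \<tau>} = {\<sigma><..}"
      using strict that by (auto, metis less_asym linorder_neqE_linordered_idom less_imp_le)
    then show ?thesis by (simp add: e)
  qed
  show e0: "e 0 = 0" using e_u[of 0] u0 by simp
  have mono: "e s \<le> e t" if "s \<le> t" for s t
    unfolding e using that by (intro cInf_superset_mono ne bdd) auto
  then show "mono_on {0..} e" by (auto simp: mono_on_def)
  \<comment> \<open>Extended by the identity to the left, the inverse is a monotone surjection of the line,
    and such a function cannot jump.\<close>
  define e' where "e' t = (if t < 0 then t else e t)" for t
  have nonneg: "0 \<le> e t" if "0 \<le> t" for t using mono[OF that] e0 by simp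
  have "continuous_on UNIV e'"
  proof (rule continuous_onI_mono)
    have "x \<in> range e'" for x
    proof (cases "x < 0")
      case True
      then show ?thesis by (intro range_eqI[of _ _ x]) (simp add: e'_def)
    next
      case False
      then have "0 \<le> u x" using strict[of 0 x] u0 by (cases "x = 0") auto
      then show ?thesis using False by (intro range_eqI[of _ _ "u x"]) (simp add: e'_def e_u)
    qed
    then have "range e' = UNIV" by blast
    then show "open (range e')" by simp
  qed (use mono nonneg in \<open>auto simp: e'_def intro: order_trans[of _ 0]\<close>)
  then have "continuous_on {0..} e'" by (rule continuous_on_subset) simp
  then show "continuous_on {0..} e"
    by (rule continuous_on_cong[THEN iffD1, rotated 2]) (auto simp: e'_def)
qed

lemma inverse_subordinator_paths:
  assumes "prob_space M" and U: "stable_subordinator M \<beta> U" and "0 < \<beta>"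
  shows "AE \<omega> in M. inverse_process U 0 \<omega> = 0 \<and>
      continuous_on {0..} (\<lambda>t. inverse_process U t \<omega>) \<and>
      mono_on {0..} (\<lambda>t. inverse_process U t \<omega>)"
proof -
  have "AE \<omega> in M. U 0 \<omega> = 0" using U by (simp add: stable_subordinator_def)
  with subordinator_strictly_increasing[OF assms] subordinator_unbounded[OF assms(1,2)]
  show ?thesis
  proof eventually_elim
    case (elim \<omega>)
    show ?case
      using inverse_of_strictly_increasing[of "\<lambda>\<tau>. U \<tau> \<omega>" "\<lambda>t. inverse_process U t \<omega>"] elim
      by (simp add: inverse_process_def[abs_def])
  qed
qed

text \<open>
  The inverse at time \<open>t\<close> is at most the number of integers \<open>n\<close> with \<open>U n \<le> t\<close>, and the
  probabilities of these events decay geometrically.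
\<close>

lemma inverse_subordinator_integrable:
  assumes "prob_space M" and U: "stable_subordinator M \<beta> U" and "0 < \<beta>"
    and "0 \<le> t" and meas: "inverse_process U t \<in> borel_measurable M"
  shows "integrable M (inverse_process U t)"
proof -
  interpret prob_space M by fact
  let ?S = "\<lambda>n. {\<omega> \<in> space M. U (real n) \<omega> \<le> t}"
  have [measurable]: "U (real m) \<in> borel_measurable M" for m :: nat
    using U by (auto simp: stable_subordinator_def)
  have "AE \<omega> in M. U 0 \<omega> = 0" using U by (simp add: stable_subordinator_def)
  with subordinator_strictly_increasing[OF assms(1-3)] subordinator_unbounded[OF assms(1,2)]
  have le: "AE \<omega> in M. ennreal (inverse_process U t \<omega>) \<le> (\<Sum>n. indicator (?S n) \<omega>)"
    using AE_space
  proof eventually_elim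
    case (elim \<omega>)
    \<comment> \<open>All integers below the first passage over \<open>t\<close> are counted.\<close>
    define m where "m = (LEAST m::nat. t < U m \<omega>)"
    have m: "t < U m \<omega>" unfolding m_def by (rule LeastI_ex) (use elim in blast)
    then have "m \<noteq> 0" using elim \<open>0 \<le> t\<close> by (cases m) auto
    have "inverse_process U t \<omega> \<le> m"
      using inverse_of_strictly_increasing(4)[of "\<lambda>\<tau>. U \<tau> \<omega>" "\<lambda>t. inverse_process U t \<omega>" m t] elim m \<open>m \<noteq> 0\<close>
      by (simp add: inverse_process_def[abs_def])
    then have "ennreal (inverse_process U t \<omega>) \<le> ennreal (real m)" by (rule ennreal_leI)
    also have "\<dots> = (\<Sum>n<m. 1)" by (simp add: ennreal_of_nat_eq_real_of_nat)
    also have "\<dots> = (\<Sum>n<m. indicator (?S n) \<omega>)"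
    proof (rule sum.cong[OF refl])
      fix n assume "n \<in> {..<m}"
      then have "\<not> t < U n \<omega>" unfolding m_def using not_less_Least by fastforce
      then show "1 = (indicator (?S n) \<omega> :: ennreal)" using elim by simp
    qed
    also have "\<dots> \<le> (\<Sum>n. indicator (?S n) \<omega>)" by (intro sum_le_suminf) auto
    finally show ?case .
  qed
  have "(\<integral>\<^sup>+ \<omega>. ennreal (inverse_process U t \<omega>) \<partial>M) \<le> (\<integral>\<^sup>+ \<omega>. (\<Sum>n. indicator (?S n) \<omega>) \<partial>M)"
    by (rule nn_integral_mono_AE[OF le])
  also have "\<dots> = (\<Sum>n. emeasure M (?S n))"
    by (subst nn_integral_suminf) auto
  also have "\<dots> \<le> (\<Sum>n. ennreal (exp t * (exp (- 1)) ^ n))"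
  proof (rule suminf_le)
    fix n
    show "emeasure M (?S n) \<le> ennreal (exp t * (exp (- 1)) ^ n)"
      using subordinator_lower_tail[OF assms(1,2), of n 1 t]
      by (simp add: emeasure_eq_measure exp_diff exp_of_nat_mult[symmetric] exp_minus divide_inverse
          power_inverse)
  qed auto
  also have "\<dots> = ennreal (\<Sum>n. exp t * (exp (- 1)) ^ n)"
    by (intro suminf_ennreal2 summable_mult summable_geometric) auto
  also have "\<dots> < \<infinity>" by simp
  finally have fin: "(\<integral>\<^sup>+ \<omega>. ennreal (inverse_process U t \<omega>) \<partial>M) < \<infinity>" .
  have "AE \<omega> in M. 0 \<le> inverse_process U t \<omega>"
    using inverse_subordinator_paths[OF assms(1-3)]
  proof eventually_elim
    case (elim \<omega>)
    then show ?case using mono_onD[of "{0..}" "\<lambda>t. inverse_process U t \<omega>" 0 t] \<open>0 \<le> t\<close> by simp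
  qed
  then show ?thesis by (rule integrableI_nonneg[OF meas _ fin])
qed

section \<open>Mean square limits\<close>

lemma square_diff_le: "(a - b)\<^sup>2 \<le> 2 * a\<^sup>2 + 2 * b\<^sup>2" for a b :: real
  using zero_le_power2[of "a + b"] by (simp add: power2_eq_square algebra_simps)

lemma integrable_mult_of_square_integrable:
  fixes g h :: "'w \<Rightarrow> real"
  assumes [measurable]: "g \<in> borel_measurable M" "h \<in> borel_measurable M"
    and "integrable M (\<lambda>\<omega>. (g \<omega>)\<^sup>2)" "integrable M (\<lambda>\<omega>. (h \<omega>)\<^sup>2)"
  shows "integrable M (\<lambda>\<omega>. g \<omega> * h \<omega>)"
proof (rule Bochner_Integration.integrable_bound)
  show "integrable M (\<lambda>\<omega>. (g \<omega>)\<^sup>2 + (h \<omega>)\<^sup>2)" using assms by auto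
  have "\<bar>a * b\<bar> \<le> a\<^sup>2 + b\<^sup>2" for a b :: real
    using sum_squares_bound[of "\<bar>a\<bar>" "\<bar>b\<bar>"] abs_ge_zero[of "a * b"]
    unfolding abs_mult power2_abs mult.assoc by linarith
  then show "AE \<omega> in M. norm (g \<omega> * h \<omega>) \<le> norm ((g \<omega>)\<^sup>2 + (h \<omega>)\<^sup>2)"
    by (intro AE_I2) simp
qed measurable

lemma set_integral_whole_space: "(LINT \<omega>:space M|M. g \<omega>) = (\<integral>\<omega>. g \<omega> \<partial>M)" for g :: "'w \<Rightarrow> real"
  unfolding set_lebesgue_integral_def by (intro Bochner_Integration.integral_cong) auto

text \<open>
  Fatou applied to \<open>(x n - x m)\<^sup>2\<close> as \<open>m\<close> tends to infinity: an almost sure limit of an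
  \<open>L\<^sup>2\<close>-Cauchy sequence is also its limit in \<open>L\<^sup>2\<close>, with the same rate.
\<close>

lemma L2_cauchy_limit:
  fixes x :: "nat \<Rightarrow> 'w \<Rightarrow> real"
  assumes meas: "\<And>n. x n \<in> borel_measurable M" "y \<in> borel_measurable M"
    and int: "\<And>n. integrable M (\<lambda>\<omega>. (x n \<omega>)\<^sup>2)"
    and lim: "AE \<omega> in M. (\<lambda>n. x n \<omega>) \<longlonglongrightarrow> y \<omega>"
    and cauchy: "\<And>n m. n \<le> m \<Longrightarrow> (\<integral>\<omega>. (x n \<omega> - x m \<omega>)\<^sup>2 \<partial>M) \<le> \<epsilon> n"
  shows "integrable M (\<lambda>\<omega>. (x n \<omega> - y \<omega>)\<^sup>2)" "(\<integral>\<omega>. (x n \<omega> - y \<omega>)\<^sup>2 \<partial>M) \<le> \<epsilon> n"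
    "integrable M (\<lambda>\<omega>. (y \<omega>)\<^sup>2)"
proof -
  note [measurable] = meas
  have int_diff: "integrable M (\<lambda>\<omega>. (x n \<omega> - x m \<omega>)\<^sup>2)" for n m
  proof (rule Bochner_Integration.integrable_bound)
    show "integrable M (\<lambda>\<omega>. 2 * (x n \<omega>)\<^sup>2 + 2 * (x m \<omega>)\<^sup>2)" using int by auto
    show "AE \<omega> in M. norm ((x n \<omega> - x m \<omega>)\<^sup>2) \<le> norm (2 * (x n \<omega>)\<^sup>2 + 2 * (x m \<omega>)\<^sup>2)"
      by (intro AE_I2) (simp add: square_diff_le)
  qed measurable
  have "0 \<le> \<epsilon> n" for n
    using cauchy[of n n] by simp
  have nn: "(\<integral>\<^sup>+\<omega>. ennreal ((x n \<omega> - y \<omega>)\<^sup>2) \<partial>M) \<le> ennreal (\<epsilon> n)" for n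
  proof -
    have "(\<integral>\<^sup>+\<omega>. ennreal ((x n \<omega> - y \<omega>)\<^sup>2) \<partial>M) = (\<integral>\<^sup>+\<omega>. liminf (\<lambda>m. ennreal ((x n \<omega> - x m \<omega>)\<^sup>2)) \<partial>M)"
    proof (rule nn_integral_cong_AE)
      show "AE \<omega> in M. ennreal ((x n \<omega> - y \<omega>)\<^sup>2) = liminf (\<lambda>m. ennreal ((x n \<omega> - x m \<omega>)\<^sup>2))"
        using lim
      proof eventually_elim
        case (elim \<omega>)
        then have "(\<lambda>m. ennreal ((x n \<omega> - x m \<omega>)\<^sup>2)) \<longlonglongrightarrow> ennreal ((x n \<omega> - y \<omega>)\<^sup>2)"
          by (intro tendsto_ennrealI tendsto_intros)
        then show ?case by (rule lim_imp_Liminf[OF sequentially_bot, symmetric])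
      qed
    qed
    also have "\<dots> \<le> liminf (\<lambda>m. \<integral>\<^sup>+\<omega>. ennreal ((x n \<omega> - x m \<omega>)\<^sup>2) \<partial>M)"
      by (rule nn_integral_liminf) measurable
    also have "\<dots> \<le> liminf (\<lambda>m. ennreal (\<epsilon> n))"
    proof (rule Liminf_mono)
      show "\<forall>\<^sub>F m in sequentially. (\<integral>\<^sup>+\<omega>. ennreal ((x n \<omega> - x m \<omega>)\<^sup>2) \<partial>M) \<le> ennreal (\<epsilon> n)"
        using eventually_ge_at_top[of n]
        by eventually_elim (use int_diff cauchy in \<open>simp add: nn_integral_eq_integral ennreal_leI\<close>)
    qed
    also have "\<dots> = ennreal (\<epsilon> n)" by (simp add: Liminf_const)
    finally show ?thesis .
  qed
  show int_y: "integrable M (\<lambda>\<omega>. (x n \<omega> - y \<omega>)\<^sup>2)" for n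
    by (rule integrableI_nonneg) (use le_less_trans[OF nn[of n] ennreal_less_top] in auto)
  show "(\<integral>\<omega>. (x n \<omega> - y \<omega>)\<^sup>2 \<partial>M) \<le> \<epsilon> n"
    using nn[of n] \<open>0 \<le> \<epsilon> n\<close> by (subst (asm) nn_integral_eq_integral[OF int_y]) auto
  show "integrable M (\<lambda>\<omega>. (y \<omega>)\<^sup>2)"
  proof (rule Bochner_Integration.integrable_bound)
    show "integrable M (\<lambda>\<omega>. 2 * (x 0 \<omega>)\<^sup>2 + 2 * (x 0 \<omega> - y \<omega>)\<^sup>2)" using int int_y by auto
    have "b\<^sup>2 \<le> 2 * a\<^sup>2 + 2 * (a - b)\<^sup>2" for a b :: real
      using square_diff_le[of a "a - b"] by simp
    then show "AE \<omega> in M. norm ((y \<omega>)\<^sup>2) \<le> norm (2 * (x 0 \<omega>)\<^sup>2 + 2 * (x 0 \<omega> - y \<omega>)\<^sup>2)"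
      by (intro AE_I2) simp
  qed measurable
qed

text \<open>For \<open>\<delta> > 0\<close>, \<open>\<bar>a\<^sup>2 - b\<^sup>2\<bar> \<le> (1 + 1/\<delta>) (a - b)\<^sup>2 + \<delta> b\<^sup>2\<close>.\<close>

lemma L2_limit_square_integral:
  fixes x :: "nat \<Rightarrow> 'w \<Rightarrow> real"
  assumes int: "\<And>n. integrable M (\<lambda>\<omega>. (x n \<omega>)\<^sup>2)" "integrable M (\<lambda>\<omega>. (y \<omega>)\<^sup>2)"
    and diff: "\<And>n. integrable M (\<lambda>\<omega>. (x n \<omega> - y \<omega>)\<^sup>2)" "\<And>n. (\<integral>\<omega>. (x n \<omega> - y \<omega>)\<^sup>2 \<partial>M) \<le> \<epsilon> n"
    and \<epsilon>: "\<epsilon> \<longlonglongrightarrow> 0" and A: "A \<in> sets M"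
  shows "(\<lambda>n. LINT \<omega>:A|M. (x n \<omega>)\<^sup>2) \<longlonglongrightarrow> (LINT \<omega>:A|M. (y \<omega>)\<^sup>2)"
proof (rule LIMSEQ_I)
  fix r :: real assume "0 < r"
  define Y where "Y = (\<integral>\<omega>. (y \<omega>)\<^sup>2 \<partial>M)"
  have Y: "0 \<le> Y" unfolding Y_def by simp
  define \<delta> where "\<delta> = r / (2 * (Y + 1))"
  have \<delta>: "0 < \<delta>" "\<delta> * Y < r / 2"
    using \<open>0 < r\<close> Y by (auto simp: \<delta>_def field_simps)
  have "(\<lambda>n. (1 + 1 / \<delta>) * \<epsilon> n) \<longlonglongrightarrow> (1 + 1 / \<delta>) * 0" by (intro tendsto_intros \<epsilon>)
  then have "\<forall>\<^sub>F n in sequentially. (1 + 1 / \<delta>) * \<epsilon> n < r / 2"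
    using \<open>0 < r\<close> by (intro order_tendstoD(2)) auto
  then obtain n0 where n0: "\<And>n. n0 \<le> n \<Longrightarrow> (1 + 1 / \<delta>) * \<epsilon> n < r / 2"
    by (auto simp: eventually_sequentially)
  have pt: "\<bar>a\<^sup>2 - b\<^sup>2\<bar> \<le> (1 + 1 / \<delta>) * (a - b)\<^sup>2 + \<delta> * b\<^sup>2" for a b :: real
  proof -
    have "2 * (\<bar>b\<bar> * \<bar>a - b\<bar>) \<le> (a - b)\<^sup>2 / \<delta> + \<delta> * b\<^sup>2"
    proof -
      have sq: "(c - \<delta> * d)\<^sup>2 / \<delta> = c\<^sup>2 / \<delta> - 2 * (d * c) + \<delta> * d\<^sup>2" for c d
        using \<delta> by (simp add: power2_eq_square field_simps)
      have "0 \<le> (\<bar>a - b\<bar> - \<delta> * \<bar>b\<bar>)\<^sup>2 / \<delta>" using \<delta> by simp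
      also have "\<dots> = (a - b)\<^sup>2 / \<delta> - 2 * (\<bar>b\<bar> * \<bar>a - b\<bar>) + \<delta> * b\<^sup>2"
        unfolding sq by simp
      finally show ?thesis by simp
    qed
    moreover have "\<bar>a\<^sup>2 - b\<^sup>2\<bar> \<le> (a - b)\<^sup>2 + 2 * (\<bar>b\<bar> * \<bar>a - b\<bar>)"
    proof -
      have "a\<^sup>2 - b\<^sup>2 = (a - b)\<^sup>2 + 2 * (b * (a - b))" by (simp add: power2_eq_square algebra_simps)
      then have "\<bar>a\<^sup>2 - b\<^sup>2\<bar> \<le> \<bar>(a - b)\<^sup>2\<bar> + \<bar>2 * (b * (a - b))\<bar>" by (metis abs_triangle_ineq)
      then show ?thesis by (simp add: abs_mult)
    qed
    ultimately show ?thesis by (simp add: distrib_right)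
  qed
  show "\<exists>no. \<forall>n\<ge>no. norm ((LINT \<omega>:A|M. (x n \<omega>)\<^sup>2) - (LINT \<omega>:A|M. (y \<omega>)\<^sup>2)) < r"
  proof (intro exI[of _ n0] allI impI)
    fix n assume n: "n0 \<le> n"
    have sx: "set_integrable M A (\<lambda>\<omega>. (x n \<omega>)\<^sup>2)" "set_integrable M A (\<lambda>\<omega>. (y \<omega>)\<^sup>2)"
      unfolding set_integrable_def by (intro integrable_mult_indicator A int)+
    have "norm ((LINT \<omega>:A|M. (x n \<omega>)\<^sup>2) - (LINT \<omega>:A|M. (y \<omega>)\<^sup>2))
        = norm (\<integral>\<omega>. indicator A \<omega> *\<^sub>R ((x n \<omega>)\<^sup>2 - (y \<omega>)\<^sup>2) \<partial>M)"
      using set_integral_diff[OF sx] by (simp add: set_lebesgue_integral_def)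
    also have "\<dots> \<le> (\<integral>\<omega>. norm (indicator A \<omega> *\<^sub>R ((x n \<omega>)\<^sup>2 - (y \<omega>)\<^sup>2)) \<partial>M)"
      by (rule integral_norm_bound)
    also have "\<dots> \<le> (\<integral>\<omega>. (1 + 1 / \<delta>) * (x n \<omega> - y \<omega>)\<^sup>2 + \<delta> * (y \<omega>)\<^sup>2 \<partial>M)"
    proof (rule integral_mono)
      show "integrable M (\<lambda>\<omega>. norm (indicator A \<omega> *\<^sub>R ((x n \<omega>)\<^sup>2 - (y \<omega>)\<^sup>2)))"
        by (intro integrable_norm integrable_mult_indicator A Bochner_Integration.integrable_diff int)
      show "integrable M (\<lambda>\<omega>. (1 + 1 / \<delta>) * (x n \<omega> - y \<omega>)\<^sup>2 + \<delta> * (y \<omega>)\<^sup>2)"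
        by (intro Bochner_Integration.integrable_add integrable_mult_right diff int)
      show "norm (indicator A \<omega> *\<^sub>R ((x n \<omega>)\<^sup>2 - (y \<omega>)\<^sup>2)) \<le> (1 + 1 / \<delta>) * (x n \<omega> - y \<omega>)\<^sup>2 + \<delta> * (y \<omega>)\<^sup>2" for \<omega>
        using pt[of "x n \<omega>" "y \<omega>"] \<delta>(1) by (auto simp: indicator_def)
    qed
    also have "\<dots> = (1 + 1 / \<delta>) * (\<integral>\<omega>. (x n \<omega> - y \<omega>)\<^sup>2 \<partial>M) + \<delta> * Y"
      using diff(1) int(2) by (simp add: Y_def)
    also have "\<dots> \<le> (1 + 1 / \<delta>) * \<epsilon> n + \<delta> * Y"
      using \<delta>(1) by (intro add_right_mono mult_left_mono diff) auto
    also have "\<dots> < r" using add_strict_mono[OF n0[OF n] \<delta>(2)] by simp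
    finally show "norm ((LINT \<omega>:A|M. (x n \<omega>)\<^sup>2) - (LINT \<omega>:A|M. (y \<omega>)\<^sup>2)) < r" .
  qed
qed

lemma (in finite_measure) integrable_of_square_integrable:
  fixes y :: "'a \<Rightarrow> real"
  assumes "y \<in> borel_measurable M" "integrable M (\<lambda>\<omega>. (y \<omega>)\<^sup>2)"
  shows "integrable M y"
proof (rule Bochner_Integration.integrable_bound)
  show "integrable M (\<lambda>\<omega>. 1 + (y \<omega>)\<^sup>2)" using assms by auto
  have "\<bar>a\<bar> \<le> 1 + a\<^sup>2" for a :: real
    using zero_le_power2[of "\<bar>a\<bar> - 1"] by (simp add: power2_diff)
  then show "AE \<omega> in M. norm (y \<omega>) \<le> norm (1 + (y \<omega>)\<^sup>2)"
    by (intro AE_I2) (simp add: add_nonneg_nonneg)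
qed (use assms in auto)

lemma (in finite_measure) L2_limit_integral:
  fixes x :: "nat \<Rightarrow> 'a \<Rightarrow> real"
  assumes meas: "\<And>n. x n \<in> borel_measurable M" "y \<in> borel_measurable M"
    and int: "\<And>n. integrable M (\<lambda>\<omega>. (x n \<omega>)\<^sup>2)" "integrable M (\<lambda>\<omega>. (y \<omega>)\<^sup>2)"
    and diff: "\<And>n. integrable M (\<lambda>\<omega>. (x n \<omega> - y \<omega>)\<^sup>2)" "\<And>n. (\<integral>\<omega>. (x n \<omega> - y \<omega>)\<^sup>2 \<partial>M) \<le> \<epsilon> n"
    and \<epsilon>: "\<epsilon> \<longlonglongrightarrow> 0" and A: "A \<in> sets M"
  shows "(\<lambda>n. LINT \<omega>:A|M. x n \<omega>) \<longlonglongrightarrow> (LINT \<omega>:A|M. y \<omega>)"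
proof -
  \<comment> \<open>Both \<open>x\<close> and \<open>x + 1\<close> converge in mean square, and \<open>2 x = (x + 1)\<^sup>2 - x\<^sup>2 - 1\<close>.\<close>
  have int1: "integrable M (\<lambda>\<omega>. (z \<omega> + 1)\<^sup>2)"
    if "z \<in> borel_measurable M" "integrable M (\<lambda>\<omega>. (z \<omega>)\<^sup>2)" for z :: "'a \<Rightarrow> real"
    unfolding power2_sum using integrable_of_square_integrable[OF that] that(2)
    by (intro Bochner_Integration.integrable_add) auto
  have split: "(LINT \<omega>:A|M. z \<omega>) = ((LINT \<omega>:A|M. (z \<omega> + 1)\<^sup>2) - (LINT \<omega>:A|M. (z \<omega>)\<^sup>2) - measure M A) / 2"
    if z: "z \<in> borel_measurable M" "integrable M (\<lambda>\<omega>. (z \<omega>)\<^sup>2)" for z :: "'a \<Rightarrow> real"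
  proof -
    have si: "integrable M (\<lambda>\<omega>. indicator A \<omega> *\<^sub>R (z \<omega>)\<^sup>2)" "integrable M (\<lambda>\<omega>. indicator A \<omega> *\<^sub>R (z \<omega>))"
      by (intro integrable_mult_indicator A z integrable_of_square_integrable)+
    have "(LINT \<omega>:A|M. (z \<omega> + 1)\<^sup>2)
        = (\<integral>\<omega>. indicator A \<omega> *\<^sub>R (z \<omega>)\<^sup>2 + 2 * (indicator A \<omega> *\<^sub>R z \<omega>) + indicator A \<omega> \<partial>M)"
      unfolding set_lebesgue_integral_def
      by (intro Bochner_Integration.integral_cong) (auto simp: power2_eq_square algebra_simps)
    also have "\<dots> = (LINT \<omega>:A|M. (z \<omega>)\<^sup>2) + 2 * (LINT \<omega>:A|M. z \<omega>) + measure M A"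
      using si A by (simp add: set_lebesgue_integral_def integrable_indicator_iff less_top[symmetric])
    finally show ?thesis by simp
  qed
  have "(\<lambda>n. LINT \<omega>:A|M. (x n \<omega> + 1)\<^sup>2) \<longlonglongrightarrow> (LINT \<omega>:A|M. (y \<omega> + 1)\<^sup>2)"
    by (rule L2_limit_square_integral[where \<epsilon>=\<epsilon>]) (use diff in \<open>auto intro!: int1 meas int \<epsilon> A\<close>)
  moreover have "(\<lambda>n. LINT \<omega>:A|M. (x n \<omega>)\<^sup>2) \<longlonglongrightarrow> (LINT \<omega>:A|M. (y \<omega>)\<^sup>2)"
    by (rule L2_limit_square_integral[where \<epsilon>=\<epsilon>]) (rule int diff \<epsilon> A)+
  ultimately show ?thesis
    unfolding split[OF meas(1) int(1)] split[OF meas(2) int(2)] by (intro tendsto_intros) auto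
qed

section \<open>Brownian increments are independent of the past\<close>

lemma process_sigma_space: "process_sigma M I X \<subseteq> Pow (space M)"
  unfolding process_sigma_def by (intro subsetI PowI, drule sigma_sets_into_sp[rotated]) auto

lemma space_in_process_sigma: "space M \<in> process_sigma M I X"
  unfolding process_sigma_def by (rule sigma_sets_top)

lemma sigma_algebra_process_sigma: "sigma_algebra (space M) (process_sigma M I X)"
  unfolding process_sigma_def by (rule sigma_algebra_sigma_sets) auto

lemma process_sigma_least:
  assumes "\<And>i. i \<in> I \<Longrightarrow> X i \<in> borel_measurable N" "space N = space M"
  shows "process_sigma M I X \<subseteq> sets N"
  unfolding process_sigma_def assms(2)[symmetric]
proof (rule sets.sigma_sets_subset, safe)
  fix i A assume "i \<in> I" "A \<in> sets (borel :: real measure)"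
  then show "X i -` A \<inter> space N \<in> sets N" using assms(1) by (intro measurable_sets)
qed

lemma process_sigma_vimage:
  "i \<in> I \<Longrightarrow> A \<in> sets borel \<Longrightarrow> X i -` A \<inter> space M \<in> process_sigma M I X"
  unfolding process_sigma_def by (rule sigma_sets.Basic) blast

lemma measurable_process_sigma:
  assumes "process_sigma M I X \<subseteq> sets N" "space N = space M" "i \<in> I"
  shows "X i \<in> borel_measurable N"
  by (rule measurableI) (use process_sigma_vimage[of i I _ X M] assms in auto)

lemma process_sigma_mono: "I \<subseteq> J \<Longrightarrow> process_sigma M I X \<subseteq> process_sigma M J X"
  unfolding process_sigma_def by (rule sigma_sets_mono') auto

lemma Int_stable_process_sigma: "Int_stable (process_sigma M I X)"
  using sigma_algebra_process_sigma[of M I X] algebra.axioms(1) sigma_algebra.axioms(1)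
  by (metis algebra.Int_stable)

lemma Int_stable_sigma_sets: "G \<subseteq> Pow \<Omega> \<Longrightarrow> Int_stable (sigma_sets \<Omega> G)"
  by (metis sigma_algebra_sigma_sets sigma_algebra.axioms(1) algebra.Int_stable)

lemma Int_stable_vimages: "Int_stable {f -` A \<inter> space M | A. A \<in> sets borel}"
proof (rule Int_stableI)
  fix a b assume "a \<in> {f -` A \<inter> space M | A. A \<in> sets borel}" "b \<in> {f -` A \<inter> space M | A. A \<in> sets borel}"
  then obtain A B where "a = f -` A \<inter> space M" "b = f -` B \<inter> space M" "A \<in> sets borel" "B \<in> sets borel" by auto
  then show "a \<inter> b \<in> {f -` A \<inter> space M | A. A \<in> sets borel}"
    by (intro CollectI exI[of _ "A \<inter> B"]) auto
qed

lemma (in prob_space) indep_set_mono: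
  "indep_set A B \<Longrightarrow> A' \<subseteq> A \<Longrightarrow> B' \<subseteq> B \<Longrightarrow> indep_set A' B'"
  unfolding indep_sets2_eq by blast

text \<open>
  Adding the points 0 and \<open>u\<close> to a finite set of times and sorting it expresses the values at
  these times as sums of consecutive increments, which are independent of the next one.
\<close>

lemma (in prob_space) increment_indep_finite_past:
  assumes ind: "independent_increments M X" and "0 \<le> u" "u \<le> v" and S: "finite S" "S \<subseteq> {0..u}"
  shows "indep_set (process_sigma M S (\<lambda>s \<omega>. X s \<omega> - X 0 \<omega>))
           {(\<lambda>\<omega>. X v \<omega> - X u \<omega>) -` A \<inter> space M | A. A \<in> sets borel}"
proof -
  let ?V = "\<lambda>g :: 'a \<Rightarrow> real. {g -` A \<inter> space M | A. A \<in> sets borel}"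
  define xs where "xs = sorted_list_of_set (insert 0 (insert u S))"
  define m where "m = length xs - 1"
  have set_xs: "set xs = insert 0 (insert u S)"
    unfolding xs_def by (rule set_sorted_list_of_set) (use S in simp)
  have sorted: "sorted xs" by (simp add: xs_def)
  have len: "length xs = Suc m" using set_xs by (cases xs) (auto simp: m_def)
  have range: "xs ! i \<in> {0..u}" if "i \<le> m" for i
    using nth_mem[of i xs] that len set_xs S \<open>0 \<le> u\<close> by auto
  obtain i0 where i0: "i0 \<le> m" "xs ! i0 = 0" using set_xs len by (metis in_set_conv_nth insertI1 less_Suc_eq_le)
  obtain iu where iu: "iu \<le> m" "xs ! iu = u"
    using set_xs len by (metis in_set_conv_nth insertI1 insertI2 less_Suc_eq_le)
  define s where "s i = (if i \<le> m then xs ! i else v)" for i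
  have s0: "s 0 = 0"
    using sorted_nth_mono[OF sorted, of 0 i0] i0 len range[of 0] by (auto simp: s_def)
  have sm: "s m = u"
    using sorted_nth_mono[OF sorted, of iu m] iu len range[of m] by (auto simp: s_def)
  have mono: "incseq s"
  proof (rule incseq_SucI)
    fix i show "s i \<le> s (Suc i)"
      using sorted_nth_mono[OF sorted, of i "Suc i"] len range[of i] \<open>u \<le> v\<close> by (auto simp: s_def)
  qed
  define D where "D i \<omega> = X (s (Suc i)) \<omega> - X (s i) \<omega>" for i \<omega>
  have "indep_vars (\<lambda>_. borel) D {..<Suc m}"
    using ind s0 mono unfolding independent_increments_def D_def[abs_def] by simp
  then have iv: "indep_sets (\<lambda>i. (?V (D i))) {..<Suc m}"
    by (simp add: indep_vars_def2)
  let ?I = "case_bool {..<m} {m}"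
  have "indep_sets (\<lambda>b. sigma_sets (space M) (\<Union>i\<in>?I b. (?V (D i)))) UNIV"
  proof (rule indep_sets_collect_sigma)
    have "(\<Union>b\<in>UNIV. ?I b) = {..<Suc m}" by (auto simp: UNIV_bool)
    then show "indep_sets (\<lambda>i. (?V (D i))) (\<Union>b\<in>UNIV. ?I b)"
      using iv by simp
    show "disjoint_family_on ?I UNIV" by (auto simp: disjoint_family_on_def split: bool.splits)
  qed (rule Int_stable_vimages)
  then have "indep_set (sigma_sets (space M) (\<Union>i\<in>{..<m}. (?V (D i))))
      (?V (D m))"
    unfolding indep_set_def
    by (rule indep_sets_mono_sets) (auto split: bool.split)
  moreover have "process_sigma M S (\<lambda>s \<omega>. X s \<omega> - X 0 \<omega>)
      \<subseteq> sigma_sets (space M) (\<Union>i\<in>{..<m}. (?V (D i)))"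
  proof -
    define N where "N = sigma (space M) (\<Union>i\<in>{..<m}. (?V (D i)))"
    have sub: "(\<Union>i\<in>{..<m}. (?V (D i))) \<subseteq> Pow (space M)" by auto
    have N: "space N = space M" "sets N = sigma_sets (space M) (\<Union>i\<in>{..<m}. (?V (D i)))"
      unfolding N_def using sub by (auto simp: space_measure_of sets_measure_of)
    have DN: "D i \<in> borel_measurable N" if "i < m" for i
      by (rule measurableI) (use that N in \<open>auto intro!: sigma_sets.Basic\<close>)
    have "(\<lambda>\<omega>. X x \<omega> - X 0 \<omega>) \<in> borel_measurable N" if "x \<in> S" for x
    proof -
      have "x \<in> set xs" using set_xs that by simp
      then obtain k where k: "k \<le> m" "xs ! k = x" using len by (metis in_set_conv_nth less_Suc_eq_le)
      have "X x \<omega> - X 0 \<omega> = (\<Sum>i<k. D i \<omega>)" for \<omega>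
        unfolding D_def using k s0 by (subst sum_lessThan_telescope) (simp add: s_def)
      then show ?thesis using DN k by simp
    qed
    from process_sigma_least[OF this N(1)] N(2) show ?thesis by simp
  qed
  ultimately have "indep_set (process_sigma M S (\<lambda>s \<omega>. X s \<omega> - X 0 \<omega>)) (?V (D m))"
    by (rule indep_set_mono[OF _ _ subset_refl])
  moreover have "D m = (\<lambda>\<omega>. X v \<omega> - X u \<omega>)" using sm by (auto simp: D_def s_def)
  ultimately show ?thesis by simp
qed

text \<open>
  The \<open>\<sigma>\<close>-fields generated by finitely many times form an intersection-stable generator.
\<close>

lemma (in prob_space) increment_indep_past:
  assumes ind: "independent_increments M X" and "0 \<le> u" "u \<le> v"
  shows "indep_set (process_sigma M {0..u} (\<lambda>s \<omega>. X s \<omega> - X 0 \<omega>))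
           (sigma_sets (space M) {(\<lambda>\<omega>. X v \<omega> - X u \<omega>) -` A \<inter> space M | A. A \<in> sets borel})"
proof -
  let ?X = "\<lambda>s \<omega>. X s \<omega> - X 0 \<omega>"
  let ?P = "\<Union>S\<in>{S. finite S \<and> S \<subseteq> {0..u}}. process_sigma M S ?X"
  let ?N = "{(\<lambda>\<omega>. X v \<omega> - X u \<omega>) -` A \<inter> space M | A. A \<in> sets borel}"
  have "indep_set ?P ?N"
    using increment_indep_finite_past[OF assms] unfolding indep_sets2_eq by blast
  moreover have "Int_stable ?P"
  proof (rule Int_stableI)
    fix a b assume "a \<in> ?P" "b \<in> ?P"
    then obtain S S' where S: "finite S" "S \<subseteq> {0..u}" "a \<in> process_sigma M S ?X"
      "finite S'" "S' \<subseteq> {0..u}" "b \<in> process_sigma M S' ?X" by blast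
    then have "a \<in> process_sigma M (S \<union> S') ?X" "b \<in> process_sigma M (S \<union> S') ?X"
      using process_sigma_mono[of S "S \<union> S'"] process_sigma_mono[of S' "S \<union> S'"] by blast+
    then have "a \<inter> b \<in> process_sigma M (S \<union> S') ?X"
      using Int_stable_process_sigma[of M "S \<union> S'" ?X] by (auto simp: Int_stable_def)
    then show "a \<inter> b \<in> ?P" using S by (intro UN_I[of "S \<union> S'"]) auto
  qed
  ultimately have "indep_set (sigma_sets (space M) ?P) (sigma_sets (space M) ?N)"
    by (rule indep_set_sigma_sets[OF _ _ Int_stable_vimages])
  moreover have "process_sigma M {0..u} ?X \<subseteq> sigma_sets (space M) ?P"
    unfolding process_sigma_def[of M "{0..u}"]
  proof (rule sigma_sets_mono, safe)
    fix i A assume "i \<in> {0..u}" "A \<in> sets (borel :: real measure)"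
    then have "?X i -` A \<inter> space M \<in> ?P"
      by (intro UN_I[of "{i}"]) (auto intro!: process_sigma_vimage)
    then show "?X i -` A \<inter> space M \<in> sigma_sets (space M) ?P" by (rule sigma_sets.Basic)
  qed
  ultimately show ?thesis by (rule indep_set_mono[OF _ _ subset_refl])
qed

text \<open>
  Independence across the index together with independence of two \<open>\<sigma>\<close>-fields within each index
  gives joint independence of all of them.
\<close>

lemma (in prob_space) indep_sets_refine:
  assumes indep: "indep_sets G (UNIV :: 'i set)"
    and sub: "\<And>j. P j \<subseteq> G j" "\<And>j. N j \<subseteq> G j"
    and alg: "\<And>j. sigma_algebra (space M) (G j)"
    and sp: "\<And>j. space M \<in> P j" "\<And>j. space M \<in> N j"
    and pn: "\<And>j. indep_set (P j) (N j)"
  shows "indep_sets (\<lambda>(j, b). if b then P j else N j) UNIV"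
proof (rule indep_setsI)
  fix i :: "'i \<times> bool"
  show "(case i of (j, b) \<Rightarrow> if b then P j else N j) \<subseteq> events"
    using pn unfolding indep_sets2_eq by (auto split: prod.splits)
next
  fix A :: "'i \<times> bool \<Rightarrow> 'a set" and J
  assume J: "J \<noteq> {}" "finite J" and A: "\<forall>i\<in>J. A i \<in> (case i of (j, b) \<Rightarrow> if b then P j else N j)"
  define A' where "A' i = (if i \<in> J then A i else space M)" for i
  have AP: "A' (j, True) \<in> P j" and AN: "A' (j, False) \<in> N j" for j
    using A sp by (auto simp: A'_def split: if_splits)
  have sp_sub: "A' i \<subseteq> space M" for i
  proof -
    obtain j b where i: "i = (j, b)" by (cases i)
    have "A' i \<in> events" using AP[of j] AN[of j] pn[of j] unfolding indep_sets2_eq i by (cases b) auto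
    then show ?thesis by (rule sets.sets_into_space)
  qed
  define K where "K = fst ` J"
  have K: "finite K" "K \<noteq> {}" using J by (auto simp: K_def)
  have "(\<Inter>i\<in>J. A i) = (\<Inter>j\<in>K. A' (j, True) \<inter> A' (j, False))"
  proof (intro subset_antisym subsetI)
    fix \<omega> assume \<omega>: "\<omega> \<in> (\<Inter>i\<in>J. A i)"
    obtain i0 where "i0 \<in> J" using J by auto
    then have "\<omega> \<in> A' i0" using \<omega> by (simp add: A'_def)
    then have "\<omega> \<in> space M" using sp_sub by blast
    then show "\<omega> \<in> (\<Inter>j\<in>K. A' (j, True) \<inter> A' (j, False))" using \<omega> by (auto simp: A'_def)
  next
    fix \<omega> assume \<omega>: "\<omega> \<in> (\<Inter>j\<in>K. A' (j, True) \<inter> A' (j, False))"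
    show "\<omega> \<in> (\<Inter>i\<in>J. A i)"
    proof
      fix i assume i: "i \<in> J"
      then have "\<omega> \<in> A' (fst i, True) \<inter> A' (fst i, False)" using \<omega> by (auto simp: K_def)
      then have "\<omega> \<in> A' i" by (cases i; cases "snd i") auto
      then show "\<omega> \<in> A i" using i by (simp add: A'_def)
    qed
  qed
  also have "prob \<dots> = (\<Prod>j\<in>K. prob (A' (j, True) \<inter> A' (j, False)))"
  proof (rule indep_setsD[OF indep _ K(2,1)])
    show "\<forall>j\<in>K. A' (j, True) \<inter> A' (j, False) \<in> G j"
    proof
      fix j
      interpret G: sigma_algebra "space M" "G j" by (rule alg)
      show "A' (j, True) \<inter> A' (j, False) \<in> G j" using AP AN sub by blast
    qed
  qed simp
  also have "\<dots> = (\<Prod>j\<in>K. \<Prod>b\<in>UNIV. prob (A' (j, b)))"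
    by (intro prod.cong) (simp_all add: UNIV_bool indep_setD[OF pn AP AN] mult.commute)
  also have "\<dots> = (\<Prod>i\<in>K \<times> UNIV. prob (A' i))" by (subst prod.cartesian_product) simp
  also have "\<dots> = (\<Prod>i\<in>J. prob (A' i))"
  proof (rule prod.mono_neutral_right)
    show "J \<subseteq> K \<times> UNIV" by (force simp: K_def)
    show "\<forall>i\<in>K \<times> UNIV - J. prob (A' i) = 1" by (auto simp: A'_def prob_space)
  qed (use K in auto)
  also have "\<dots> = (\<Prod>i\<in>J. prob (A i))" by (intro prod.cong) (auto simp: A'_def)
  finally show "prob (\<Inter>i\<in>J. A i) = (\<Prod>i\<in>J. prob (A i))" .
qed

lemma (in prob_space) indep_var_of_indep_set:
  assumes ind: "indep_set (sets F) (sets N)" and sp: "space F = space M" "space N = space M"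
    and f: "f \<in> borel_measurable F" and g: "g \<in> borel_measurable N"
  shows "indep_var borel f borel g"
proof -
  have F: "sets F \<subseteq> events" and N: "sets N \<subseteq> events" using ind by (auto simp: indep_sets2_eq)
  have "sigma_sets (space M) {f -` A \<inter> space M | A. A \<in> sets borel} \<subseteq> sets F"
    using measurable_sets[OF f] unfolding sp(1)[symmetric] by (intro sets.sigma_sets_subset) auto
  moreover have "sigma_sets (space M) {g -` A \<inter> space M | A. A \<in> sets borel} \<subseteq> sets N"
    using measurable_sets[OF g] unfolding sp(2)[symmetric] by (intro sets.sigma_sets_subset) auto
  moreover have "random_variable borel f" "random_variable borel g"
    using f g F N sp by (auto simp: measurable_def)
  ultimately show ?thesis unfolding indep_var_eq using indep_set_mono[OF ind] by blast
qed

lemma (in prob_space) set_integral_indep: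
  fixes g :: "'a \<Rightarrow> real"
  assumes ind: "indep_set (sets F) (sets N)" and sp: "space F = space M" "space N = space M"
    and A: "A \<in> sets F" and g: "g \<in> borel_measurable N" "integrable M g"
  shows "(LINT \<omega>:A|M. g \<omega>) = prob A * (\<integral>\<omega>. g \<omega> \<partial>M)"
proof -
  have A': "A \<in> events" using A ind by (auto simp: indep_sets2_eq)
  have "indep_var borel (indicator A :: 'a \<Rightarrow> real) borel g"
    by (rule indep_var_of_indep_set[OF ind sp _ g(1)]) (use A in simp)
  from indep_var_lebesgue_integral[OF this _ g(2)] A' show ?thesis
    by (simp add: set_lebesgue_integral_def integrable_indicator_iff less_top[symmetric])
qed

locale wiener_family = prob_space M for M :: "'w measure" +
  fixes w :: "nat \<Rightarrow> real \<Rightarrow> 'w \<Rightarrow> real" and E :: "real \<Rightarrow> 'w \<Rightarrow> real"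
  assumes complete: "complete_measure M"
    and bm: "\<And>j. standard_brownian_motion M (w j)"
    and indep_w: "indep_sets (\<lambda>j. process_sigma M {0..} (w j)) UNIV"
    and indep_E: "indep_set (process_sigma M (UNIV \<times> {0..}) (\<lambda>(j, s). w j s)) (process_sigma M {0..} E)"
begin

lemma w_meas: "0 \<le> s \<Longrightarrow> w j s \<in> borel_measurable M"
  using bm by (auto simp: standard_brownian_motion_def)

lemma E_meas: "0 \<le> t \<Longrightarrow> E t \<in> borel_measurable M"
  using indep_E by (intro measurable_process_sigma[where I="{0..}" and X=E and M=M]) (auto simp: indep_sets2_eq)

lemma null_setI: "N \<in> null_sets M \<Longrightarrow> A \<subseteq> N \<Longrightarrow> A \<in> null_sets M"
  using complete_measure.complete2[OF complete] by blast

text \<open>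
  The past up to time \<open>u\<close> without the right limit. The filtration consists of the right limits
  of these \<open>\<sigma>\<close>-fields; independence of later increments is immediate only for \<open>H u\<close> itself.
\<close>

definition H :: "real \<Rightarrow> 'w measure" where
  "H u = sigma (space M) (process_sigma M (UNIV \<times> {0..u}) (\<lambda>(j, s). w j s) \<union>
           process_sigma M {0..} E \<union> null_sets M)"

lemma H_gen_space: "process_sigma M (UNIV \<times> {0..u}) (\<lambda>(j, s). w j s) \<union>
    process_sigma M {0..} E \<union> null_sets M \<subseteq> Pow (space M)"
  using process_sigma_space[of M "UNIV \<times> {0..u}" "\<lambda>(j, s). w j s"] process_sigma_space[of M "{0..}" E]
    sets.space_closed[of M] null_setsD2 by (intro Un_least) blast+

lemma space_H: "space (H u) = space M"
  unfolding H_def using H_gen_space by (simp add: space_measure_of)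

lemma sets_H: "sets (H u) = sigma_sets (space M)
    (process_sigma M (UNIV \<times> {0..u}) (\<lambda>(j, s). w j s) \<union> process_sigma M {0..} E \<union> null_sets M)"
  unfolding H_def using H_gen_space by (simp add: sets_measure_of)

lemma sets_H_mono: "u \<le> v \<Longrightarrow> sets (H u) \<subseteq> sets (H v)"
  unfolding sets_H by (intro sigma_sets_mono' Un_mono process_sigma_mono) auto

lemma w_meas_H: "0 \<le> s \<Longrightarrow> s \<le> u \<Longrightarrow> w j s \<in> borel_measurable (H u)"
  using measurable_process_sigma[of M "UNIV \<times> {0..u}" "\<lambda>(j, s). w j s" "H u" "(j, s)"]
  by (auto simp: space_H sets_H)

lemma E_meas_H: "0 \<le> t \<Longrightarrow> E t \<in> borel_measurable (H u)"
  using measurable_process_sigma[of M "{0..}" E "H u" t] by (auto simp: space_H sets_H)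

lemma null_sets_H: "N \<in> null_sets M \<Longrightarrow> N \<in> sets (H u)" by (auto simp: sets_H)

lemma sets_H_le: "sets (H u) \<subseteq> sets M"
proof -
  have "process_sigma M (UNIV \<times> {0..u}) (\<lambda>(j, s). w j s) \<subseteq> sets M"
    by (rule process_sigma_least) (auto intro: w_meas)
  moreover have "process_sigma M {0..} E \<subseteq> sets M"
    by (rule process_sigma_least) (auto intro: E_meas)
  ultimately show ?thesis unfolding sets_H by (intro sets.sigma_sets_subset) auto
qed

lemma subalgebra_H: "subalgebra M (H u)" by (simp add: subalgebra_def space_H sets_H_le)

definition increments :: "real \<Rightarrow> real \<Rightarrow> 'w measure" where
  "increments u v = sigma (space M) {(\<lambda>\<omega>. w j v \<omega> - w j u \<omega>) -` A \<inter> space M | j A. A \<in> sets borel}"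

lemma space_increments: "space (increments u v) = space M"
  unfolding increments_def by (rule space_measure_of) auto

lemma sets_increments: "sets (increments u v) =
    sigma_sets (space M) {(\<lambda>\<omega>. w j v \<omega> - w j u \<omega>) -` A \<inter> space M | j A. A \<in> sets borel}"
  unfolding increments_def by (rule sets_measure_of) auto

lemma increment_meas: "(\<lambda>\<omega>. w j v \<omega> - w j u \<omega>) \<in> borel_measurable (increments u v)"
proof (rule measurableI)
  fix A :: "real set" assume "A \<in> sets borel"
  then have "(\<lambda>\<omega>. w j v \<omega> - w j u \<omega>) -` A \<inter> space M \<in> {(\<lambda>\<omega>. w j v \<omega> - w j u \<omega>) -` A \<inter> space M | j A. A \<in> sets borel}"
    by blast
  then show "(\<lambda>\<omega>. w j v \<omega> - w j u \<omega>) -` A \<inter> space (increments u v) \<in> sets (increments u v)"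
    unfolding space_increments sets_increments by (rule sigma_sets.Basic)
qed simp

text \<open>
  The pasts and the increments of all Brownian motions are jointly independent, and \<open>E\<close> is
  independent of both. Events of the form past \<open>\<inter>\<close> event of \<open>E\<close>, together with the null sets,
  are stable under intersections and generate a \<open>\<sigma>\<close>-field that contains \<open>H u\<close>.
\<close>

lemma increments_indep_past:
  assumes uv: "0 \<le> u" "u \<le> v"
  shows "indep_set (sets (H u)) (sets (increments u v))"
proof -
  let ?w = "\<lambda>j s \<omega>. w j s \<omega> - w j 0 \<omega>"
  let ?P = "\<lambda>j. process_sigma M {0..u} (?w j)"
  let ?N = "\<lambda>j. sigma_sets (space M) {(\<lambda>\<omega>. w j v \<omega> - w j u \<omega>) -` A \<inter> space M | A. A \<in> sets borel}"
  let ?G = "\<lambda>j. process_sigma M {0..} (w j)"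
  let ?W = "process_sigma M (UNIV \<times> {0..}) (\<lambda>(j, s). w j s)"
  let ?E = "process_sigma M {0..} E"
  have meas_G: "w j s \<in> borel_measurable (sigma (space M) (?G j))" if "0 \<le> s" for j s
    using that process_sigma_space[of M "{0..}" "w j"]
    by (intro measurable_process_sigma[where I="{0..}"]) (auto simp: sets_measure_of space_measure_of)
  have sets_G: "sets (sigma (space M) (?G j)) = ?G j" for j
    using sigma_algebra.sets_measure_of_eq[OF sigma_algebra_process_sigma] .
  have PG: "?P j \<subseteq> ?G j" for j
    using meas_G process_sigma_space[of M "{0..}" "w j"]
    by (subst sets_G[symmetric], intro process_sigma_least) (auto simp: space_measure_of)
  have NG: "?N j \<subseteq> ?G j" for j
  proof -
    have "(\<lambda>\<omega>. w j v \<omega> - w j u \<omega>) \<in> borel_measurable (sigma (space M) (?G j))"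
      using meas_G uv by (intro borel_measurable_diff) auto
    then have "(\<lambda>\<omega>. w j v \<omega> - w j u \<omega>) -` A \<inter> space M \<in> ?G j" if "A \<in> sets borel" for A
      using measurable_sets[OF _ that] process_sigma_space[of M "{0..}" "w j"] sets_G[of j]
      by (metis space_measure_of)
    then show ?thesis
      by (intro sigma_algebra.sigma_sets_subset[OF sigma_algebra_process_sigma]) auto
  qed
  have "indep_sets (\<lambda>(j, b). if b then ?P j else ?N j) UNIV"
  proof (rule indep_sets_refine[OF indep_w PG NG sigma_algebra_process_sigma])
    show "space M \<in> ?P j" for j by (rule space_in_process_sigma)
    show "space M \<in> ?N j" for j by (rule sigma_sets_top)
    show "indep_set (?P j) (?N j)" for j
      using bm[of j] uv by (intro increment_indep_past) (auto simp: standard_brownian_motion_def)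
  qed
  then have "indep_sets (\<lambda>(j, b). if b then ?P j else ?N j) (\<Union>b\<in>UNIV. range (\<lambda>j. (j, b)))"
    by (rule indep_sets_mono_index[rotated]) simp
  then have "indep_sets (\<lambda>b. sigma_sets (space M) (\<Union>i\<in>range (\<lambda>j. (j, b)). case i of (j, b) \<Rightarrow> if b then ?P j else ?N j)) UNIV"
  proof (rule indep_sets_collect_sigma)
    fix i :: "nat \<times> bool"
    show "Int_stable (case i of (j, b) \<Rightarrow> if b then ?P j else ?N j)"
      by (cases i) (auto intro!: Int_stable_process_sigma Int_stable_sigma_sets)
  qed (auto simp: disjoint_family_on_def)
  then have PN: "indep_set (sigma_sets (space M) (\<Union>j. ?P j)) (sigma_sets (space M) (\<Union>j. ?N j))"
    unfolding indep_set_def by (rule indep_sets_mono_sets) (auto split: bool.split)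
  let ?SP = "sigma_sets (space M) (\<Union>j. ?P j)" and ?SN = "sigma_sets (space M) (\<Union>j. ?N j)"
  have GW: "?G j \<subseteq> ?W" for j
    unfolding process_sigma_def by (rule sigma_sets_mono') force
  have SPW: "?SP \<subseteq> ?W" and SNW: "?SN \<subseteq> ?W"
    using PG NG GW by (intro sigma_algebra.sigma_sets_subset[OF sigma_algebra_process_sigma], blast)+
  interpret W: sigma_algebra "space M" ?W by (rule sigma_algebra_process_sigma)
  have EW: "prob (a \<inter> e) = prob a * prob e" if "a \<in> ?W" "e \<in> ?E" for a e
    using indep_E that by (auto simp: indep_sets2_eq)
  have W_ev: "?W \<subseteq> events" and E_ev: "?E \<subseteq> events" using indep_E by (auto simp: indep_sets2_eq)
  define R where "R = {p \<inter> e | p e. p \<in> ?SP \<and> e \<in> ?E} \<union> null_sets M"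
  have R_ev: "R \<subseteq> events" unfolding R_def using SPW W_ev E_ev by blast
  have "indep_set R ?SN"
  proof (rule indep_setI[OF R_ev])
    show "?SN \<subseteq> events" using SNW W_ev by blast
    fix a n assume a: "a \<in> R" and n: "n \<in> ?SN"
    show "prob (a \<inter> n) = prob a * prob n"
    proof (cases "a \<in> null_sets M")
      case True
      have "a \<inter> n \<in> null_sets M" by (rule null_setI[OF True]) auto
      then show ?thesis using True by (simp add: measure_eq_0_null_sets)
    next
      case False
      then obtain p e where pe: "a = p \<inter> e" "p \<in> ?SP" "e \<in> ?E" using a by (auto simp: R_def)
      have "prob (a \<inter> n) = prob ((p \<inter> n) \<inter> e)" by (simp add: pe Int_ac)
      also have "\<dots> = prob (p \<inter> n) * prob e" using pe n SPW SNW by (intro EW) auto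
      also have "\<dots> = prob p * prob n * prob e" using PN pe n by (auto simp: indep_sets2_eq)
      also have "\<dots> = prob a * prob n" using pe SPW EW[of p e] by auto
      finally show ?thesis .
    qed
  qed
  moreover have "Int_stable R"
  proof (rule Int_stableI)
    fix a b assume a: "a \<in> R" and b: "b \<in> R"
    show "a \<inter> b \<in> R"
    proof (cases "a \<in> null_sets M \<or> b \<in> null_sets M")
      case True
      then have "a \<inter> b \<in> null_sets M" by (auto intro: null_setI)
      then show ?thesis by (simp add: R_def)
    next
      case False
      then obtain p e p' e' where pe: "a = p \<inter> e" "p \<in> ?SP" "e \<in> ?E" "b = p' \<inter> e'" "p' \<in> ?SP" "e' \<in> ?E"
        using a b by (auto simp: R_def)
      interpret SP: sigma_algebra "space M" ?SP
        using process_sigma_space by (intro sigma_algebra_sigma_sets) blast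
      interpret SE: sigma_algebra "space M" ?E by (rule sigma_algebra_process_sigma)
      have "a \<inter> b = (p \<inter> p') \<inter> (e \<inter> e')" using pe by auto
      moreover have "p \<inter> p' \<in> ?SP" "e \<inter> e' \<in> ?E" using pe by auto
      ultimately show ?thesis unfolding R_def by blast
    qed
  qed
  ultimately have ind: "indep_set (sigma_sets (space M) R) (sigma_sets (space M) ?SN)"
    using W.space_closed SNW
    by (intro indep_set_sigma_sets Int_stable_sigma_sets) (blast intro: sigma_sets.Basic)+
  have R_sp: "R \<subseteq> Pow (space M)" using R_ev sets.sets_into_space by blast
  define S where "S = sigma (space M) R"
  have S: "space S = space M" "sets S = sigma_sets (space M) R"
    unfolding S_def using R_sp by (auto simp: space_measure_of sets_measure_of)
  have SP_S: "?SP \<subseteq> sets S"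
  proof
    fix p assume p: "p \<in> ?SP"
    then have "p \<subseteq> space M" using SPW W.sets_into_space by blast
    then have "p = p \<inter> space M" by (rule Int_absorb2[symmetric])
    moreover have "space M \<in> ?E" by (rule space_in_process_sigma)
    ultimately have "p \<in> R" unfolding R_def using p by (intro UnI1 CollectI exI conjI)
    then show "p \<in> sets S" unfolding S by (rule sigma_sets.Basic)
  qed
  have E_S: "?E \<subseteq> sets S"
  proof
    fix e assume e: "e \<in> ?E"
    then have "e \<subseteq> space M" using process_sigma_space by blast
    then have "e = space M \<inter> e" by (rule Int_absorb1[symmetric])
    moreover have "space M \<in> ?SP" by (rule sigma_sets_top)
    ultimately have "e \<in> R" unfolding R_def using e by (intro UnI1 CollectI exI conjI)
    then show "e \<in> sets S" unfolding S by (rule sigma_sets.Basic)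
  qed
  have null_S: "N \<in> sets S" if "N \<in> null_sets M" for N
    using that unfolding S R_def by (intro sigma_sets.Basic) auto
  \<comment> \<open>The paths start at 0 only almost surely; the difference disappears in the null sets.\<close>
  have w_S: "w j s \<in> borel_measurable S" if s: "s \<in> {0..u}" for j s
  proof (rule measurableI)
    fix A :: "real set" assume A: "A \<in> sets borel"
    define Z where "Z = {\<omega> \<in> space M. w j 0 \<omega> \<noteq> 0}"
    have Z: "Z \<in> null_sets M"
      using bm[of j] complete_measure.AE_iff_null_sets[OF complete, of "\<lambda>\<omega>. w j 0 \<omega> = 0"]
      by (simp add: standard_brownian_motion_def Z_def)
    have "?w j s -` A \<inter> space M \<in> ?P j" using s A by (rule process_sigma_vimage[of s "{0..u}" A "?w j"])
    then have 1: "?w j s -` A \<inter> space M \<in> sets S"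
      by (intro subsetD[OF SP_S] sigma_sets.Basic UN_I[OF UNIV_I])
    have eq: "w j s -` A \<inter> space M = ((?w j s -` A \<inter> space M) - Z) \<union> (w j s -` A \<inter> space M \<inter> Z)"
      by (auto simp: Z_def)
    have "w j s -` A \<inter> space M \<inter> Z \<in> null_sets M" by (rule null_setI[OF Z]) auto
    then show "w j s -` A \<inter> space S \<in> sets S"
      unfolding S(1) by (subst eq) (intro sets.Un sets.Diff 1 null_S Z)
  qed simp
  have "process_sigma M (UNIV \<times> {0..u}) (\<lambda>(j, s). w j s) \<subseteq> sets S"
    by (rule process_sigma_least) (use w_S S in auto)
  then have "sets (H u) \<subseteq> sets S"
    unfolding sets_H S(1)[symmetric] using E_S null_S by (intro sets.sigma_sets_subset) auto
  moreover have "sets (increments u v) \<subseteq> sigma_sets (space M) ?SN"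
    unfolding sets_increments by (intro sigma_sets_mono) (auto intro!: sigma_sets.Basic)
  ultimately show ?thesis using ind unfolding S(2) by (intro indep_set_mono[OF ind[unfolded S(2)[symmetric]]]) (auto simp: S(2))
qed

lemma increment_moment:
  assumes "0 \<le> u" "u < v"
  shows "integrable M (\<lambda>\<omega>. (w j v \<omega> - w j u \<omega>) ^ k)"
    and "(\<integral>\<omega>. w j v \<omega> - w j u \<omega> \<partial>M) = 0"
    and "(\<integral>\<omega>. (w j v \<omega> - w j u \<omega>)\<^sup>2 \<partial>M) = v - u"
    and "(\<integral>\<omega>. (w j v \<omega> - w j u \<omega>) ^ 4 \<partial>M) = 3 * (v - u)\<^sup>2"
proof -
  define \<sigma> where "\<sigma> = sqrt (v - u)"
  have \<sigma>: "0 < \<sigma>" "\<sigma>\<^sup>2 = v - u" using assms by (simp_all add: \<sigma>_def)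
  have D: "distributed M lborel (\<lambda>\<omega>. w j v \<omega> - w j u \<omega>) (normal_density 0 \<sigma>)"
    using bm[of j] assms by (auto simp: standard_brownian_motion_def \<sigma>_def)
  have mom: "(\<integral>\<omega>. (w j v \<omega> - w j u \<omega>) ^ k \<partial>M) = (\<integral>x. normal_density 0 \<sigma> x * x ^ k \<partial>lborel)" for k
    using distributed_integral[OF D, of "\<lambda>x. x ^ k"] by simp
  show "integrable M (\<lambda>\<omega>. (w j v \<omega> - w j u \<omega>) ^ k)"
    using distributed_integrable[OF D, of "\<lambda>x. x ^ k"] integrable_normal_moment[OF \<sigma>(1), of 0 k] by simp
  show "(\<integral>\<omega>. w j v \<omega> - w j u \<omega> \<partial>M) = 0"
    using mom[of 1] integral_normal_moment_odd[OF \<sigma>(1), of 0 0] by simp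
  show "(\<integral>\<omega>. (w j v \<omega> - w j u \<omega>)\<^sup>2 \<partial>M) = v - u"
    using mom[of 2] integral_normal_moment_even[OF \<sigma>(1), of 0 1] \<sigma> by simp
  have "(\<integral>x. normal_density 0 \<sigma> x * x ^ 4 \<partial>lborel) = fact 4 / ((2 / \<sigma>\<^sup>2)\<^sup>2 * fact 2)"
    using integral_normal_moment_even[OF \<sigma>(1), of 0 2] by simp
  also have "\<dots> = 3 * (v - u)\<^sup>2"
    unfolding \<sigma>(2) using assms by (simp add: fact_numeral power2_eq_square)
  finally show "(\<integral>\<omega>. (w j v \<omega> - w j u \<omega>) ^ 4 \<partial>M) = 3 * (v - u)\<^sup>2" using mom[of 4] by simp
qed

lemma increment_square_integrable:
  assumes "0 \<le> u" "u \<le> v"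
  shows "integrable M (\<lambda>\<omega>. w j v \<omega> - w j u \<omega>)"
    and "integrable M (\<lambda>\<omega>. (w i v \<omega> - w i u \<omega>) * (w j v \<omega> - w j u \<omega>))"
proof -
  have sq: "integrable M (\<lambda>\<omega>. (w j v \<omega> - w j u \<omega>)\<^sup>2)" for j
    using increment_moment(1)[of u v j 2] assms by (cases "u = v") auto
  show "integrable M (\<lambda>\<omega>. w j v \<omega> - w j u \<omega>)"
    using increment_moment(1)[of u v j 1] assms by (cases "u = v") auto
  show "integrable M (\<lambda>\<omega>. (w i v \<omega> - w i u \<omega>) * (w j v \<omega> - w j u \<omega>))"
    using w_meas assms sq by (intro integrable_mult_of_square_integrable borel_measurable_diff) auto
qed

lemma increment_covariance:
  assumes "0 \<le> u" "u \<le> v"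
  shows "(\<integral>\<omega>. (w i v \<omega> - w i u \<omega>) * (w j v \<omega> - w j u \<omega>) \<partial>M) = (if i = j then v - u else 0)"
proof (cases "i = j \<or> u = v")
  case True
  then show ?thesis
    using increment_moment(3)[of u v j] assms by (cases "u = v") (auto simp: power2_eq_square)
next
  case False
  let ?S = "\<lambda>j. sigma (space M) (process_sigma M {0..} (w j))"
  have S: "space (?S j) = space M" "sets (?S j) = process_sigma M {0..} (w j)" for j
    by (rule space_measure_of[OF process_sigma_space])
       (rule sigma_algebra.sets_measure_of_eq[OF sigma_algebra_process_sigma])
  have "indep_set (process_sigma M {0..} (w i)) (process_sigma M {0..} (w j))"
  proof (rule indep_setI)
    show "process_sigma M {0..} (w i) \<subseteq> events" "process_sigma M {0..} (w j) \<subseteq> events"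
      using indep_w by (auto simp: indep_sets_def)
    fix a b assume "a \<in> process_sigma M {0..} (w i)" "b \<in> process_sigma M {0..} (w j)"
    then show "prob (a \<inter> b) = prob a * prob b"
      using indep_setsD[OF indep_w, of "{i, j}" "\<lambda>k. if k = i then a else b"] False by auto
  qed
  then have "indep_set (sets (?S i)) (sets (?S j))" by (simp add: S)
  moreover have "(\<lambda>\<omega>. w k v \<omega> - w k u \<omega>) \<in> borel_measurable (?S k)" for k
    using assms by (intro borel_measurable_diff measurable_process_sigma[where I="{0..}"]) (auto simp: S)
  ultimately have "indep_var borel (\<lambda>\<omega>. w i v \<omega> - w i u \<omega>) borel (\<lambda>\<omega>. w j v \<omega> - w j u \<omega>)"
    by (intro indep_var_of_indep_set[where F="?S i" and N="?S j"] S(1))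
  from indep_var_lebesgue_integral[OF this increment_square_integrable(1,1)[OF assms]]
  show ?thesis using False increment_moment(2)[of u v j] assms by simp
qed

lemma increment_orthogonal_past:
  assumes uv: "0 \<le> u" "u \<le> v" and A: "A \<in> sets (H u)"
  shows "(LINT \<omega>:A|M. w j v \<omega> - w j u \<omega>) = 0"
    and "(LINT \<omega>:A|M. (w i v \<omega> - w i u \<omega>) * (w j v \<omega> - w j u \<omega>)) = (if i = j then (v - u) * prob A else 0)"
proof -
  note fact = set_integral_indep[OF increments_indep_past[OF uv] space_H space_increments A]
  have "(LINT \<omega>:A|M. w j v \<omega> - w j u \<omega>) = prob A * (\<integral>\<omega>. w j v \<omega> - w j u \<omega> \<partial>M)"
    by (rule fact[OF increment_meas increment_square_integrable(1)[OF uv]])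
  also have "\<dots> = 0" using increment_moment(2)[of u v j] uv by (cases "u = v") auto
  finally show "(LINT \<omega>:A|M. w j v \<omega> - w j u \<omega>) = 0" .
  show "(LINT \<omega>:A|M. (w i v \<omega> - w i u \<omega>) * (w j v \<omega> - w j u \<omega>)) = (if i = j then (v - u) * prob A else 0)"
    by (subst fact[OF borel_measurable_times[OF increment_meas increment_meas] increment_square_integrable(2)[OF uv]])
       (simp add: increment_covariance[OF uv])
qed

end

section \<open>Time change of processes with orthogonal increments\<close>

text \<open>
  Changing a function on a null set preserves measurability with respect to a \<open>\<sigma>\<close>-field that
  contains all null sets.
\<close>

lemma borel_measurable_AE_limit:
  fixes f :: "nat \<Rightarrow> 'w \<Rightarrow> real"
  assumes complete: "complete_measure M" and sp: "space N = space M" and null: "null_sets M \<subseteq> sets N"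
    and meas: "\<And>n. f n \<in> borel_measurable N"
    and lim: "AE \<omega> in M. (\<lambda>n. f n \<omega>) \<longlonglongrightarrow> g \<omega>"
  shows "g \<in> borel_measurable N"
proof -
  define Z where "Z = {\<omega> \<in> space M. \<not> (\<lambda>n. f n \<omega>) \<longlonglongrightarrow> g \<omega>}"
  have Z: "Z \<in> null_sets M"
    using lim unfolding Z_def complete_measure.AE_iff_null_sets[OF complete] .
  then have [measurable]: "Z \<in> sets N" using null by blast
  have g': "(\<lambda>\<omega>. if \<omega> \<in> Z then 0 else g \<omega>) \<in> borel_measurable N"
  proof (rule borel_measurable_LIMSEQ_real)
    show "(\<lambda>\<omega>. if \<omega> \<in> Z then 0 else f n \<omega>) \<in> borel_measurable N" for n
      using meas by measurable
    show "(\<lambda>n. if \<omega> \<in> Z then 0 else f n \<omega>) \<longlonglongrightarrow> (if \<omega> \<in> Z then 0 else g \<omega>)" if "\<omega> \<in> space N" for \<omega>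
      using that sp by (auto simp: Z_def)
  qed
  show ?thesis
  proof (rule measurableI)
    fix A :: "real set" assume A: "A \<in> sets borel"
    have "g -` A \<inter> space M \<inter> Z \<in> null_sets M"
      by (rule complete_measure.complete2[OF complete _ Z]) auto
    then have 1: "g -` A \<inter> space M \<inter> Z \<in> sets N" using null by blast
    have 2: "(\<lambda>\<omega>. if \<omega> \<in> Z then 0 else g \<omega>) -` A \<inter> space N \<in> sets N"
      by (rule measurable_sets[OF g' A])
    have eq: "g -` A \<inter> space N = (((\<lambda>\<omega>. if \<omega> \<in> Z then 0 else g \<omega>) -` A \<inter> space N) - Z) \<union> (g -` A \<inter> space M \<inter> Z)"
      using sp by auto
    show "g -` A \<inter> space N \<in> sets N"
      by (subst eq) (intro sets.Un sets.Diff 1 2 \<open>Z \<in> sets N\<close>)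
  qed simp
qed

text \<open>
  The properties of the inverse subordinator, beyond independence, on which the time change
  depends.
\<close>

locale time_change = wiener_family +
  assumes E_paths: "AE \<omega> in M. E 0 \<omega> = 0 \<and> continuous_on {0..} (\<lambda>t. E t \<omega>) \<and> mono_on {0..} (\<lambda>t. E t \<omega>)"
    and E_int: "\<And>t. 0 \<le> t \<Longrightarrow> integrable M (E t)"
begin

abbreviation "F \<equiv> base_filtration M w E"
abbreviation "G \<equiv> time_changed_filtration M w E"

lemma E_nonneg:
  assumes "0 \<le> t"
  shows "AE \<omega> in M. 0 \<le> E t \<omega>"
  using E_paths
proof eventually_elim
  case (elim \<omega>)
  then show ?case using mono_onD[of "{0..}" "\<lambda>t. E t \<omega>" 0 t] assms by simp
qed

lemma E_mono:
  assumes "0 \<le> s" "s \<le> t"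
  shows "AE \<omega> in M. E s \<omega> \<le> E t \<omega>"
  using E_paths
proof eventually_elim
  case (elim \<omega>)
  then show ?case using mono_onD[of "{0..}" "\<lambda>t. E t \<omega>" s t] assms by simp
qed

lemma sets_H_Inter_space: "(\<Inter>u\<in>{r<..}. sets (H u)) \<subseteq> Pow (space M)"
  using sets.space_closed[of "H (r + 1)"] by (force simp: space_H)

lemma space_F: "space (F r) = space M"
  unfolding base_filtration_def sets_H[symmetric] by (rule space_measure_of[OF sets_H_Inter_space])

lemma sets_F: "sets (F r) = (\<Inter>u\<in>{r<..}. sets (H u))"
proof -
  have "sets (F r) = sigma_sets (space M) (\<Inter>u\<in>{r<..}. sets (H u))"
    unfolding base_filtration_def sets_H[symmetric] by (rule sets_measure_of[OF sets_H_Inter_space])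
  also have "\<dots> = (\<Inter>u\<in>{r<..}. sets (H u))"
  proof (rule antisym)
    show "sigma_sets (space M) (\<Inter>u\<in>{r<..}. sets (H u)) \<subseteq> (\<Inter>u\<in>{r<..}. sets (H u))"
    proof (rule INT_greatest)
      fix u assume "u \<in> {r<..}"
      then show "sigma_sets (space M) (\<Inter>u\<in>{r<..}. sets (H u)) \<subseteq> sets (H u)"
        unfolding space_H[of u, symmetric] by (intro sets.sigma_sets_subset) auto
    qed
  qed (rule sigma_sets_superset_generator)
  finally show ?thesis .
qed

lemma sets_F_le: "r < u \<Longrightarrow> sets (F r) \<subseteq> sets (H u)" by (auto simp: sets_F)

lemma sets_H_F: "sets (H r) \<subseteq> sets (F r)"
  unfolding sets_F using sets_H_mono[of r] by (intro INT_greatest) auto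

lemma null_sets_F: "N \<in> null_sets M \<Longrightarrow> N \<in> sets (F r)"
  using null_sets_H sets_H_F by blast

lemma filtration_F: "filtration (space M) F"
proof
  show "sets (F i) \<subseteq> sets (F j)" if "i \<le> j" for i j
    using that by (auto simp: sets_F)
qed (rule space_F)

lemma E_level_sets: "0 \<le> t \<Longrightarrow> {\<omega> \<in> space M. E t \<omega> \<le> r} \<in> sets (H u)"
  using measurable_sets[OF E_meas_H[of t u], of "{..r}"] by (simp add: space_H vimage_def Int_def conj_commute)

lemma stopping_time_E: "0 \<le> t \<Longrightarrow> stopping_time F (E t)"
  by (intro stopping_timeI) (simp add: pred_def space_F subsetD[OF sets_H_F E_level_sets])

text \<open>
  As \<open>E t\<close> is a stopping time, the family that generates the \<open>\<sigma>\<close>-field at \<open>E t\<close> is already a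
  \<open>\<sigma>\<close>-field.
\<close>

lemma sets_G: "0 \<le> t \<Longrightarrow> sets (G t) = {A. \<forall>r. {\<omega> \<in> A. E t \<omega> \<le> r} \<in> sets (F r)}"
  unfolding time_changed_filtration_def
  by (rule filtration.sets_pre_sigma[OF filtration_F stopping_time_E])

lemma space_G: "space (G t) = space M"
  unfolding time_changed_filtration_def by (rule filtration.space_pre_sigma[OF filtration_F])

lemma sets_G_le:
  assumes t: "0 \<le> t"
  shows "sets (G t) \<subseteq> sets M"
proof
  fix A assume A: "A \<in> sets (G t)"
  have "{\<omega> \<in> A. E t \<omega> \<le> real n} \<in> sets M" for n :: nat
    using A sets_F_le[of "real n" "real n + 1"] sets_H_le by (auto simp: sets_G[OF t])
  then have "(\<Union>n::nat. {\<omega> \<in> A. E t \<omega> \<le> real n}) \<in> sets M" by blast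
  also have "(\<Union>n::nat. {\<omega> \<in> A. E t \<omega> \<le> real n}) = A" using real_arch_simple by auto
  finally show "A \<in> sets M" .
qed

lemma subalgebra_G: "0 \<le> t \<Longrightarrow> subalgebra M (G t)"
  by (simp add: subalgebra_def space_G sets_G_le)

lemma E_meas_G: "0 \<le> t \<Longrightarrow> E t \<in> borel_measurable (G t)"
  unfolding time_changed_filtration_def
  by (rule filtration.measurable_stopping_time_pre_sigma[OF filtration_F stopping_time_E])

text \<open>
  A strict inequality leaves room for the right limit in the filtration, so these events already
  lie in \<open>H r\<close>.
\<close>

lemma G_below_level:
  assumes t: "0 \<le> t" and A: "A \<in> sets (G t)"
  shows "{\<omega> \<in> A. E t \<omega> < r} \<in> sets (H r)"
proof -
  have "{\<omega> \<in> A. E t \<omega> \<le> r - 1 / real (Suc m)} \<in> sets (H r)" for m :: nat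
    using A sets_F_le[of "r - 1 / real (Suc m)" r] by (auto simp: sets_G[OF t])
  then have "(\<Union>m::nat. {\<omega> \<in> A. E t \<omega> \<le> r - 1 / real (Suc m)}) \<in> sets (H r)" by blast
  also have "(\<Union>m::nat. {\<omega> \<in> A. E t \<omega> \<le> r - 1 / real (Suc m)}) = {\<omega> \<in> A. E t \<omega> < r}"
  proof (intro subset_antisym subsetI)
    fix \<omega> assume "\<omega> \<in> {\<omega> \<in> A. E t \<omega> < r}"
    then have "0 < r - E t \<omega>" "\<omega> \<in> A" by auto
    then obtain m where "inverse (real (Suc m)) < r - E t \<omega>" using reals_Archimedean by blast
    then show "\<omega> \<in> (\<Union>m::nat. {\<omega> \<in> A. E t \<omega> \<le> r - 1 / real (Suc m)})"
      using \<open>\<omega> \<in> A\<close> by (auto intro!: exI[of _ m] simp: inverse_eq_divide)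
  qed (auto intro: le_less_trans)
  finally show ?thesis .
qed

definition mesh :: "nat \<Rightarrow> real" where "mesh n = 1 / 2 ^ n"

text \<open>The successor places the grid time strictly above \<open>E t\<close>.\<close>

definition grid_index :: "nat \<Rightarrow> real \<Rightarrow> 'a \<Rightarrow> nat" where
  "grid_index n t \<omega> = Suc (nat \<lfloor>2 ^ n * E t \<omega>\<rfloor>)"

abbreviation grid_time :: "nat \<Rightarrow> real \<Rightarrow> 'a \<Rightarrow> real" where
  "grid_time n t \<omega> \<equiv> mesh n * real (grid_index n t \<omega>)"

lemma mesh_pos: "0 < mesh n" by (simp add: mesh_def)

lemma mesh_tendsto: "mesh \<longlonglongrightarrow> 0"
  unfolding mesh_def using LIMSEQ_inverse_realpow_zero[of 2] by (simp add: inverse_eq_divide)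

lemma grid_index_bounds:
  assumes "0 \<le> E t \<omega>"
  shows "E t \<omega> < grid_time n t \<omega>" "grid_time n t \<omega> \<le> E t \<omega> + mesh n"
proof -
  have "0 \<le> \<lfloor>2 ^ n * E t \<omega>\<rfloor>" using assms by simp
  then have "real (grid_index n t \<omega>) = of_int \<lfloor>2 ^ n * E t \<omega>\<rfloor> + 1"
    by (simp add: grid_index_def)
  moreover have "2 ^ n * E t \<omega> < of_int \<lfloor>2 ^ n * E t \<omega>\<rfloor> + 1" "of_int \<lfloor>2 ^ n * E t \<omega>\<rfloor> \<le> 2 ^ n * E t \<omega>"
    by linarith+
  ultimately show "E t \<omega> < grid_time n t \<omega>" "grid_time n t \<omega> \<le> E t \<omega> + mesh n"
    by (auto simp: mesh_def field_simps)
qed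

lemma grid_index_refine:
  assumes "0 \<le> E t \<omega>" "n \<le> m"
  shows "grid_index m t \<omega> \<le> 2 ^ (m - n) * grid_index n t \<omega>"
proof -
  have "2 ^ m * E t \<omega> = 2 ^ (m - n) * (2 ^ n * E t \<omega>)"
    using assms(2) by (simp add: power_add[symmetric] mult.assoc[symmetric])
  also have "\<dots> < 2 ^ (m - n) * real (grid_index n t \<omega>)"
    using grid_index_bounds(1)[OF assms(1), of n] by (simp add: mesh_def field_simps)
  finally have "2 ^ m * E t \<omega> < of_nat (2 ^ (m - n) * grid_index n t \<omega>)" by simp
  then have "\<lfloor>2 ^ m * E t \<omega>\<rfloor> < int (2 ^ (m - n) * grid_index n t \<omega>)" by (simp add: floor_less_iff)
  moreover have "0 \<le> \<lfloor>2 ^ m * E t \<omega>\<rfloor>" using assms by simp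
  ultimately show ?thesis unfolding grid_index_def[of m] by linarith
qed

lemma grid_index_mono: "E s \<omega> \<le> E t \<omega> \<Longrightarrow> grid_index n s \<omega> \<le> grid_index n t \<omega>"
  by (auto simp: grid_index_def intro!: nat_mono floor_mono mult_left_mono)

lemma grid_index_meas: "0 \<le> t \<Longrightarrow> grid_index n t \<in> measurable (H u) (count_space UNIV)"
  unfolding grid_index_def[abs_def] using E_meas_H[of t u] by measurable

text \<open>
  The grid time exceeds \<open>E t\<close> strictly, so the event that it has a given value is known at that
  value.
\<close>

lemma grid_cell:
  assumes t: "0 \<le> t" and A: "A \<in> sets (G t)"
  shows "{\<omega> \<in> A. grid_index n t \<omega> = k} \<in> sets (H (mesh n * k))"
proof (cases k)
  case 0
  then show ?thesis by (simp add: grid_index_def)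
next
  case (Suc i)
  \<comment> \<open>For \<open>i = 0\<close> there is no lower bound, since \<open>nat\<close> also sends negative values to 0.\<close>
  have "grid_index n t \<omega> = k \<longleftrightarrow> E t \<omega> < mesh n * k \<and> (i = 0 \<or> \<not> E t \<omega> < mesh n * i)" for \<omega>
  proof -
    have 1: "nat x \<le> i \<longleftrightarrow> x < int i + 1" for x by linarith
    have 2: "i \<le> nat x \<longleftrightarrow> i = 0 \<or> int i \<le> x" for x by linarith
    have "grid_index n t \<omega> = k \<longleftrightarrow> nat \<lfloor>2 ^ n * E t \<omega>\<rfloor> \<le> i \<and> i \<le> nat \<lfloor>2 ^ n * E t \<omega>\<rfloor>"
      using Suc by (auto simp: grid_index_def)
    also have "\<dots> \<longleftrightarrow> 2 ^ n * E t \<omega> < real i + 1 \<and> (i = 0 \<or> real i \<le> 2 ^ n * E t \<omega>)"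
      unfolding 1 2 floor_less_iff le_floor_iff by simp
    also have "\<dots> \<longleftrightarrow> E t \<omega> < mesh n * k \<and> (i = 0 \<or> \<not> E t \<omega> < mesh n * i)"
      using Suc by (auto simp: mesh_def field_simps)
    finally show ?thesis .
  qed
  then have eq: "{\<omega> \<in> A. grid_index n t \<omega> = k} =
      {\<omega> \<in> A. E t \<omega> < mesh n * k} - (if i = 0 then {} else {\<omega> \<in> A. E t \<omega> < mesh n * i})"
    by auto
  have "mesh n * i \<le> mesh n * k" using Suc mesh_pos[of n] by (intro mult_left_mono) auto
  from sets_H_mono[OF this] show ?thesis
    unfolding eq using G_below_level[OF assms] by (intro sets.Diff) auto
qed

text \<open>
  What is needed of a Brownian motion with variance \<open>c\<close> per unit of time. The moments are
  prescribed on events of the past instead of asking for independence, because this form passes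
  to limits in \<open>L\<^sup>2\<close> and hence to the infinite combinations \<open>W u \<bullet> h\<close>.
\<close>

definition orthogonal_increments :: "real \<Rightarrow> (real \<Rightarrow> 'a \<Rightarrow> real) \<Rightarrow> bool" where
  "orthogonal_increments c B \<longleftrightarrow> 0 \<le> c \<and>
     (AE \<omega> in M. B 0 \<omega> = 0 \<and> continuous_on {0..} (\<lambda>u. B u \<omega>)) \<and>
     (\<forall>u\<ge>0. B u \<in> borel_measurable (H u)) \<and>
     (\<forall>u v. 0 \<le> u \<and> u \<le> v \<longrightarrow> integrable M (\<lambda>\<omega>. (B v \<omega> - B u \<omega>)\<^sup>2) \<and>
       (\<forall>A\<in>sets (H u). (LINT \<omega>:A|M. B v \<omega> - B u \<omega>) = 0 \<and>
          (LINT \<omega>:A|M. (B v \<omega> - B u \<omega>)\<^sup>2) = c * (v - u) * prob A))"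

lemma orthogonal_increments_meas:
  "orthogonal_increments c B \<Longrightarrow> 0 \<le> u \<Longrightarrow> B u \<in> borel_measurable M"
  unfolding orthogonal_increments_def using subalgebra_H measurable_from_subalg by blast

lemma grid_process_meas:
  assumes B: "orthogonal_increments c B" and S: "S \<in> measurable M (count_space UNIV)" and h: "0 \<le> h"
  shows "(\<lambda>\<omega>. B (h * real (S \<omega>)) \<omega>) \<in> borel_measurable M"
  by (rule measurable_compose_countable[OF _ S, of "\<lambda>k. B (h * real k)"])
     (use orthogonal_increments_meas[OF B] h in auto)

text \<open>
  On the event \<open>E t \<le> r\<close> the time-changed process is the limit of its values at the dyadic
  points below \<open>E t\<close>, hence below \<open>r\<close>.
\<close>

lemma time_changed_meas_G:
  assumes meas: "\<And>u. 0 \<le> u \<Longrightarrow> B u \<in> borel_measurable (H u)"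
    and cont: "AE \<omega> in M. continuous_on {0..} (\<lambda>u. B u \<omega>)" and t: "0 \<le> t"
  shows "(\<lambda>\<omega>. B (E t \<omega>) \<omega> :: real) \<in> borel_measurable (G t)"
proof (rule measurableI)
  fix C :: "real set" assume C: "C \<in> sets borel"
  have "{\<omega> \<in> space M. B (E t \<omega>) \<omega> \<in> C \<and> E t \<omega> \<le> r} \<in> sets (F r)" for r
  proof (cases "r < 0")
    case True
    \<comment> \<open>The inverse process takes a default value on paths where it is not defined, and it may be
      negative there.\<close>
    have "{\<omega> \<in> space M. \<not> 0 \<le> E t \<omega>} \<in> null_sets M"
      by (rule iffD1[OF complete_measure.AE_iff_null_sets[OF complete] E_nonneg[OF t]])
    then have "{\<omega> \<in> space M. B (E t \<omega>) \<omega> \<in> C \<and> E t \<omega> \<le> r} \<in> null_sets M"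
      by (rule null_setI) (use True in auto)
    then show ?thesis by (rule null_sets_F)
  next
    case False
    define x where "x n \<omega> = (if E t \<omega> \<le> r then B (min (mesh n * real (nat \<lfloor>2 ^ n * E t \<omega>\<rfloor>)) r) \<omega> else 0)" for n \<omega>
    have E_H: "E t \<in> borel_measurable (H r)" by (rule E_meas_H[OF t])
    have x: "x n \<in> borel_measurable (H r)" for n
    proof -
      have "(\<lambda>\<omega>. B (min (mesh n * real (nat \<lfloor>2 ^ n * E t \<omega>\<rfloor>)) r) \<omega>) \<in> borel_measurable (H r)"
      proof (rule measurable_compose_countable[of "\<lambda>k. B (min (mesh n * real k) r)"])
        fix k :: nat
        have "B (min (mesh n * real k) r) \<in> borel_measurable (H (min (mesh n * real k) r))"
          using False mesh_pos[of n] by (intro meas) auto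
        moreover have "subalgebra (H r) (H (min (mesh n * real k) r))"
          by (simp add: subalgebra_def space_H sets_H_mono)
        ultimately show "B (min (mesh n * real k) r) \<in> borel_measurable (H r)"
          using measurable_from_subalg by blast
        show "(\<lambda>\<omega>. nat \<lfloor>2 ^ n * E t \<omega>\<rfloor>) \<in> measurable (H r) (count_space UNIV)"
          using E_H by measurable
      qed
      then show ?thesis unfolding x_def using E_H by measurable
    qed
    have lim: "AE \<omega> in M. (\<lambda>n. x n \<omega>) \<longlonglongrightarrow> (if E t \<omega> \<le> r then B (E t \<omega>) \<omega> else 0)"
      using cont E_nonneg[OF t]
    proof eventually_elim
      case (elim \<omega>)
      show ?case
      proof (cases "E t \<omega> \<le> r")
        case True
        let ?e = "\<lambda>n. mesh n * real (nat \<lfloor>2 ^ n * E t \<omega>\<rfloor>)"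
        have b: "?e n \<le> E t \<omega>" "E t \<omega> - mesh n \<le> ?e n" for n
          using grid_index_bounds[OF elim(2), of n] by (auto simp: grid_index_def algebra_simps)
        have "?e \<longlonglongrightarrow> E t \<omega>"
        proof (rule tendsto_sandwich[of "\<lambda>n. E t \<omega> - mesh n" _ _ "\<lambda>n. E t \<omega>"])
          show "(\<lambda>n. E t \<omega> - mesh n) \<longlonglongrightarrow> E t \<omega>"
            using tendsto_diff[OF tendsto_const mesh_tendsto, of "E t \<omega>"] by simp
        qed (use b in auto)
        then have "(\<lambda>n. B (?e n) \<omega>) \<longlonglongrightarrow> B (E t \<omega>) \<omega>"
          using elim mesh_pos by (intro continuous_on_tendsto_compose[OF elim(1)]) (auto simp: less_imp_le)
        moreover have "x n \<omega> = B (?e n) \<omega>" for n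
          using True b(1)[of n] by (simp add: x_def min_def)
        ultimately show ?thesis using True by simp
      qed (simp add: x_def)
    qed
    have "(\<lambda>\<omega>. if E t \<omega> \<le> r then B (E t \<omega>) \<omega> else 0) \<in> borel_measurable (H r)"
      by (rule borel_measurable_AE_limit[OF complete space_H _ x lim]) (use null_sets_H in blast)
    from measurable_sets[OF this C] E_level_sets[OF t, of r r]
    have "((\<lambda>\<omega>. if E t \<omega> \<le> r then B (E t \<omega>) \<omega> else 0) -` C \<inter> space M) \<inter> {\<omega> \<in> space M. E t \<omega> \<le> r} \<in> sets (H r)"
      unfolding space_H by (rule sets.Int)
    also have "((\<lambda>\<omega>. if E t \<omega> \<le> r then B (E t \<omega>) \<omega> else 0) -` C \<inter> space M) \<inter> {\<omega> \<in> space M. E t \<omega> \<le> r}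
        = {\<omega> \<in> space M. B (E t \<omega>) \<omega> \<in> C \<and> E t \<omega> \<le> r}"
      by auto
    finally show ?thesis using sets_H_F by blast
  qed
  then show "(\<lambda>\<omega>. B (E t \<omega>) \<omega>) -` C \<inter> space (G t) \<in> sets (G t)"
    unfolding sets_G[OF t] space_G by (simp add: vimage_def Int_def conj_commute conj_left_commute)
qed simp

text \<open>
  Both times take countably many values. On the cell where they equal \<open>h k\<close> and \<open>h l\<close> the
  increment is an ordinary one, and the cell lies in \<open>H (h k)\<close>, so the moments are those of
  \<open>orthogonal_increments\<close>. Nonnegative integrals are used first because integrability of the
  square is part of the result.
\<close>

lemma grid_increment:
  assumes B: "orthogonal_increments c B" and h: "0 < h" and A: "A \<in> sets M"
    and S: "S \<in> measurable M (count_space UNIV)" "\<And>k. {\<omega> \<in> A. S \<omega> = k} \<in> sets (H (h * real k))"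
    and R: "\<And>u. R \<in> measurable (H u) (count_space UNIV)" and le: "AE \<omega> in M. S \<omega> \<le> (R \<omega> :: nat)"
  defines "D \<equiv> \<lambda>\<omega>. B (h * real (R \<omega>)) \<omega> - B (h * real (S \<omega>)) \<omega>"
  shows "(\<integral>\<^sup>+\<omega>\<in>A. ennreal ((D \<omega>)\<^sup>2) \<partial>M) = (\<integral>\<^sup>+\<omega>\<in>A. ennreal (c * (h * real (R \<omega>) - h * real (S \<omega>))) \<partial>M)"
    and "set_integrable M A D \<Longrightarrow> (LINT \<omega>:A|M. D \<omega>) = 0"
proof -
  \<comment> \<open>The cells are indexed by the pair of values of \<open>S\<close> and \<open>R\<close>, coded as one number.\<close>
  define C where "C n = {\<omega> \<in> A. S \<omega> = fst (prod_decode n) \<and> R \<omega> = snd (prod_decode n)}" for n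
  have C_H: "C n \<in> sets (H (h * real (fst (prod_decode n))))" for n
  proof -
    let ?u = "h * real (fst (prod_decode n))"
    have "{\<omega> \<in> A. S \<omega> = fst (prod_decode n)} \<inter> (R -` {snd (prod_decode n)} \<inter> space (H ?u)) \<in> sets (H ?u)"
      by (intro sets.Int S(2) measurable_sets[OF R]) auto
    also have "{\<omega> \<in> A. S \<omega> = fst (prod_decode n)} \<inter> (R -` {snd (prod_decode n)} \<inter> space (H ?u)) = C n"
      using sets.sets_into_space[OF A] by (auto simp: C_def space_H)
    finally show ?thesis .
  qed
  have C_M: "C n \<in> sets M" for n using C_H[of n] sets_H_le by blast
  have C_Un: "(\<Union>n. C n) = A"
  proof (intro subset_antisym subsetI)
    fix \<omega> assume "\<omega> \<in> A"
    then show "\<omega> \<in> (\<Union>n. C n)"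
      by (intro UN_I[of "prod_encode (S \<omega>, R \<omega>)"]) (auto simp: C_def)
  qed (auto simp: C_def)
  have C_disj: "C i \<inter> C j = {}" if "i \<noteq> j" for i j
  proof -
    have "prod_decode i \<noteq> prod_decode j" using that inj_prod_decode by (auto dest: injD)
    then show ?thesis by (auto simp: C_def prod_eq_iff)
  qed
  have R_M: "R \<in> measurable M (count_space UNIV)"
    using R[of 0] subalgebra_H measurable_from_subalg by blast
  have D_meas[measurable]: "D \<in> borel_measurable M"
    unfolding D_def using B S(1) R_M h by (intro borel_measurable_diff grid_process_meas) auto
  have RHS_meas: "(\<lambda>\<omega>. ennreal (c * (h * real (R \<omega>) - h * real (S \<omega>)))) \<in> borel_measurable M"
    using R_M S(1) by measurable
  have null: "C n \<in> null_sets M" if "\<not> fst (prod_decode n) \<le> snd (prod_decode n)" for n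
  proof (rule null_setI)
    show "{\<omega> \<in> space M. \<not> S \<omega> \<le> R \<omega>} \<in> null_sets M"
      by (rule iffD1[OF complete_measure.AE_iff_null_sets[OF complete] le])
    show "C n \<subseteq> {\<omega> \<in> space M. \<not> S \<omega> \<le> R \<omega>}"
      using that sets.sets_into_space[OF A] by (auto simp: C_def)
  qed
  have cell: "(LINT \<omega>:C n|M. D \<omega>) = 0 \<and> (\<integral>\<^sup>+\<omega>\<in>C n. ennreal ((D \<omega>)\<^sup>2) \<partial>M)
      = (\<integral>\<^sup>+\<omega>\<in>C n. ennreal (c * (h * real (R \<omega>) - h * real (S \<omega>))) \<partial>M)" for n
  proof (cases "fst (prod_decode n) \<le> snd (prod_decode n)")
    case False
    have "(LINT \<omega>:C n|M. D \<omega>) = 0"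
      unfolding set_lebesgue_integral_def
      using AE_not_in[OF null[OF False]] by (intro integral_eq_zero_AE) (auto elim!: eventually_mono)
    then show ?thesis using null[OF False] by (simp add: nn_integral_null_set)
  next
    case True
    define u v where "u = h * real (fst (prod_decode n))" and "v = h * real (snd (prod_decode n))"
    have uv: "0 \<le> u" "u \<le> v" using True h by (auto simp: u_def v_def)
    have on_C: "D \<omega> = B v \<omega> - B u \<omega>" "h * real (R \<omega>) - h * real (S \<omega>) = v - u" if "\<omega> \<in> C n" for \<omega>
      using that by (auto simp: C_def D_def u_def v_def)
    have C_u: "C n \<in> sets (H u)" using C_H[of n] by (simp add: u_def)
    have int: "integrable M (\<lambda>\<omega>. (B v \<omega> - B u \<omega>)\<^sup>2)"
      and zero: "(LINT \<omega>:C n|M. B v \<omega> - B u \<omega>) = 0"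
      and sq: "(LINT \<omega>:C n|M. (B v \<omega> - B u \<omega>)\<^sup>2) = c * (v - u) * prob (C n)"
      using B uv C_u unfolding orthogonal_increments_def by blast+
    have 1: "(LINT \<omega>:C n|M. D \<omega>) = 0"
      using zero by (subst set_lebesgue_integral_cong[OF C_M]) (auto simp: on_C)
    have "(\<integral>\<^sup>+\<omega>\<in>C n. ennreal ((D \<omega>)\<^sup>2) \<partial>M) = (\<integral>\<^sup>+\<omega>. ennreal (indicator (C n) \<omega> *\<^sub>R (B v \<omega> - B u \<omega>)\<^sup>2) \<partial>M)"
      by (intro nn_integral_cong) (auto simp: indicator_def on_C)
    also have "\<dots> = ennreal (LINT \<omega>:C n|M. (B v \<omega> - B u \<omega>)\<^sup>2)"
      unfolding set_lebesgue_integral_def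
      by (intro nn_integral_eq_integral integrable_mult_indicator C_M int) auto
    also have "\<dots> = ennreal (c * (v - u)) * emeasure M (C n)"
      using B uv by (simp add: sq emeasure_eq_measure ennreal_mult' orthogonal_increments_def)
    also have "\<dots> = (\<integral>\<^sup>+\<omega>. ennreal (c * (v - u)) * indicator (C n) \<omega> \<partial>M)"
      by (simp only: nn_integral_cmult_indicator[OF C_M])
    also have "\<dots> = (\<integral>\<^sup>+\<omega>\<in>C n. ennreal (c * (h * real (R \<omega>) - h * real (S \<omega>))) \<partial>M)"
      by (intro nn_integral_cong) (auto simp: indicator_def on_C)
    finally show ?thesis using 1 by simp
  qed
  have disj: "disjoint_family C" using C_disj by (auto simp: disjoint_family_on_def)
  show "(\<integral>\<^sup>+\<omega>\<in>A. ennreal ((D \<omega>)\<^sup>2) \<partial>M) = (\<integral>\<^sup>+\<omega>\<in>A. ennreal (c * (h * real (R \<omega>) - h * real (S \<omega>))) \<partial>M)"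
    using cell nn_integral_disjoint_family[OF _ C_M disj, of "\<lambda>\<omega>. ennreal ((D \<omega>)\<^sup>2)"]
      nn_integral_disjoint_family[OF RHS_meas C_M disj]
    unfolding C_Un by simp
  show "(LINT \<omega>:A|M. D \<omega>) = 0" if "set_integrable M A D"
    using lebesgue_integral_countable_add[of C M D, OF C_M C_disj] that cell unfolding C_Un by simp
qed

lemma grid_increment_real:
  assumes B: "orthogonal_increments c B" and h: "0 < h" and A: "A \<in> sets M"
    and S: "\<And>u. S \<in> measurable (H u) (count_space UNIV)" "\<And>k. {\<omega> \<in> A. S \<omega> = k} \<in> sets (H (h * real k))"
    and R: "\<And>u. R \<in> measurable (H u) (count_space UNIV)" and le: "AE \<omega> in M. S \<omega> \<le> (R \<omega> :: nat)"
    and int: "integrable M (\<lambda>\<omega>. h * real (R \<omega>) - h * real (S \<omega>))"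
  defines "D \<equiv> \<lambda>\<omega>. B (h * real (R \<omega>)) \<omega> - B (h * real (S \<omega>)) \<omega>"
  shows "integrable M (\<lambda>\<omega>. (D \<omega>)\<^sup>2)" and "(LINT \<omega>:A|M. D \<omega>) = 0"
    and "(LINT \<omega>:A|M. (D \<omega>)\<^sup>2) = c * (LINT \<omega>:A|M. h * real (R \<omega>) - h * real (S \<omega>))"
proof -
  have M_meas: "f \<in> measurable M (count_space UNIV)" if "\<And>u. f \<in> measurable (H u) (count_space UNIV)" for f :: "'a \<Rightarrow> nat"
    using that[of 0] subalgebra_H measurable_from_subalg by blast
  have D_meas[measurable]: "D \<in> borel_measurable M"
    unfolding D_def using B M_meas[OF S(1)] M_meas[OF R] h by (intro borel_measurable_diff grid_process_meas) auto
  have c: "0 \<le> c" using B by (simp add: orthogonal_increments_def)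
  have pos: "AE \<omega> in M. 0 \<le> h * real (R \<omega>) - h * real (S \<omega>)"
    using le by eventually_elim (use h in simp)
  have S_space: "{\<omega> \<in> space M. S \<omega> = k} \<in> sets (H (h * real k))" for k
    using measurable_sets[OF S(1)[of "h * real k"], of "{k}"] by (simp add: space_H vimage_def Int_def conj_commute)
  have "(\<integral>\<^sup>+\<omega>. ennreal ((D \<omega>)\<^sup>2) \<partial>M) = (\<integral>\<^sup>+\<omega>\<in>space M. ennreal ((D \<omega>)\<^sup>2) \<partial>M)"
    by (intro nn_integral_cong) (auto simp: indicator_def)
  also have "\<dots> = (\<integral>\<^sup>+\<omega>\<in>space M. ennreal (c * (h * real (R \<omega>) - h * real (S \<omega>))) \<partial>M)"
    unfolding D_def by (rule grid_increment(1)[OF B h _ M_meas[OF S(1)] S_space R le]) auto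
  also have "\<dots> = (\<integral>\<^sup>+\<omega>. ennreal (c * (h * real (R \<omega>) - h * real (S \<omega>))) \<partial>M)"
    by (intro nn_integral_cong) (auto simp: indicator_def)
  also have "\<dots> = ennreal (\<integral>\<omega>. c * (h * real (R \<omega>) - h * real (S \<omega>)) \<partial>M)"
  proof (rule nn_integral_eq_integral)
    show "AE \<omega> in M. 0 \<le> c * (h * real (R \<omega>) - h * real (S \<omega>))"
      using pos by eventually_elim (use c in simp)
  qed (use int in auto)
  also have "\<dots> < \<infinity>" by simp
  finally show int_D: "integrable M (\<lambda>\<omega>. (D \<omega>)\<^sup>2)" by (intro integrableI_nonneg) auto
  have "integrable M D" by (rule integrable_of_square_integrable[OF D_meas int_D])
  then have "set_integrable M A D" unfolding set_integrable_def by (intro integrable_mult_indicator A)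
  then show "(LINT \<omega>:A|M. D \<omega>) = 0"
    unfolding D_def by (rule grid_increment(2)[OF B h A M_meas[OF S(1)] S(2) R le])
  have "ennreal (LINT \<omega>:A|M. (D \<omega>)\<^sup>2) = (\<integral>\<^sup>+\<omega>. ennreal (indicator A \<omega> *\<^sub>R (D \<omega>)\<^sup>2) \<partial>M)"
    unfolding set_lebesgue_integral_def
    by (intro nn_integral_eq_integral[symmetric] integrable_mult_indicator A int_D) auto
  also have "\<dots> = (\<integral>\<^sup>+\<omega>\<in>A. ennreal ((D \<omega>)\<^sup>2) \<partial>M)"
    by (intro nn_integral_cong) (auto simp: indicator_def)
  also have "\<dots> = (\<integral>\<^sup>+\<omega>\<in>A. ennreal (c * (h * real (R \<omega>) - h * real (S \<omega>))) \<partial>M)"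
    unfolding D_def by (rule grid_increment(1)[OF B h A M_meas[OF S(1)] S(2) R le])
  also have "\<dots> = (\<integral>\<^sup>+\<omega>. ennreal (indicator A \<omega> *\<^sub>R (c * (h * real (R \<omega>) - h * real (S \<omega>)))) \<partial>M)"
    by (intro nn_integral_cong) (auto simp: indicator_def)
  also have "\<dots> = ennreal (LINT \<omega>:A|M. c * (h * real (R \<omega>) - h * real (S \<omega>)))"
    unfolding set_lebesgue_integral_def
  proof (rule nn_integral_eq_integral)
    show "AE \<omega> in M. 0 \<le> indicator A \<omega> *\<^sub>R (c * (h * real (R \<omega>) - h * real (S \<omega>)))"
      using pos by eventually_elim (use c in simp)
    show "integrable M (\<lambda>\<omega>. indicator A \<omega> *\<^sub>R (c * (h * real (R \<omega>) - h * real (S \<omega>))))"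
      by (intro integrable_mult_indicator A integrable_mult_right int)
  qed
  finally have "ennreal (LINT \<omega>:A|M. (D \<omega>)\<^sup>2) = ennreal (LINT \<omega>:A|M. c * (h * real (R \<omega>) - h * real (S \<omega>)))" .
  moreover have "0 \<le> (LINT \<omega>:A|M. (D \<omega>)\<^sup>2)"
    unfolding set_lebesgue_integral_def by (intro integral_nonneg_AE) auto
  moreover have "0 \<le> (LINT \<omega>:A|M. c * (h * real (R \<omega>) - h * real (S \<omega>)))"
    unfolding set_lebesgue_integral_def
  proof (rule integral_nonneg_AE)
    show "AE \<omega> in M. 0 \<le> indicator A \<omega> *\<^sub>R (c * (h * real (R \<omega>) - h * real (S \<omega>)))"
      using pos by eventually_elim (use c in simp)
  qed
  ultimately have "(LINT \<omega>:A|M. (D \<omega>)\<^sup>2) = (LINT \<omega>:A|M. c * (h * real (R \<omega>) - h * real (S \<omega>)))"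
    by simp
  then show "(LINT \<omega>:A|M. (D \<omega>)\<^sup>2) = c * (LINT \<omega>:A|M. h * real (R \<omega>) - h * real (S \<omega>))"
    by simp
qed

lemma grid_time_integrable: "0 \<le> t \<Longrightarrow> integrable M (\<lambda>\<omega>. grid_time n t \<omega>)"
proof (rule Bochner_Integration.integrable_bound)
  assume t: "0 \<le> t"
  show "integrable M (\<lambda>\<omega>. E t \<omega> + mesh n)" using E_int[OF t] by simp
  show "(\<lambda>\<omega>. grid_time n t \<omega>) \<in> borel_measurable M"
    unfolding grid_index_def[abs_def] using E_meas[OF t] by measurable
  show "AE \<omega> in M. norm (grid_time n t \<omega>) \<le> norm (E t \<omega> + mesh n)"
    using E_nonneg[OF t]
  proof eventually_elim
    case (elim \<omega>)
    then show ?case using grid_index_bounds(2)[OF elim, of n] mesh_pos[of n] by simp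
  qed
qed

text \<open>
  Both grid times are multiples of the finer mesh, and they differ by at most the coarser mesh.
\<close>

lemma grid_increment_refine:
  assumes B: "orthogonal_increments c B" and t: "0 \<le> t" and nm: "n \<le> m"
  defines "y \<equiv> \<lambda>n \<omega>. B (grid_time n t \<omega>) \<omega>"
  shows "integrable M (\<lambda>\<omega>. (y n \<omega> - y m \<omega>)\<^sup>2)" "(\<integral>\<omega>. (y n \<omega> - y m \<omega>)\<^sup>2 \<partial>M) \<le> c * mesh n"
proof -
  define R where "R \<omega> = 2 ^ (m - n) * grid_index n t \<omega>" for \<omega>
  have R: "mesh m * real (R \<omega>) = grid_time n t \<omega>" for \<omega>
  proof -
    have "(2::real) ^ m = 2 ^ n * 2 ^ (m - n)" using nm by (simp add: power_add[symmetric])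
    then show ?thesis by (simp add: R_def mesh_def)
  qed
  have c: "0 \<le> c" using B by (simp add: orthogonal_increments_def)
  have R_meas: "R \<in> measurable (H u) (count_space UNIV)" for u
    unfolding R_def[abs_def] using grid_index_meas[OF t] by measurable
  have le: "AE \<omega> in M. grid_index m t \<omega> \<le> R \<omega>"
    using E_nonneg[OF t] by eventually_elim (simp add: R_def grid_index_refine nm)
  have cell: "{\<omega> \<in> space M. grid_index m t \<omega> = k} \<in> sets (H (mesh m * real k))" for k
    by (rule grid_cell[OF t]) (metis sets.top space_G)
  have int: "integrable M (\<lambda>\<omega>. mesh m * real (R \<omega>) - grid_time m t \<omega>)"
    unfolding R by (intro Bochner_Integration.integrable_diff grid_time_integrable t)
  note inc = grid_increment_real[OF B mesh_pos sets.top grid_index_meas[OF t] cell R_meas le int]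
  show "integrable M (\<lambda>\<omega>. (y n \<omega> - y m \<omega>)\<^sup>2)"
    using inc(1) unfolding y_def R .
  have "(\<integral>\<omega>. (y n \<omega> - y m \<omega>)\<^sup>2 \<partial>M) = c * (\<integral>\<omega>. grid_time n t \<omega> - grid_time m t \<omega> \<partial>M)"
    using inc(3) unfolding y_def R set_integral_whole_space .
  also have "(\<integral>\<omega>. grid_time n t \<omega> - grid_time m t \<omega> \<partial>M) \<le> (\<integral>\<omega>. mesh n \<partial>M)"
  proof (rule integral_mono_AE)
    show "integrable M (\<lambda>\<omega>. grid_time n t \<omega> - grid_time m t \<omega>)"
      using int unfolding R .
    show "AE \<omega> in M. grid_time n t \<omega> - grid_time m t \<omega> \<le> mesh n"
      using E_nonneg[OF t]
    proof eventually_elim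
      case (elim \<omega>)
      show ?case using grid_index_bounds(2)[OF elim, of n] grid_index_bounds(1)[OF elim, of m] by linarith
    qed
  qed simp
  finally show "(\<integral>\<omega>. (y n \<omega> - y m \<omega>)\<^sup>2 \<partial>M) \<le> c * mesh n"
    using c by (simp add: mult_left_mono prob_space)
qed

text \<open>
  The identities hold for the grid times. The increments between grid times are Cauchy in \<open>L\<^sup>2\<close>
  as the mesh tends to 0, and by path continuity they converge to the increment between \<open>E s\<close>
  and \<open>E t\<close>.
\<close>

theorem time_changed_orthogonal_increments:
  assumes B: "orthogonal_increments c B" and st: "0 \<le> s" "s \<le> t" and A: "A \<in> sets (G s)"
  shows "integrable M (\<lambda>\<omega>. (B (E t \<omega>) \<omega> - B (E s \<omega>) \<omega>)\<^sup>2)"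
    and "(LINT \<omega>:A|M. B (E t \<omega>) \<omega> - B (E s \<omega>) \<omega>) = 0"
    and "(LINT \<omega>:A|M. (B (E t \<omega>) \<omega> - B (E s \<omega>) \<omega>)\<^sup>2) = c * (LINT \<omega>:A|M. E t \<omega> - E s \<omega>)"
proof -
  have t: "0 \<le> t" using st by simp
  have A_M: "A \<in> sets M" using A sets_G_le[OF st(1)] by blast
  have cont: "AE \<omega> in M. continuous_on {0..} (\<lambda>u. B u \<omega>)"
    using B unfolding orthogonal_increments_def by (auto elim!: eventually_mono)
  define T where "T r n \<omega> = grid_time n r \<omega>" for r n \<omega>
  define x where "x n \<omega> = B (T t n \<omega>) \<omega> - B (T s n \<omega>) \<omega>" for n \<omega>
  define y where "y \<omega> = B (E t \<omega>) \<omega> - B (E s \<omega>) \<omega>" for \<omega>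
  have B_E: "(\<lambda>\<omega>. B (E r \<omega>) \<omega>) \<in> borel_measurable M" if r: "0 \<le> r" for r
    using time_changed_meas_G[OF _ cont r] B subalgebra_G[OF r] measurable_from_subalg
    unfolding orthogonal_increments_def by blast
  then have y_meas: "y \<in> borel_measurable M" unfolding y_def using st t by simp
  have gi_M: "grid_index n r \<in> measurable M (count_space UNIV)" if "0 \<le> r" for n r
    using grid_index_meas[OF that, of n 0] subalgebra_H measurable_from_subalg by blast
  have BT_meas: "(\<lambda>\<omega>. B (T r n \<omega>) \<omega>) \<in> borel_measurable M" if r: "0 \<le> r" for r n
    unfolding T_def using mesh_pos[of n] by (intro grid_process_meas[OF B] gi_M r) simp
  have x_meas: "x n \<in> borel_measurable M" for n
    unfolding x_def using BT_meas st t by simp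
  have le: "AE \<omega> in M. grid_index n s \<omega> \<le> grid_index n t \<omega>" for n
    using E_mono[OF st] by eventually_elim (rule grid_index_mono)
  have int: "integrable M (\<lambda>\<omega>. grid_time n t \<omega> - grid_time n s \<omega>)" for n
    by (intro Bochner_Integration.integrable_diff grid_time_integrable t st)
  note inc = grid_increment_real[OF B mesh_pos A_M grid_index_meas[OF st(1)] grid_cell[OF st(1) A]
      grid_index_meas[OF t] le int, folded T_def, folded x_def]
  have T_lim: "(\<lambda>n. T r n \<omega>) \<longlonglongrightarrow> E r \<omega>" if "0 \<le> E r \<omega>" for r \<omega>
  proof (rule tendsto_sandwich[of "\<lambda>n. E r \<omega>" _ _ "\<lambda>n. E r \<omega> + mesh n"])
    show "(\<lambda>n. E r \<omega> + mesh n) \<longlonglongrightarrow> E r \<omega>"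
      using tendsto_add[OF tendsto_const mesh_tendsto, of "E r \<omega>"] by simp
  qed (use grid_index_bounds[OF that] in \<open>auto simp: T_def less_imp_le\<close>)
  have lim: "AE \<omega> in M. (\<lambda>n. x n \<omega>) \<longlonglongrightarrow> y \<omega>"
    using cont E_nonneg[OF st(1)] E_nonneg[OF t]
  proof eventually_elim
    case (elim \<omega>)
    have "(\<lambda>n. B (T r n \<omega>) \<omega>) \<longlonglongrightarrow> B (E r \<omega>) \<omega>" if "0 \<le> E r \<omega>" for r
      by (rule continuous_on_tendsto_compose[OF elim(1) T_lim[OF that]])
         (use that mesh_pos in \<open>auto simp: T_def less_imp_le\<close>)
    from tendsto_diff[OF this[OF elim(3)] this[OF elim(2)]] show ?case unfolding x_def y_def .
  qed
  \<comment> \<open>Refining the grid changes each of the two values of \<open>B\<close> by at most \<open>c * mesh n\<close> in mean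
    square; the factor 4 comes from \<open>(a - b)\<^sup>2 \<le> 2 a\<^sup>2 + 2 b\<^sup>2\<close>.\<close>
  define \<epsilon> where "\<epsilon> n = 4 * c * mesh n" for n
  have \<epsilon>: "\<epsilon> \<longlonglongrightarrow> 0"
    unfolding \<epsilon>_def using tendsto_mult[OF tendsto_const mesh_tendsto, of "4 * c"] by simp
  have cauchy: "(\<integral>\<omega>. (x n \<omega> - x m \<omega>)\<^sup>2 \<partial>M) \<le> \<epsilon> n" if nm: "n \<le> m" for n m
  proof -
    note rt = grid_increment_refine[OF B t nm, folded T_def]
    note rs = grid_increment_refine[OF B st(1) nm, folded T_def]
    have "(\<integral>\<omega>. (x n \<omega> - x m \<omega>)\<^sup>2 \<partial>M) \<le> (\<integral>\<omega>. 2 * (B (T t n \<omega>) \<omega> - B (T t m \<omega>) \<omega>)\<^sup>2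
        + 2 * (B (T s n \<omega>) \<omega> - B (T s m \<omega>) \<omega>)\<^sup>2 \<partial>M)"
    proof (rule integral_mono')
      show "integrable M (\<lambda>\<omega>. 2 * (B (T t n \<omega>) \<omega> - B (T t m \<omega>) \<omega>)\<^sup>2
          + 2 * (B (T s n \<omega>) \<omega> - B (T s m \<omega>) \<omega>)\<^sup>2)"
        using rt rs by simp
      show "(x n \<omega> - x m \<omega>)\<^sup>2 \<le> 2 * (B (T t n \<omega>) \<omega> - B (T t m \<omega>) \<omega>)\<^sup>2
          + 2 * (B (T s n \<omega>) \<omega> - B (T s m \<omega>) \<omega>)\<^sup>2" for \<omega>
        using square_diff_le[of "B (T t n \<omega>) \<omega> - B (T t m \<omega>) \<omega>" "B (T s n \<omega>) \<omega> - B (T s m \<omega>) \<omega>"]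
        by (simp add: x_def algebra_simps)
    qed simp
    also have "\<dots> \<le> \<epsilon> n" using rt rs by (simp add: \<epsilon>_def)
    finally show ?thesis .
  qed
  note L2 = L2_cauchy_limit[OF x_meas y_meas inc(1) lim cauchy]
  show "integrable M (\<lambda>\<omega>. (B (E t \<omega>) \<omega> - B (E s \<omega>) \<omega>)\<^sup>2)" using L2(3) unfolding y_def .
  have "(\<lambda>n. LINT \<omega>:A|M. x n \<omega>) \<longlonglongrightarrow> (LINT \<omega>:A|M. y \<omega>)"
    by (rule L2_limit_integral[OF x_meas y_meas inc(1) L2(3,1,2) \<epsilon> A_M])
  then have "(\<lambda>n. 0) \<longlonglongrightarrow> (LINT \<omega>:A|M. y \<omega>)" unfolding inc(2) .
  then show "(LINT \<omega>:A|M. B (E t \<omega>) \<omega> - B (E s \<omega>) \<omega>) = 0"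
    unfolding y_def by (simp add: LIMSEQ_const_iff)
  have "(\<lambda>n. LINT \<omega>:A|M. (x n \<omega>)\<^sup>2) \<longlonglongrightarrow> (LINT \<omega>:A|M. (y \<omega>)\<^sup>2)"
    by (rule L2_limit_square_integral[OF inc(1) L2(3,1,2) \<epsilon> A_M])
  then have 1: "(\<lambda>n. c * (LINT \<omega>:A|M. T t n \<omega> - T s n \<omega>)) \<longlonglongrightarrow> (LINT \<omega>:A|M. (y \<omega>)\<^sup>2)"
    unfolding inc(3) .
  have "(\<lambda>n. LINT \<omega>:A|M. T t n \<omega> - T s n \<omega>) \<longlonglongrightarrow> (LINT \<omega>:A|M. E t \<omega> - E s \<omega>)"
    unfolding set_lebesgue_integral_def
  proof (rule integral_dominated_convergence[where w="\<lambda>\<omega>. E t \<omega> + 1"])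
    have T_M: "T r n \<in> borel_measurable M" if "0 \<le> r" for r n
      using grid_time_integrable[OF that] unfolding T_def[symmetric] by simp
    show "(\<lambda>\<omega>. indicator A \<omega> *\<^sub>R (E t \<omega> - E s \<omega>)) \<in> borel_measurable M"
      "(\<lambda>\<omega>. indicator A \<omega> *\<^sub>R (T t n \<omega> - T s n \<omega>)) \<in> borel_measurable M" for n
      using A_M E_meas st t T_M by auto
    show "integrable M (\<lambda>\<omega>. E t \<omega> + 1)" using E_int t by simp
    show "AE \<omega> in M. (\<lambda>n. indicator A \<omega> *\<^sub>R (T t n \<omega> - T s n \<omega>)) \<longlonglongrightarrow> indicator A \<omega> *\<^sub>R (E t \<omega> - E s \<omega>)"
      using E_nonneg[OF st(1)] E_nonneg[OF t] by eventually_elim (intro tendsto_intros T_lim)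
    show "AE \<omega> in M. norm (indicator A \<omega> *\<^sub>R (T t n \<omega> - T s n \<omega>)) \<le> E t \<omega> + 1" for n
      using E_nonneg[OF st(1)] E_nonneg[OF t] le[of n]
    proof eventually_elim
      case (elim \<omega>)
      have "mesh n \<le> 1" by (simp add: mesh_def)
      moreover have "T s n \<omega> \<le> T t n \<omega>" "0 \<le> T s n \<omega>"
        using elim(3) mesh_pos[of n] by (auto simp: T_def intro!: mult_left_mono)
      ultimately show ?case
        using grid_index_bounds(2)[OF elim(2), of n] elim by (auto simp: indicator_def T_def)
    qed
  qed
  then have "(\<lambda>n. c * (LINT \<omega>:A|M. T t n \<omega> - T s n \<omega>)) \<longlonglongrightarrow> c * (LINT \<omega>:A|M. E t \<omega> - E s \<omega>)"
    by (intro tendsto_intros)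
  from LIMSEQ_unique[OF 1 this]
  show "(LINT \<omega>:A|M. (B (E t \<omega>) \<omega> - B (E s \<omega>) \<omega>)\<^sup>2) = c * (LINT \<omega>:A|M. E t \<omega> - E s \<omega>)"
    unfolding y_def .
qed

end

section \<open>Path continuity of the Q-Wiener process\<close>

text \<open>Passing from level \<open>n\<close> to level \<open>n + 1\<close> costs at most one step of the finer grid.\<close>

lemma dyadic_chaining:
  fixes x :: "real \<Rightarrow> real"
  assumes step: "\<And>l k. k < 2 ^ l \<Longrightarrow> \<bar>x (real (Suc k) / 2 ^ l) - x (real k / 2 ^ l)\<bar> \<le> a l"
    and i: "i \<le> 2 ^ n"
  shows "\<bar>x (real i / 2 ^ n) - x 0\<bar> \<le> (\<Sum>l\<le>n. a l)"
  using i
proof (induction n arbitrary: i)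
  case 0
  then have "i = 0 \<or> i = 1" by auto
  then show ?case using step[of 0 0] by auto
next
  case (Suc n)
  have a0: "0 \<le> a (Suc n)" by (rule order_trans[OF abs_ge_zero step[of 0 "Suc n"]]) simp
  obtain k where k: "i = 2 * k \<or> i = 2 * k + 1" by (metis evenE oddE)
  have half: "real (2 * k) / 2 ^ Suc n = real k / 2 ^ n" by simp
  have k_le: "k \<le> 2 ^ n" using k Suc.prems by auto
  from k show ?case
  proof
    assume "i = 2 * k"
    then have "\<bar>x (real i / 2 ^ Suc n) - x 0\<bar> \<le> (\<Sum>l\<le>n. a l)"
      using Suc.IH[OF k_le] half by simp
    then show ?thesis using a0 by simp
  next
    assume i: "i = 2 * k + 1"
    then have "2 * k < 2 ^ Suc n" using Suc.prems by simp
    from step[OF this] have "\<bar>x (real i / 2 ^ Suc n) - x (real k / 2 ^ n)\<bar> \<le> a (Suc n)"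
      unfolding half using i by (simp add: add.commute)
    then show ?thesis using Suc.IH[OF k_le] by simp
  qed
qed

text \<open>
  Cauchy--Schwarz with geometric weights makes the square of the chaining bound linear in the
  fourth powers \<open>D\<close>, at the price of a geometric factor.
\<close>

lemma square_of_sum_of_fourth_roots:
  fixes D :: "nat \<Rightarrow> real"
  assumes D: "\<And>l. 0 \<le> D l"
  shows "(\<Sum>l\<le>n. sqrt (sqrt (D l)))\<^sup>2 \<le> 6 * (\<Sum>l\<le>n. (9/10) ^ l + D l / ((9/10) ^ l) ^ 5)"
proof -
  define q :: "nat \<Rightarrow> real" where "q l = (9/10) ^ l" for l
  have q: "0 < q l" for l by (simp add: q_def)
  have "(\<Sum>l\<le>n. sqrt (sqrt (D l))) = (\<Sum>l\<le>n. q l * (sqrt (sqrt (D l)) / q l))"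
    using q by (intro sum.cong) (auto simp: less_imp_neq[symmetric])
  then have "(\<Sum>l\<le>n. sqrt (sqrt (D l)))\<^sup>2 \<le> (\<Sum>l\<le>n. (q l)\<^sup>2) * (\<Sum>l\<le>n. (sqrt (sqrt (D l)) / q l)\<^sup>2)"
    using Cauchy_Schwarz_ineq_sum[of q "\<lambda>l. sqrt (sqrt (D l)) / q l" "{..n}"] by simp
  also have "\<dots> \<le> 6 * (\<Sum>l\<le>n. q l + D l / (q l) ^ 5)"
  proof (rule mult_mono)
    \<comment> \<open>The geometric series sums to \<open>100 / 19\<close>, which is below 6.\<close>
    have "(\<Sum>l\<le>n. (q l)\<^sup>2) = (\<Sum>l\<le>n. (81/100) ^ l)"
      by (intro sum.cong) (auto simp: q_def power2_eq_square power_mult_distrib[symmetric])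
    also have "\<dots> \<le> (\<Sum>l. (81/100) ^ l)"
      by (intro sum_le_suminf summable_geometric) auto
    also have "\<dots> \<le> 6" by (subst suminf_geometric) auto
    finally show "(\<Sum>l\<le>n. (q l)\<^sup>2) \<le> 6" .
    show "(\<Sum>l\<le>n. (sqrt (sqrt (D l)) / q l)\<^sup>2) \<le> (\<Sum>l\<le>n. q l + D l / (q l) ^ 5)"
    proof (rule sum_mono)
      fix l
      define z where "z = (sqrt (sqrt (D l)) / q l)\<^sup>2"
      have z0: "0 \<le> z" by (simp add: z_def)
      have "z = sqrt (D l) / (q l)\<^sup>2" using D[of l] by (simp add: z_def power_divide)
      then have "z\<^sup>2 / q l = D l / (q l) ^ 5"
        using D[of l] q[of l] by (simp add: power_divide power2_eq_square power_numeral_reduce)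
      moreover have "z \<le> q l + z\<^sup>2 / q l"
      proof (cases "z \<le> q l")
        case True
        then show ?thesis using q[of l] by (simp add: add_increasing2)
      next
        case False
        then have "z * q l \<le> z * z" using z0 by (intro mult_left_mono) auto
        then have "z \<le> z\<^sup>2 / q l" using q[of l] by (simp add: pos_le_divide_eq power2_eq_square)
        then show ?thesis using q[of l] by simp
      qed
      ultimately show "(sqrt (sqrt (D l)) / q l)\<^sup>2 \<le> q l + D l / (q l) ^ 5" by (simp add: z_def)
    qed
    show "0 \<le> (\<Sum>l\<le>n. (sqrt (sqrt (D l)) / q l)\<^sup>2)" by (intro sum_nonneg) auto
  qed simp
  finally show ?thesis unfolding q_def .
qed

context wiener_family
begin

definition quartic_variation :: "real \<Rightarrow> nat \<Rightarrow> nat \<Rightarrow> 'w \<Rightarrow> real" where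
  "quartic_variation T j l \<omega> =
     (\<Sum>k<2 ^ l. (w j (T * (real (Suc k) / 2 ^ l)) \<omega> - w j (T * (real k / 2 ^ l)) \<omega>) ^ 4)"

lemma quartic_variation_nonneg: "0 \<le> quartic_variation T j l \<omega>"
  unfolding quartic_variation_def by (intro sum_nonneg) (simp add: zero_le_even_power)

lemma quartic_variation_meas: "0 \<le> T \<Longrightarrow> quartic_variation T j l \<in> borel_measurable M"
  unfolding quartic_variation_def[abs_def]
  by (intro borel_measurable_sum borel_measurable_power borel_measurable_diff w_meas) auto

text \<open>Each of the \<open>2\<^sup>l\<close> increments has fourth moment \<open>3 (T / 2\<^sup>l)\<^sup>2\<close>.\<close>

lemma quartic_variation_mean:
  assumes "0 < T"
  shows "(\<integral>\<^sup>+\<omega>. ennreal (quartic_variation T j l \<omega>) \<partial>M) = ennreal (3 * T\<^sup>2 / 2 ^ l)"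
proof -
  have inc: "0 \<le> T * (real k / 2 ^ l)" "T * (real k / 2 ^ l) < T * (real (Suc k) / 2 ^ l)" for k
    using assms by (auto simp: field_simps)
  have int: "integrable M (\<lambda>\<omega>. (w j (T * (real (Suc k) / 2 ^ l)) \<omega> - w j (T * (real k / 2 ^ l)) \<omega>) ^ 4)" for k
    by (rule increment_moment(1)[OF inc])
  have "(\<integral>\<omega>. quartic_variation T j l \<omega> \<partial>M) = (\<Sum>k<2 ^ l. 3 * (T * (real (Suc k) / 2 ^ l) - T * (real k / 2 ^ l))\<^sup>2)"
    unfolding quartic_variation_def using int
    by (subst Bochner_Integration.integral_sum) (auto simp only: increment_moment(4)[OF inc])
  also have "\<dots> = (\<Sum>k<(2::nat) ^ l. 3 * (T / 2 ^ l)\<^sup>2)"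
    by (intro sum.cong refl arg_cong[where f="\<lambda>x. 3 * x\<^sup>2"]) (simp add: field_simps)
  also have "\<dots> = 3 * T\<^sup>2 / 2 ^ l" by (simp add: power_divide power2_eq_square)
  finally have "(\<integral>\<omega>. quartic_variation T j l \<omega> \<partial>M) = 3 * T\<^sup>2 / 2 ^ l" .
  moreover have "integrable M (quartic_variation T j l)"
    unfolding quartic_variation_def[abs_def] using int by (intro Bochner_Integration.integrable_sum) auto
  ultimately show ?thesis
    by (subst nn_integral_eq_integral) (auto simp: quartic_variation_nonneg)
qed

abbreviation chaining_term :: "real \<Rightarrow> nat \<Rightarrow> nat \<Rightarrow> 'w \<Rightarrow> real" where
  "chaining_term T j l \<omega> \<equiv> 6 * ((9/10) ^ l + quartic_variation T j l \<omega> / ((9/10) ^ l) ^ 5)"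

text \<open>
  An integrable bound for \<open>(w j)\<^sup>2\<close> on \<open>[0, T]\<close>, with the weights of the chaining estimate.
\<close>

definition maximal_bound :: "real \<Rightarrow> nat \<Rightarrow> 'w \<Rightarrow> ennreal" where
  "maximal_bound T j \<omega> = (\<Sum>l. ennreal (chaining_term T j l \<omega>))"

lemma maximal_bound_meas: "0 \<le> T \<Longrightarrow> maximal_bound T j \<in> borel_measurable M"
  unfolding maximal_bound_def[abs_def] using quartic_variation_meas[of T j] by measurable

text \<open>
  The quartic variation at level \<open>l\<close> has mean of order \<open>2\<^sup>-\<^sup>l\<close>, which beats the weight because
  \<open>2 (9/10)\<^sup>5 > 1\<close>. The bound is the same for all \<open>j\<close>.
\<close>

lemma maximal_bound_mean:
  assumes "0 < T"
  shows "\<exists>C. \<forall>j. (\<integral>\<^sup>+\<omega>. maximal_bound T j \<omega> \<partial>M) \<le> ennreal C"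
proof -
  \<comment> \<open>Here \<open>100000 / 118098 = 1 / (2 (9/10)\<^sup>5)\<close>.\<close>
  define b :: "nat \<Rightarrow> real" where "b l = 6 * (9/10) ^ l + 18 * T\<^sup>2 * (100000/118098) ^ l" for l
  have b0: "0 \<le> b l" for l by (simp add: b_def)
  have b_sum: "summable b"
    unfolding b_def by (intro summable_add summable_mult summable_geometric) auto
  have "(\<integral>\<^sup>+\<omega>. maximal_bound T j \<omega> \<partial>M) \<le> ennreal (\<Sum>l. b l)" for j
  proof -
    have [measurable]: "quartic_variation T j l \<in> borel_measurable M" for l
      using assms by (intro quartic_variation_meas) auto
    have "(\<integral>\<^sup>+\<omega>. maximal_bound T j \<omega> \<partial>M)
        = (\<Sum>l. \<integral>\<^sup>+\<omega>. ennreal (chaining_term T j l \<omega>) \<partial>M)"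
      unfolding maximal_bound_def by (rule nn_integral_suminf) measurable
    also have "\<dots> = (\<Sum>l. ennreal (b l))"
    proof (rule arg_cong[where f=suminf], rule ext)
      fix l
      have "(\<integral>\<^sup>+\<omega>. ennreal (chaining_term T j l \<omega>) \<partial>M)
          = (\<integral>\<^sup>+\<omega>. ennreal (6 * (9/10) ^ l) + ennreal (6 / ((9/10) ^ l) ^ 5) * ennreal (quartic_variation T j l \<omega>) \<partial>M)"
        by (intro nn_integral_cong)
           (simp add: ennreal_plus[symmetric] ennreal_mult[symmetric] quartic_variation_nonneg algebra_simps del: ennreal_plus)
      also have "\<dots> = ennreal (6 * (9/10) ^ l) + ennreal (6 / ((9/10) ^ l) ^ 5) * ennreal (3 * T\<^sup>2 / 2 ^ l)"
        by (subst nn_integral_add) (auto simp: nn_integral_cmult quartic_variation_mean[OF assms] emeasure_space_1)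
      also have "\<dots> = ennreal (6 * (9/10) ^ l + 6 / ((9/10) ^ l) ^ 5 * (3 * T\<^sup>2 / 2 ^ l))"
        by (simp add: ennreal_plus[symmetric] ennreal_mult[symmetric] del: ennreal_plus)
      also have "6 * (9/10) ^ l + 6 / ((9/10) ^ l) ^ 5 * (3 * T\<^sup>2 / 2 ^ l) = b l"
      proof -
        have "((9/10 :: real) ^ l) ^ 5 * 2 ^ l = ((9/10) ^ 5 * 2) ^ l"
          by (simp add: power_mult_distrib power_mult[symmetric] mult.commute)
        then have "6 / ((9/10) ^ l) ^ 5 * (3 * T\<^sup>2 / 2 ^ l) = 18 * T\<^sup>2 / ((9/10) ^ 5 * 2) ^ l" by simp
        also have "(9/10 :: real) ^ 5 * 2 = 118098 / 100000" by (simp add: power_divide)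
        also have "18 * T\<^sup>2 / (118098 / 100000) ^ l = 18 * T\<^sup>2 * (100000/118098) ^ l"
          by (simp add: power_divide)
        finally show ?thesis by (simp add: b_def)
      qed
      finally show "(\<integral>\<^sup>+\<omega>. ennreal (chaining_term T j l \<omega>) \<partial>M) = ennreal (b l)" .
    qed
    also have "\<dots> = ennreal (\<Sum>l. b l)" by (rule suminf_ennreal2[OF b0 b_sum])
    finally show ?thesis by simp
  qed
  then show ?thesis by blast
qed

text \<open>
  Chaining bounds the path at dyadic points, and continuity extends the bound to all times.
\<close>

lemma brownian_path_le_maximal_bound:
  assumes T: "0 < T" and w0: "w j 0 \<omega> = 0" and cont: "continuous_on {0..} (\<lambda>t. w j t \<omega>)" and u: "u \<in> {0..T}"
  shows "ennreal ((w j u \<omega>)\<^sup>2) \<le> maximal_bound T j \<omega>"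
proof -
  define D where "D l = quartic_variation T j l \<omega>" for l
  have D0: "0 \<le> D l" for l by (simp add: D_def quartic_variation_nonneg)
  define x where "x r = w j (T * r) \<omega>" for r
  have step: "\<bar>x (real (Suc k) / 2 ^ l) - x (real k / 2 ^ l)\<bar> \<le> sqrt (sqrt (D l))" if "k < 2 ^ l" for l k
  proof -
    have "(x (real (Suc k) / 2 ^ l) - x (real k / 2 ^ l)) ^ 4 \<le> D l"
      unfolding D_def quartic_variation_def x_def using that
      by (intro member_le_sum[of k "{..<2 ^ l}" "\<lambda>k. (w j (T * (real (Suc k) / 2 ^ l)) \<omega> - w j (T * (real k / 2 ^ l)) \<omega>) ^ 4"]) (auto simp: zero_le_even_power)
    then have "((x (real (Suc k) / 2 ^ l) - x (real k / 2 ^ l))\<^sup>2)\<^sup>2 \<le> D l" by (simp add: power_mult[symmetric])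
    then have "(x (real (Suc k) / 2 ^ l) - x (real k / 2 ^ l))\<^sup>2 \<le> sqrt (D l)" by (rule real_le_rsqrt)
    then have "(\<bar>x (real (Suc k) / 2 ^ l) - x (real k / 2 ^ l)\<bar>)\<^sup>2 \<le> sqrt (D l)" by simp
    then show ?thesis by (rule real_le_rsqrt)
  qed
  have dyadic: "ennreal ((x (real i / 2 ^ n))\<^sup>2) \<le> maximal_bound T j \<omega>" if "i \<le> 2 ^ n" for i n
  proof -
    have "\<bar>x (real i / 2 ^ n)\<bar> \<le> (\<Sum>l\<le>n. sqrt (sqrt (D l)))"
      using dyadic_chaining[of x "\<lambda>l. sqrt (sqrt (D l))", OF step that] w0 by (simp add: x_def)
    then have "(x (real i / 2 ^ n))\<^sup>2 \<le> (\<Sum>l\<le>n. sqrt (sqrt (D l)))\<^sup>2"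
      by (metis abs_ge_zero power2_abs power_mono)
    also have "\<dots> \<le> (\<Sum>l\<le>n. 6 * ((9/10) ^ l + D l / ((9/10) ^ l) ^ 5))"
      using square_of_sum_of_fourth_roots[of D n, OF D0] by (simp only: sum_distrib_left)
    finally have "ennreal ((x (real i / 2 ^ n))\<^sup>2) \<le> ennreal (\<Sum>l\<le>n. 6 * ((9/10) ^ l + D l / ((9/10) ^ l) ^ 5))"
      by (rule ennreal_leI)
    also have "\<dots> = (\<Sum>l\<le>n. ennreal (6 * ((9/10) ^ l + D l / ((9/10) ^ l) ^ 5)))"
      using D0 by (subst sum_ennreal) auto
    also have "\<dots> \<le> maximal_bound T j \<omega>"
      unfolding maximal_bound_def D_def[symmetric] by (intro sum_le_suminf) auto
    finally show ?thesis .
  qed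
  define r where "r = u / T"
  have r: "0 \<le> r" "r \<le> 1" "T * r = u" using u T by (auto simp: r_def)
  define i where "i n = nat \<lfloor>2 ^ n * r\<rfloor>" for n
  have i: "real (i n) / 2 ^ n \<le> r" "r - 1 / 2 ^ n \<le> real (i n) / 2 ^ n" for n
  proof -
    have "real (i n) = of_int \<lfloor>2 ^ n * r\<rfloor>" using r by (simp add: i_def)
    then have "real (i n) \<le> 2 ^ n * r" "2 ^ n * r - 1 \<le> real (i n)" by linarith+
    then have "real (i n) / 2 ^ n \<le> 2 ^ n * r / 2 ^ n" "(2 ^ n * r - 1) / 2 ^ n \<le> real (i n) / 2 ^ n"
      by (intro divide_right_mono; simp)+
    then show "real (i n) / 2 ^ n \<le> r" "r - 1 / 2 ^ n \<le> real (i n) / 2 ^ n"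
      by (simp_all add: diff_divide_distrib)
  qed
  have i_le: "i n \<le> 2 ^ n" for n
  proof -
    have "real (i n) / 2 ^ n \<le> 1" using i(1)[of n] r(2) by linarith
    then have "real (i n) \<le> real (2 ^ n)" by (simp add: pos_divide_le_eq)
    then show ?thesis by (simp only: of_nat_le_iff)
  qed
  have "(\<lambda>n. real (i n) / 2 ^ n) \<longlonglongrightarrow> r"
  proof (rule tendsto_sandwich[of "\<lambda>n. r - 1 / 2 ^ n" _ _ "\<lambda>n. r"])
    have "(\<lambda>n. r - 1 / 2 ^ n) \<longlonglongrightarrow> r - 0"
      using LIMSEQ_inverse_realpow_zero[of 2] by (intro tendsto_intros) (simp add: inverse_eq_divide)
    then show "(\<lambda>n. r - 1 / 2 ^ n) \<longlonglongrightarrow> r" by simp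
  qed (use i in auto)
  from tendsto_mult_left[OF this, of T] have "(\<lambda>n. T * (real (i n) / 2 ^ n)) \<longlonglongrightarrow> u"
    unfolding r(3) .
  then have "(\<lambda>n. x (real (i n) / 2 ^ n)) \<longlonglongrightarrow> w j u \<omega>"
    unfolding x_def using u T by (intro continuous_on_tendsto_compose[OF cont]) auto
  then have "(\<lambda>n. ennreal ((x (real (i n) / 2 ^ n))\<^sup>2)) \<longlonglongrightarrow> ennreal ((w j u \<omega>)\<^sup>2)"
    by (intro tendsto_ennrealI tendsto_intros)
  then show ?thesis by (rule LIMSEQ_le_const2) (use dyadic i_le in auto)
qed

end

text \<open>
  By Pythagoras the tails of the series are bounded by the tails of \<open>\<Sum>j. g j\<close>, uniformly on \<open>S\<close>.
\<close>

lemma orthogonal_series_continuous: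
  fixes f :: "nat \<Rightarrow> 'k::{real_inner, banach}"
  assumes orth: "\<And>i j. f i \<bullet> f j = (if i = j then 1 else 0)"
    and bound: "\<And>j u. u \<in> S \<Longrightarrow> (c j u)\<^sup>2 \<le> g j" and g: "summable g"
    and cont: "\<And>j. continuous_on S (c j)"
  shows "u \<in> S \<Longrightarrow> summable (\<lambda>j. c j u *\<^sub>R f j)"
    and "continuous_on S (\<lambda>u. \<Sum>j. c j u *\<^sub>R f j)"
proof -
  let ?s = "\<lambda>n u. \<Sum>j<n. c j u *\<^sub>R f j"
  have "uniformly_Cauchy_on S ?s"
  proof (rule uniformly_Cauchy_onI')
    fix e :: real assume "0 < e"
    then have "0 < e\<^sup>2" by simp
    with g obtain N where N: "\<And>m n. N \<le> m \<Longrightarrow> norm (sum g {m..<n}) < e\<^sup>2"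
      unfolding summable_Cauchy by blast
    show "\<exists>M. \<forall>u\<in>S. \<forall>m\<ge>M. \<forall>n>m. dist (?s m u) (?s n u) < e"
    proof (intro exI[of _ N] ballI allI impI)
      fix u m n assume u: "u \<in> S" and mn: "N \<le> m" "m < n"
      have split: "{..<n} = {..<m} \<union> {m..<n}" using mn by auto
      have "?s n u = ?s m u + (\<Sum>j\<in>{m..<n}. c j u *\<^sub>R f j)"
        unfolding split by (intro sum.union_disjoint) auto
      then have eq: "dist (?s m u) (?s n u) = norm (\<Sum>j\<in>{m..<n}. c j u *\<^sub>R f j)"
        by (simp add: dist_norm)
      have "(norm (\<Sum>j\<in>{m..<n}. c j u *\<^sub>R f j))\<^sup>2 = (\<Sum>j\<in>{m..<n}. (norm (c j u *\<^sub>R f j))\<^sup>2)"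
        by (rule norm_sum_Pythagorean) (auto simp: pairwise_def orthogonal_def orth)
      also have "\<dots> = (\<Sum>j\<in>{m..<n}. (c j u)\<^sup>2)"
        by (intro sum.cong) (auto simp: power_mult_distrib norm_eq_sqrt_inner orth)
      also have "\<dots> \<le> (\<Sum>j\<in>{m..<n}. g j)" by (intro sum_mono bound u)
      also have "\<dots> < e\<^sup>2" using N[OF mn(1), of n] by simp
      finally show "dist (?s m u) (?s n u) < e"
        unfolding eq by (rule power2_less_imp_less) (use \<open>0 < e\<close> in simp)
    qed
  qed
  then have uc: "uniformly_convergent_on S ?s" by (rule Cauchy_uniformly_convergent)
  then obtain l where l: "uniform_limit S ?s l sequentially" by (auto simp: uniformly_convergent_on_def)
  have sums: "(\<lambda>j. c j u *\<^sub>R f j) sums l u" if "u \<in> S" for u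
    unfolding sums_def using tendsto_uniform_limitI[OF l that] .
  then show "u \<in> S \<Longrightarrow> summable (\<lambda>j. c j u *\<^sub>R f j)" by (auto simp: sums_iff)
  have "continuous_on S l"
    by (rule uniform_limit_theorem[OF _ l]) (auto intro!: always_eventually continuous_intros cont)
  then show "continuous_on S (\<lambda>u. \<Sum>j. c j u *\<^sub>R f j)"
    using sums by (subst continuous_on_cong[OF refl, of _ _ l]) (auto simp: sums_iff)
qed

locale time_changed_q_wiener = time_change +
  fixes Q :: "'k::{real_inner, banach, second_countable_topology} \<Rightarrow>\<^sub>L 'k"
    and f :: "nat \<Rightarrow> 'k" and lam :: "nat \<Rightarrow> real"
  assumes Q_sym: "symmetric_op Q" and Q_nonneg: "nonneg_op Q" and Q_tc: "trace_class Q"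
    and f_inj: "inj f" and f_onb: "orthonormal_basis (range f)"
    and eig: "\<And>j. Q (f j) = lam j *\<^sub>R f j"
begin

lemma lam_nonneg: "0 \<le> lam j"
  by (rule eigenvalues_nonneg[where f=f, OF Q_nonneg f_onb eig])

lemma lam_summable: "summable lam"
  by (rule trace_class_eigenvalues_summable[OF Q_nonneg Q_tc f_onb f_inj eig])

definition W :: "real \<Rightarrow> 'a \<Rightarrow> 'k" where
  "W u \<omega> = (\<Sum>j. (sqrt (lam j) * w j u \<omega>) *\<^sub>R f j)"

text \<open>
  The means of the maximal bounds are bounded uniformly in \<open>j\<close>, and the eigenvalues are
  summable.
\<close>

lemma weighted_maximal_bound_finite:
  assumes "0 < T"
  shows "AE \<omega> in M. (\<Sum>j. ennreal (lam j) * maximal_bound T j \<omega>) \<noteq> \<infinity>"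
proof (rule nn_integral_noteq_infinite)
  note [measurable] = maximal_bound_meas[OF less_imp_le[OF assms]]
  show "(\<lambda>\<omega>. \<Sum>j. ennreal (lam j) * maximal_bound T j \<omega>) \<in> borel_measurable M" by measurable
  obtain C where C: "\<And>j. (\<integral>\<^sup>+\<omega>. maximal_bound T j \<omega> \<partial>M) \<le> ennreal C"
    using maximal_bound_mean[OF assms] by blast
  have "(\<integral>\<^sup>+\<omega>. (\<Sum>j. ennreal (lam j) * maximal_bound T j \<omega>) \<partial>M)
      = (\<Sum>j. ennreal (lam j) * (\<integral>\<^sup>+\<omega>. maximal_bound T j \<omega> \<partial>M))"
    by (simp add: nn_integral_suminf nn_integral_cmult)
  also have "\<dots> \<le> (\<Sum>j. ennreal (lam j) * ennreal C)"
    by (intro suminf_le mult_left_mono C) auto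
  also have "\<dots> = ennreal (\<Sum>j. lam j) * ennreal C"
    by (simp add: suminf_ennreal2[OF lam_nonneg lam_summable] ennreal_suminf_multc)
  also have "\<dots> < \<infinity>" by (simp add: ennreal_mult_less_top)
  finally show "(\<integral>\<^sup>+\<omega>. (\<Sum>j. ennreal (lam j) * maximal_bound T j \<omega>) \<partial>M) \<noteq> \<infinity>" by simp
qed

lemma W_paths:
  "AE \<omega> in M. W 0 \<omega> = 0 \<and> continuous_on {0..} (\<lambda>u. W u \<omega>) \<and>
     (\<forall>u\<ge>0. summable (\<lambda>j. (sqrt (lam j) * w j u \<omega>) *\<^sub>R f j))"
proof -
  have fin: "AE \<omega> in M. \<forall>m::nat. (\<Sum>j. ennreal (lam j) * maximal_bound (real (Suc m)) j \<omega>) \<noteq> \<infinity>"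
    unfolding AE_all_countable by (intro allI weighted_maximal_bound_finite) simp
  have wj: "AE \<omega> in M. \<forall>j. w j 0 \<omega> = 0 \<and> continuous_on {0..} (\<lambda>t. w j t \<omega>)"
    unfolding AE_all_countable using bm by (auto simp: standard_brownian_motion_def)
  from fin wj show ?thesis
  proof eventually_elim
    case (elim \<omega>)
    have local: "(\<forall>u\<in>{0..real (Suc m)}. summable (\<lambda>j. (sqrt (lam j) * w j u \<omega>) *\<^sub>R f j)) \<and>
        continuous_on {0..real (Suc m)} (\<lambda>u. W u \<omega>)" for m
    proof -
      define e where "e j = ennreal (lam j) * maximal_bound (real (Suc m)) j \<omega>" for j
      have e_sum: "(\<Sum>j. e j) \<noteq> \<infinity>" using elim(1) by (simp add: e_def)
      have e_fin: "e j \<noteq> \<infinity>" for j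
      proof -
        have "e j \<le> (\<Sum>j. e j)" using sum_le_suminf[of e "{j}"] by simp
        then show ?thesis using e_sum by (auto simp: top_unique)
      qed
      then have e_real: "e j = ennreal (enn2real (e j))" for j
        by (simp add: less_top[symmetric])
      have g: "summable (\<lambda>j. enn2real (e j))"
        by (rule summable_suminf_not_top) (use e_sum e_real in auto)
      have bound: "(sqrt (lam j) * w j u \<omega>)\<^sup>2 \<le> enn2real (e j)" if u: "u \<in> {0..real (Suc m)}" for j u
      proof -
        have "ennreal ((sqrt (lam j) * w j u \<omega>)\<^sup>2) = ennreal (lam j) * ennreal ((w j u \<omega>)\<^sup>2)"
          by (simp add: power_mult_distrib lam_nonneg ennreal_mult)
        also have "\<dots> \<le> e j"
          unfolding e_def using elim(2) u
          by (intro mult_left_mono brownian_path_le_maximal_bound) auto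
        finally have "ennreal ((sqrt (lam j) * w j u \<omega>)\<^sup>2) \<le> ennreal (enn2real (e j))"
          using e_real[of j] by simp
        then show ?thesis by (subst (asm) ennreal_le_iff) auto
      qed
      have cont: "continuous_on {0..real (Suc m)} (\<lambda>u. sqrt (lam j) * w j u \<omega>)" for j
      proof -
        have "continuous_on {0..real (Suc m)} (\<lambda>u. w j u \<omega>)"
          by (rule continuous_on_subset[of "{0..}"]) (use elim(2) in auto)
        then show ?thesis by (intro continuous_intros)
      qed
      note series = orthogonal_series_continuous[where c="\<lambda>j u. sqrt (lam j) * w j u \<omega>" and f=f,
          OF sequence_orthonormal[OF f_onb f_inj] bound g cont]
      show ?thesis using series unfolding W_def by blast
    qed
    have "W 0 \<omega> = 0" using elim(2) by (simp add: W_def)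
    moreover have "summable (\<lambda>j. (sqrt (lam j) * w j u \<omega>) *\<^sub>R f j)" if "0 \<le> u" for u
    proof -
      have "u \<le> real (Suc (nat \<lceil>u\<rceil>))" by linarith
      then show ?thesis using local[of "nat \<lceil>u\<rceil>"] that by simp
    qed
    moreover have "continuous_on {0..} (\<lambda>u. W u \<omega>)"
      unfolding continuous_on_eq_continuous_within
    proof
      fix u :: real assume "u \<in> {0..}"
      define m where "m = nat \<lceil>u\<rceil>"
      have m: "u < real (Suc m)" unfolding m_def by linarith
      have "continuous (at u within {0..real (Suc m)}) (\<lambda>u. W u \<omega>)"
        using local[of m] \<open>u \<in> {0..}\<close> m by (auto simp: continuous_on_eq_continuous_within)
      moreover have "at u within {0..real (Suc m)} = at u within {0..}"
        by (rule at_within_nhd[of u "{..<real (Suc m)}"]) (use m in auto)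
      ultimately show "continuous (at u within {0..}) (\<lambda>u. W u \<omega>)" by simp
    qed
    ultimately show ?case by blast
  qed
qed

lemma W_inner_sums:
  assumes "summable (\<lambda>j. (sqrt (lam j) * w j u \<omega>) *\<^sub>R f j)"
  shows "(\<lambda>j. (sqrt (lam j) * (f j \<bullet> h)) * w j u \<omega>) sums (W u \<omega> \<bullet> h)"
  using bounded_linear.sums[OF bounded_linear_inner_left summable_sums[OF assms], of h]
  by (simp add: W_def mult_ac)

text \<open>
  Increments of different Brownian motions are uncorrelated, also on events of the past.
\<close>

lemma finite_combination_increment:
  fixes a :: "nat \<Rightarrow> real"
  assumes uv: "0 \<le> u" "u \<le> v" and A: "A \<in> sets (H u)" and J: "finite J"
  defines "S \<equiv> \<lambda>\<omega>. \<Sum>j\<in>J. a j * (w j v \<omega> - w j u \<omega>)"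
  shows "integrable M (\<lambda>\<omega>. (S \<omega>)\<^sup>2)" "(LINT \<omega>:A|M. S \<omega>) = 0"
    "(LINT \<omega>:A|M. (S \<omega>)\<^sup>2) = (\<Sum>j\<in>J. (a j)\<^sup>2) * (v - u) * prob A"
proof -
  have A_M: "A \<in> sets M" using A sets_H_le by blast
  let ?d = "\<lambda>j \<omega>. w j v \<omega> - w j u \<omega>"
  have sq: "(S \<omega>)\<^sup>2 = (\<Sum>i\<in>J. \<Sum>j\<in>J. (a i * a j) * (?d i \<omega> * ?d j \<omega>))" for \<omega>
    unfolding S_def power2_eq_square sum_product by (intro sum.cong) (auto simp: mult_ac)
  have int: "integrable M (\<lambda>\<omega>. (a i * a j) * (?d i \<omega> * ?d j \<omega>))" for i j
    by (intro integrable_mult_right increment_square_integrable(2)[OF uv])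
  show "integrable M (\<lambda>\<omega>. (S \<omega>)\<^sup>2)"
    unfolding sq by (intro Bochner_Integration.integrable_sum int)
  have intA: "integrable M (\<lambda>\<omega>. indicator A \<omega> *\<^sub>R g \<omega>)" if "integrable M g" for g :: "'a \<Rightarrow> real"
    by (intro integrable_mult_indicator A_M that)
  have "(LINT \<omega>:A|M. S \<omega>) = (\<integral>\<omega>. (\<Sum>j\<in>J. a j * (indicator A \<omega> *\<^sub>R ?d j \<omega>)) \<partial>M)"
    unfolding set_lebesgue_integral_def S_def
    by (intro Bochner_Integration.integral_cong) (auto simp: scaleR_sum_right sum_distrib_left mult_ac)
  also have "\<dots> = (\<Sum>j\<in>J. a j * (LINT \<omega>:A|M. ?d j \<omega>))"
    unfolding set_lebesgue_integral_def
    by (subst Bochner_Integration.integral_sum)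
       (intro integrable_mult_right intA increment_square_integrable(1)[OF uv], simp)
  also have "\<dots> = 0" by (simp add: increment_orthogonal_past(1)[OF uv A])
  finally show "(LINT \<omega>:A|M. S \<omega>) = 0" .
  have "(LINT \<omega>:A|M. (S \<omega>)\<^sup>2)
      = (\<integral>\<omega>. (\<Sum>i\<in>J. \<Sum>j\<in>J. (a i * a j) * (indicator A \<omega> *\<^sub>R (?d i \<omega> * ?d j \<omega>))) \<partial>M)"
    unfolding set_lebesgue_integral_def sq
    by (intro Bochner_Integration.integral_cong) (auto simp: scaleR_sum_right sum_distrib_left mult_ac)
  also have "\<dots> = (\<Sum>i\<in>J. \<Sum>j\<in>J. (a i * a j) * (LINT \<omega>:A|M. ?d i \<omega> * ?d j \<omega>))"
    unfolding set_lebesgue_integral_def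
    by (subst Bochner_Integration.integral_sum, intro Bochner_Integration.integrable_sum integrable_mult_right intA
        increment_square_integrable(2)[OF uv], intro sum.cong refl, subst Bochner_Integration.integral_sum)
       (intro integrable_mult_right intA increment_square_integrable(2)[OF uv], simp)
  also have "\<dots> = (\<Sum>i\<in>J. \<Sum>j\<in>J. if i = j then (a i * a j) * ((v - u) * prob A) else 0)"
    unfolding increment_orthogonal_past(2)[OF uv A] by (intro sum.cong) auto
  also have "\<dots> = (\<Sum>i\<in>J. (a i)\<^sup>2) * (v - u) * prob A"
    using J by (simp add: power2_eq_square sum_distrib_right mult.assoc)
  finally show "(LINT \<omega>:A|M. (S \<omega>)\<^sup>2) = (\<Sum>j\<in>J. (a j)\<^sup>2) * (v - u) * prob A" .
qed

text \<open>
  The partial sums of \<open>\<Sum>j. sqrt (lam j) (f j \<bullet> h) w j\<close> have the property with the partial sums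
  of \<open>\<Sum>j. lam j (f j \<bullet> h)\<^sup>2 = Q h \<bullet> h\<close> as rate, and they converge in \<open>L\<^sup>2\<close>.
\<close>

theorem W_inner_orthogonal_increments: "orthogonal_increments (Q h \<bullet> h) (\<lambda>u \<omega>. W u \<omega> \<bullet> h)"
proof -
  define a where "a j = sqrt (lam j) * (f j \<bullet> h)" for j
  have a_sums: "(\<lambda>j. (a j)\<^sup>2) sums (Q h \<bullet> h)"
    using spectral_form_sums[OF f_onb f_inj eig, of h h]
    by (simp add: a_def power_mult_distrib lam_nonneg power2_eq_square[of "f _ \<bullet> h"] mult.assoc)
  define P where "P n u \<omega> = (\<Sum>j<n. a j * w j u \<omega>)" for n u \<omega>
  have P_lim: "AE \<omega> in M. \<forall>u\<ge>0. (\<lambda>n. P n u \<omega>) \<longlonglongrightarrow> W u \<omega> \<bullet> h"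
    using W_paths by eventually_elim (use W_inner_sums in \<open>auto simp: P_def a_def sums_def\<close>)
  have meas: "(\<lambda>\<omega>. W u \<omega> \<bullet> h) \<in> borel_measurable (H u)" if u: "0 \<le> u" for u
  proof (rule borel_measurable_AE_limit[OF complete space_H])
    show "null_sets M \<subseteq> sets (H u)" using null_sets_H by blast
    show "P n u \<in> borel_measurable (H u)" for n
      unfolding P_def[abs_def] using u by (intro borel_measurable_sum borel_measurable_times w_meas_H) auto
    show "AE \<omega> in M. (\<lambda>n. P n u \<omega>) \<longlonglongrightarrow> W u \<omega> \<bullet> h"
      using P_lim by eventually_elim (use u in simp)
  qed
  have main: "integrable M (\<lambda>\<omega>. (W v \<omega> \<bullet> h - W u \<omega> \<bullet> h)\<^sup>2) \<and>
      (\<forall>A\<in>sets (H u). (LINT \<omega>:A|M. W v \<omega> \<bullet> h - W u \<omega> \<bullet> h) = 0 \<and>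
        (LINT \<omega>:A|M. (W v \<omega> \<bullet> h - W u \<omega> \<bullet> h)\<^sup>2) = (Q h \<bullet> h) * (v - u) * prob A)"
    if uv: "0 \<le> u" "u \<le> v" for u v
  proof -
    have v: "0 \<le> v" using uv by simp
    define x where "x n \<omega> = (\<Sum>j<n. a j * (w j v \<omega> - w j u \<omega>))" for n \<omega>
    define y where "y \<omega> = W v \<omega> \<bullet> h - W u \<omega> \<bullet> h" for \<omega>
    have xP: "x n \<omega> = P n v \<omega> - P n u \<omega>" for n \<omega>
      by (simp add: x_def P_def right_diff_distrib sum_subtractf)
    have WM: "(\<lambda>\<omega>. W r \<omega> \<bullet> h) \<in> borel_measurable M" if "0 \<le> r" for r
      using meas[OF that] subalgebra_H measurable_from_subalg by blast
    have y_meas: "y \<in> borel_measurable M" unfolding y_def using WM uv v by simp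
    have x_meas: "x n \<in> borel_measurable M" for n
      unfolding x_def using uv v by (intro borel_measurable_sum borel_measurable_times borel_measurable_diff w_meas) auto
    have lim: "AE \<omega> in M. (\<lambda>n. x n \<omega>) \<longlonglongrightarrow> y \<omega>"
      using P_lim by eventually_elim (unfold xP y_def, use uv v in \<open>intro tendsto_diff; simp\<close>)
    have top: "space M \<in> sets (H u)" by (metis sets.top space_H)
    have x_int: "integrable M (\<lambda>\<omega>. (x n \<omega>)\<^sup>2)" for n
      unfolding x_def by (rule finite_combination_increment(1)[OF uv top]) simp
    define \<epsilon> where "\<epsilon> n = ((Q h \<bullet> h) - (\<Sum>j<n. (a j)\<^sup>2)) * (v - u)" for n
    have a_lim: "(\<lambda>n. \<Sum>j<n. (a j)\<^sup>2) \<longlonglongrightarrow> Q h \<bullet> h" using a_sums by (simp add: sums_def)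
    have "(\<lambda>n. ((Q h \<bullet> h) - (\<Sum>j<n. (a j)\<^sup>2)) * (v - u)) \<longlonglongrightarrow> ((Q h \<bullet> h) - (Q h \<bullet> h)) * (v - u)"
      by (intro tendsto_intros a_lim)
    then have \<epsilon>: "\<epsilon> \<longlonglongrightarrow> 0" by (simp add: \<epsilon>_def[abs_def])
    have cauchy: "(\<integral>\<omega>. (x n \<omega> - x m \<omega>)\<^sup>2 \<partial>M) \<le> \<epsilon> n" if nm: "n \<le> m" for n m
    proof -
      have split: "{..<m} = {..<n} \<union> {n..<m}" using nm by auto
      have "x m \<omega> = x n \<omega> + (\<Sum>j\<in>{n..<m}. a j * (w j v \<omega> - w j u \<omega>))" for \<omega>
        unfolding x_def split by (intro sum.union_disjoint) auto
      then have "(\<integral>\<omega>. (x n \<omega> - x m \<omega>)\<^sup>2 \<partial>M) = (\<integral>\<omega>. (\<Sum>j\<in>{n..<m}. a j * (w j v \<omega> - w j u \<omega>))\<^sup>2 \<partial>M)"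
        by simp
      also have "\<dots> = (\<Sum>j\<in>{n..<m}. (a j)\<^sup>2) * (v - u)"
        using finite_combination_increment(3)[OF uv top finite_atLeastLessThan[of n m], where a=a] unfolding set_integral_whole_space by (simp add: prob_space)
      also have "(\<Sum>j\<in>{n..<m}. (a j)\<^sup>2) = (\<Sum>j<m. (a j)\<^sup>2) - (\<Sum>j<n. (a j)\<^sup>2)"
        unfolding split by (subst sum.union_disjoint) auto
      also have "\<dots> * (v - u) \<le> \<epsilon> n"
        unfolding \<epsilon>_def
      proof (intro mult_right_mono diff_right_mono)
        show "(\<Sum>j<m. (a j)\<^sup>2) \<le> Q h \<bullet> h"
          using a_sums sum_le_suminf[of "\<lambda>j. (a j)\<^sup>2" "{..<m}"] by (auto simp: sums_iff)
      qed (use uv in simp)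
      finally show ?thesis .
    qed
    note L2 = L2_cauchy_limit[OF x_meas y_meas x_int lim cauchy]
    have "(LINT \<omega>:A|M. y \<omega>) = 0 \<and> (LINT \<omega>:A|M. (y \<omega>)\<^sup>2) = (Q h \<bullet> h) * (v - u) * prob A"
      if A: "A \<in> sets (H u)" for A
    proof
      have A_M: "A \<in> sets M" using A sets_H_le by blast
      have "(\<lambda>n. LINT \<omega>:A|M. x n \<omega>) \<longlonglongrightarrow> (LINT \<omega>:A|M. y \<omega>)"
        by (rule L2_limit_integral[OF x_meas y_meas x_int L2(3,1,2) \<epsilon> A_M])
      moreover have "(LINT \<omega>:A|M. x n \<omega>) = 0" for n
        unfolding x_def by (rule finite_combination_increment(2)[OF uv A]) simp
      ultimately show "(LINT \<omega>:A|M. y \<omega>) = 0" by (simp add: LIMSEQ_const_iff)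
      have "(\<lambda>n. LINT \<omega>:A|M. (x n \<omega>)\<^sup>2) \<longlonglongrightarrow> (LINT \<omega>:A|M. (y \<omega>)\<^sup>2)"
        by (rule L2_limit_square_integral[OF x_int L2(3,1,2) \<epsilon> A_M])
      moreover have "(LINT \<omega>:A|M. (x n \<omega>)\<^sup>2) = (\<Sum>j<n. (a j)\<^sup>2) * (v - u) * prob A" for n
        unfolding x_def by (rule finite_combination_increment(3)[OF uv A]) simp
      moreover have "(\<lambda>n. (\<Sum>j<n. (a j)\<^sup>2) * (v - u) * prob A) \<longlonglongrightarrow> (Q h \<bullet> h) * (v - u) * prob A"
        by (intro tendsto_intros a_lim)
      ultimately show "(LINT \<omega>:A|M. (y \<omega>)\<^sup>2) = (Q h \<bullet> h) * (v - u) * prob A"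
        by (auto intro: LIMSEQ_unique)
    qed
    then show ?thesis using L2(3) unfolding y_def by blast
  qed
  have "AE \<omega> in M. W 0 \<omega> \<bullet> h = 0 \<and> continuous_on {0..} (\<lambda>u. W u \<omega> \<bullet> h)"
    using W_paths by eventually_elim (auto intro!: continuous_intros)
  then show ?thesis
    unfolding orthogonal_increments_def using meas main Q_nonneg by (auto simp: nonneg_op_def)
qed

end

section \<open>The time-changed Q-Wiener process\<close>

lemma martingale_linear_combination:
  fixes X Y :: "real \<Rightarrow> 'w \<Rightarrow> real"
  assumes sub: "\<And>t. t \<in> {0..T} \<Longrightarrow> subalgebra M (G t)"
    and X: "martingale M G T X" and Y: "martingale M G T Y"
  shows "martingale M G T (\<lambda>t \<omega>. a * X t \<omega> + b * Y t \<omega>)"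
  unfolding martingale_def
proof (intro conjI ballI allI impI)
  fix t assume t: "t \<in> {0..T}"
  show "(\<lambda>\<omega>. a * X t \<omega> + b * Y t \<omega>) \<in> borel_measurable (G t)"
    using X Y t unfolding martingale_def by (intro borel_measurable_add borel_measurable_times) auto
  show "integrable M (\<lambda>\<omega>. a * X t \<omega> + b * Y t \<omega>)"
    using X Y t unfolding martingale_def by auto
next
  fix s t A assume st: "0 \<le> s \<and> s \<le> t \<and> t \<le> T" and A: "A \<in> sets (G s)"
  have A_M: "A \<in> sets M" using sub[of s] st A by (auto simp: subalgebra_def)
  have lin: "(LINT \<omega>:A|M. a * X r \<omega> + b * Y r \<omega>) = a * (LINT \<omega>:A|M. X r \<omega>) + b * (LINT \<omega>:A|M. Y r \<omega>)"
    if r: "r \<in> {0..T}" for r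
  proof -
    have "set_integrable M A (X r)" "set_integrable M A (Y r)"
      unfolding set_integrable_def
      using X Y r by (intro integrable_mult_indicator A_M; simp add: martingale_def)+
    then show ?thesis by simp
  qed
  have "(LINT \<omega>:A|M. X t \<omega>) = (LINT \<omega>:A|M. X s \<omega>)" "(LINT \<omega>:A|M. Y t \<omega>) = (LINT \<omega>:A|M. Y s \<omega>)"
    using X Y st A by (auto simp: martingale_def)
  then show "(LINT \<omega>:A|M. a * X t \<omega> + b * Y t \<omega>) = (LINT \<omega>:A|M. a * X s \<omega> + b * Y s \<omega>)"
    using lin[of s] lin[of t] st by auto
qed

context time_changed_q_wiener
begin

abbreviation "X \<equiv> time_changed_Wiener lam f w E"

lemma X_eq: "X t \<omega> = W (E t \<omega>) \<omega>"
  by (simp add: time_changed_Wiener_def W_def)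

lemma X_meas: 
  assumes t: "0 \<le> t"
  shows "X t \<in> borel_measurable (G t)"
proof -
  have "(\<lambda>\<omega>. w j (E t \<omega>) \<omega>) \<in> borel_measurable (G t)" for j
    using bm[of j] by (intro time_changed_meas_G w_meas_H t) (auto simp: standard_brownian_motion_def)
  then show ?thesis unfolding time_changed_Wiener_def[abs_def] by measurable
qed

lemma X_meas_M: "0 \<le> t \<Longrightarrow> X t \<in> borel_measurable M"
  using X_meas subalgebra_G measurable_from_subalg by blast

lemma X_paths: "AE \<omega> in M. X 0 \<omega> = 0 \<and> continuous_on {0..} (\<lambda>t. X t \<omega>)"
  using W_paths E_paths
proof eventually_elim
  case (elim \<omega>)
  have nonneg: "0 \<le> E t \<omega>" if "0 \<le> t" for t
    using mono_onD[of "{0..}" "\<lambda>t. E t \<omega>" 0 t] elim that by simp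
  have "continuous_on {0..} (\<lambda>t. W (E t \<omega>) \<omega>)"
    by (rule continuous_on_compose2[of "{0..}" "\<lambda>u. W u \<omega>"]) (use elim nonneg in auto)
  then show ?case using elim by (simp add: X_eq)
qed

lemma X_increment:
  assumes "0 \<le> s" "s \<le> t" "A \<in> sets (G s)"
  shows "integrable M (\<lambda>\<omega>. (X t \<omega> \<bullet> h - X s \<omega> \<bullet> h)\<^sup>2)"
    and "(LINT \<omega>:A|M. X t \<omega> \<bullet> h - X s \<omega> \<bullet> h) = 0"
    and "(LINT \<omega>:A|M. (X t \<omega> \<bullet> h - X s \<omega> \<bullet> h)\<^sup>2) = (Q h \<bullet> h) * (LINT \<omega>:A|M. E t \<omega> - E s \<omega>)"
  using time_changed_orthogonal_increments[OF W_inner_orthogonal_increments[of h] assms]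
  by (simp_all add: X_eq)

lemma X_inner_square:
  assumes t: "0 \<le> t"
  shows "integrable M (\<lambda>\<omega>. (X t \<omega> \<bullet> h)\<^sup>2)" and "(\<integral>\<omega>. (X t \<omega> \<bullet> h)\<^sup>2 \<partial>M) = (Q h \<bullet> h) * (\<integral>\<omega>. E t \<omega> \<partial>M)"
proof -
  have top: "space M \<in> sets (G 0)" by (metis sets.top space_G)
  have eq: "AE \<omega> in M. (X t \<omega> \<bullet> h - X 0 \<omega> \<bullet> h)\<^sup>2 = (X t \<omega> \<bullet> h)\<^sup>2"
    "AE \<omega> in M. (X t \<omega> \<bullet> h)\<^sup>2 = (X t \<omega> \<bullet> h - X 0 \<omega> \<bullet> h)\<^sup>2"
    using X_paths by (eventually_elim, simp)+
  have E0: "AE \<omega> in M. E t \<omega> - E 0 \<omega> = E t \<omega>" using E_paths by eventually_elim simp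
  have [measurable]: "X t \<in> borel_measurable M" "X 0 \<in> borel_measurable M" "E t \<in> borel_measurable M" "E 0 \<in> borel_measurable M"
    using X_meas_M E_meas t by auto
  show "integrable M (\<lambda>\<omega>. (X t \<omega> \<bullet> h)\<^sup>2)"
    using X_increment(1)[OF order_refl t top, of h]
    by (rule integrable_cong_AE_imp[OF _ _ eq(1)]) measurable
  have "(\<integral>\<omega>. (X t \<omega> \<bullet> h)\<^sup>2 \<partial>M) = (\<integral>\<omega>. (X t \<omega> \<bullet> h - X 0 \<omega> \<bullet> h)\<^sup>2 \<partial>M)"
    by (rule integral_cong_AE[OF _ _ eq(2)]) measurable
  also have "\<dots> = (Q h \<bullet> h) * (\<integral>\<omega>. E t \<omega> - E 0 \<omega> \<partial>M)"
    using X_increment(3)[OF order_refl t top, of h] unfolding set_integral_whole_space .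
  also have "(\<integral>\<omega>. E t \<omega> - E 0 \<omega> \<partial>M) = (\<integral>\<omega>. E t \<omega> \<partial>M)"
    by (rule integral_cong_AE[OF _ _ E0]) measurable
  finally show "(\<integral>\<omega>. (X t \<omega> \<bullet> h)\<^sup>2 \<partial>M) = (Q h \<bullet> h) * (\<integral>\<omega>. E t \<omega> \<partial>M)" .
qed

lemma X_inner_integrable: "0 \<le> t \<Longrightarrow> integrable M (\<lambda>\<omega>. X t \<omega> \<bullet> h)"
  using X_meas_M[of t] by (intro integrable_of_square_integrable[OF _ X_inner_square(1)]) auto

text \<open>
  Expand the square around \<open>X s \<bullet> h\<close>; the mixed term vanishes because \<open>X s \<bullet> h\<close> is known at time
  \<open>s\<close> and the increment is orthogonal to the past.
\<close>

lemma X_inner_square_increment: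
  assumes st: "0 \<le> s" "s \<le> t" and A: "A \<in> sets (G s)"
  shows "(LINT \<omega>:A|M. (X t \<omega> \<bullet> h)\<^sup>2) - (LINT \<omega>:A|M. (X s \<omega> \<bullet> h)\<^sup>2) = (Q h \<bullet> h) * (LINT \<omega>:A|M. E t \<omega> - E s \<omega>)"
proof -
  have t: "0 \<le> t" using st by simp
  have A_M: "A \<in> sets M" using A sets_G_le[OF st(1)] by blast
  define D where "D \<omega> = X t \<omega> \<bullet> h - X s \<omega> \<bullet> h" for \<omega>
  have D_int: "integrable M D" unfolding D_def by (intro Bochner_Integration.integrable_diff X_inner_integrable t st)
  have D2: "integrable M (\<lambda>\<omega>. (D \<omega>)\<^sup>2)" unfolding D_def by (rule X_increment(1)[OF st A])
  have [measurable]: "X s \<in> borel_measurable M" "X t \<in> borel_measurable M" using X_meas_M st t by auto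
  have XD: "integrable M (\<lambda>\<omega>. (X s \<omega> \<bullet> h) * D \<omega>)"
    using D2 X_inner_square(1)[OF st(1)]
    by (intro integrable_mult_of_square_integrable) (auto simp: D_def)
  have cross: "(\<integral>\<omega>. (indicator A \<omega> * (X s \<omega> \<bullet> h)) * D \<omega> \<partial>M) = 0"
  proof (rule integral_mult_conditionally_centred[where F="G s"])
    show "subalgebra M (G s)" by (rule subalgebra_G[OF st(1)])
    show "(LINT \<omega>:C|M. D \<omega>) = 0" if "C \<in> sets (G s)" for C
      unfolding D_def by (rule X_increment(2)[OF st that])
    show "(\<lambda>\<omega>. indicator A \<omega> * (X s \<omega> \<bullet> h)) \<in> borel_measurable (G s)"
      using X_meas[OF st(1)] A by measurable
    show "integrable M (\<lambda>\<omega>. indicator A \<omega> * (X s \<omega> \<bullet> h) * D \<omega>)"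
      using integrable_mult_indicator[OF A_M XD] by (simp add: mult.assoc)
  qed (use D_int in \<open>auto intro: finite_measure_axioms\<close>)
  have int: "set_integrable M A (\<lambda>\<omega>. (X r \<omega> \<bullet> h)\<^sup>2)" if "0 \<le> r" for r
    unfolding set_integrable_def by (intro integrable_mult_indicator A_M X_inner_square(1) that)
  have "(LINT \<omega>:A|M. (X t \<omega> \<bullet> h)\<^sup>2) - (LINT \<omega>:A|M. (X s \<omega> \<bullet> h)\<^sup>2) = (LINT \<omega>:A|M. (X t \<omega> \<bullet> h)\<^sup>2 - (X s \<omega> \<bullet> h)\<^sup>2)"
    using int st t by simp
  also have "\<dots> = (\<integral>\<omega>. indicator A \<omega> *\<^sub>R (D \<omega>)\<^sup>2 + 2 * ((indicator A \<omega> * (X s \<omega> \<bullet> h)) * D \<omega>) \<partial>M)"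
    unfolding set_lebesgue_integral_def
    by (intro Bochner_Integration.integral_cong) (auto simp: D_def power2_eq_square algebra_simps)
  also have "\<dots> = (LINT \<omega>:A|M. (D \<omega>)\<^sup>2) + 2 * (\<integral>\<omega>. (indicator A \<omega> * (X s \<omega> \<bullet> h)) * D \<omega> \<partial>M)"
    unfolding set_lebesgue_integral_def
    using integrable_mult_indicator[OF A_M D2] integrable_mult_indicator[OF A_M XD]
    by (subst Bochner_Integration.integral_add) (auto simp: mult.assoc)
  also have "\<dots> = (Q h \<bullet> h) * (LINT \<omega>:A|M. E t \<omega> - E s \<omega>)"
    unfolding cross unfolding D_def using X_increment(3)[OF st A] by simp
  finally show ?thesis .
qed

lemma E_set_integral_diff:
  assumes "0 \<le> s" "0 \<le> t" "A \<in> sets M"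
  shows "(LINT \<omega>:A|M. E t \<omega> - E s \<omega>) = (LINT \<omega>:A|M. E t \<omega>) - (LINT \<omega>:A|M. E s \<omega>)"
proof -
  have "set_integrable M A (E r)" if "0 \<le> r" for r
    unfolding set_integrable_def by (intro integrable_mult_indicator assms E_int that)
  then show ?thesis using assms by simp
qed

text \<open>
  Common to all the compensated processes below, which differ only in \<open>Y\<close> and in the rate \<open>c\<close>.
\<close>

lemma compensated_martingale:
  fixes Y :: "real \<Rightarrow> 'a \<Rightarrow> real"
  assumes meas: "\<And>t. 0 \<le> t \<Longrightarrow> Y t \<in> borel_measurable (G t)" and int: "\<And>t. 0 \<le> t \<Longrightarrow> integrable M (Y t)"
    and inc: "\<And>s t A. 0 \<le> s \<Longrightarrow> s \<le> t \<Longrightarrow> A \<in> sets (G s) \<Longrightarrow>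
      (LINT \<omega>:A|M. Y t \<omega>) - (LINT \<omega>:A|M. Y s \<omega>) = c * (LINT \<omega>:A|M. E t \<omega> - E s \<omega>)"
  shows "martingale M G T (\<lambda>t \<omega>. Y t \<omega> - c * E t \<omega>)"
  unfolding martingale_def
proof (intro conjI ballI allI impI)
  fix t assume "t \<in> {0..T}"
  then have t: "0 \<le> t" by simp
  show "(\<lambda>\<omega>. Y t \<omega> - c * E t \<omega>) \<in> borel_measurable (G t)" using meas[OF t] E_meas_G[OF t] by simp
  show "integrable M (\<lambda>\<omega>. Y t \<omega> - c * E t \<omega>)" using int[OF t] E_int[OF t] by simp
next
  fix s t A assume st: "0 \<le> s \<and> s \<le> t \<and> t \<le> T" and A: "A \<in> sets (G s)"
  then have s: "0 \<le> s" and t: "0 \<le> t" and st': "s \<le> t" by auto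
  have A_M: "A \<in> sets M" using A sets_G_le[OF s] by blast
  have si: "set_integrable M A (Y r)" "set_integrable M A (\<lambda>\<omega>. c * E r \<omega>)" if "0 \<le> r" for r
    unfolding set_integrable_def by (intro integrable_mult_indicator A_M int integrable_mult_right E_int that)+
  have "(LINT \<omega>:A|M. Y r \<omega> - c * E r \<omega>) = (LINT \<omega>:A|M. Y r \<omega>) - c * (LINT \<omega>:A|M. E r \<omega>)" if "0 \<le> r" for r
    using si[OF that] by simp
  then show "(LINT \<omega>:A|M. Y t \<omega> - c * E t \<omega>) = (LINT \<omega>:A|M. Y s \<omega> - c * E s \<omega>)"
    using inc[OF s st' A] E_set_integral_diff[OF s t A_M] s t by (simp add: right_diff_distrib)
qed

lemma X_inner_square_martingale: "martingale M G T (\<lambda>t \<omega>. (X t \<omega> \<bullet> h)\<^sup>2 - (Q h \<bullet> h) * E t \<omega>)"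
  by (rule compensated_martingale)
     (use X_meas X_inner_square(1) X_inner_square_increment in auto)

text \<open>
  Parseval along the eigenbasis; the series of the integrals converges because the integral of
  the term with index \<open>j\<close> is at most \<open>lam j\<close> times the mean of \<open>E t\<close>.
\<close>

lemma X_norm_square:
  assumes t: "0 \<le> t" and A: "A \<in> sets M"
  shows "integrable M (\<lambda>\<omega>. (norm (X t \<omega>))\<^sup>2)"
    and "(\<lambda>j. LINT \<omega>:A|M. (X t \<omega> \<bullet> f j)\<^sup>2) sums (LINT \<omega>:A|M. (norm (X t \<omega>))\<^sup>2)"
proof -
  have psv: "(\<lambda>j. (x \<bullet> f j)\<^sup>2) sums (norm x)\<^sup>2" for x
  proof -
    have "((\<lambda>e. (x \<bullet> e)\<^sup>2) has_sum (norm x)\<^sup>2) (range f)" by (rule parseval_has_sum[OF f_onb])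
    then have "((\<lambda>e. (x \<bullet> e)\<^sup>2) \<circ> f has_sum (norm x)\<^sup>2) UNIV" by (subst (asm) has_sum_reindex[OF f_inj])
    then show ?thesis using has_sum_imp_sums by (fastforce simp: o_def)
  qed
  have lam_eq: "Q (f j) \<bullet> f j = lam j" for j by (simp add: eig sequence_orthonormal[OF f_onb f_inj])
  have *: "integrable M (\<lambda>\<omega>. indicator C \<omega> *\<^sub>R (norm (X t \<omega>))\<^sup>2) \<and>
      (\<lambda>j. LINT \<omega>:C|M. (X t \<omega> \<bullet> f j)\<^sup>2) sums (LINT \<omega>:C|M. (norm (X t \<omega>))\<^sup>2)" if C: "C \<in> sets M" for C
  proof -
    have int: "integrable M (\<lambda>\<omega>. indicator C \<omega> *\<^sub>R (X t \<omega> \<bullet> f j)\<^sup>2)" for j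
      by (intro integrable_mult_indicator C X_inner_square(1) t)
    have s: "(\<lambda>j. indicator C \<omega> *\<^sub>R (X t \<omega> \<bullet> f j)\<^sup>2) sums (indicator C \<omega> *\<^sub>R (norm (X t \<omega>))\<^sup>2)" for \<omega>
      by (intro sums_scaleR_right psv)
    have a1: "AE \<omega> in M. summable (\<lambda>j. norm (indicator C \<omega> *\<^sub>R (X t \<omega> \<bullet> f j)\<^sup>2))"
      using sums_summable[OF s] by (intro AE_I2) (simp add: abs_mult)
    have a2: "summable (\<lambda>j. \<integral>\<omega>. norm (indicator C \<omega> *\<^sub>R (X t \<omega> \<bullet> f j)\<^sup>2) \<partial>M)"
    proof (rule summable_comparison_test')
      show "summable (\<lambda>j. lam j * (\<integral>\<omega>. E t \<omega> \<partial>M))" by (intro summable_mult2 lam_summable)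
      fix j :: nat
      have "(\<integral>\<omega>. norm (indicator C \<omega> *\<^sub>R (X t \<omega> \<bullet> f j)\<^sup>2) \<partial>M) \<le> (\<integral>\<omega>. (X t \<omega> \<bullet> f j)\<^sup>2 \<partial>M)"
        by (intro integral_mono integrable_norm int X_inner_square(1) t) (auto simp: indicator_def)
      also have "\<dots> = lam j * (\<integral>\<omega>. E t \<omega> \<partial>M)" by (simp add: X_inner_square(2)[OF t] lam_eq)
      finally show "norm (\<integral>\<omega>. norm (indicator C \<omega> *\<^sub>R (X t \<omega> \<bullet> f j)\<^sup>2) \<partial>M) \<le> lam j * (\<integral>\<omega>. E t \<omega> \<partial>M)"
        by simp
    qed
    show ?thesis
      unfolding set_lebesgue_integral_def
      using integrable_suminf[OF int a1 a2] sums_integral[OF int a1 a2] sums_unique[OF s] by simp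
  qed
  show "(\<lambda>j. LINT \<omega>:A|M. (X t \<omega> \<bullet> f j)\<^sup>2) sums (LINT \<omega>:A|M. (norm (X t \<omega>))\<^sup>2)" using *[OF A] by blast
  have "integrable M (\<lambda>\<omega>. indicator (space M) \<omega> *\<^sub>R (norm (X t \<omega>))\<^sup>2)" using * by blast
  then show "integrable M (\<lambda>\<omega>. (norm (X t \<omega>))\<^sup>2)"
    by (rule Bochner_Integration.integrable_cong[THEN iffD1, rotated 2]) auto
qed

lemma op_trace_sums: "lam sums op_trace Q"
  unfolding op_trace_eq_suminf[OF Q_nonneg Q_tc f_onb f_inj eig] by (rule summable_sums[OF lam_summable])

text \<open>
  Add up the increments of the squared coordinates, whose rates \<open>lam j\<close> sum to the trace.
\<close>

lemma X_norm_square_martingale: "martingale M G T (\<lambda>t \<omega>. (norm (X t \<omega>))\<^sup>2 - op_trace Q * E t \<omega>)"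
proof (rule compensated_martingale)
  show "0 \<le> t \<Longrightarrow> (\<lambda>\<omega>. (norm (X t \<omega>))\<^sup>2) \<in> borel_measurable (G t)" for t using X_meas by measurable
  show "0 \<le> t \<Longrightarrow> integrable M (\<lambda>\<omega>. (norm (X t \<omega>))\<^sup>2)" for t by (rule X_norm_square(1)[OF _ sets.top])
  fix s t A assume st: "0 \<le> s" "s \<le> t" and A: "A \<in> sets (G s)"
  have A_M: "A \<in> sets M" using A sets_G_le[OF st(1)] by blast
  have t: "0 \<le> t" using st by simp
  have lam_eq: "Q (f j) \<bullet> f j = lam j" for j by (simp add: eig sequence_orthonormal[OF f_onb f_inj])
  have "(\<lambda>j. lam j * (LINT \<omega>:A|M. E t \<omega> - E s \<omega>)) sums ((LINT \<omega>:A|M. (norm (X t \<omega>))\<^sup>2) - (LINT \<omega>:A|M. (norm (X s \<omega>))\<^sup>2))"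
    using sums_diff[OF X_norm_square(2)[OF t A_M] X_norm_square(2)[OF st(1) A_M]]
    unfolding X_inner_square_increment[OF st A] lam_eq .
  moreover have "(\<lambda>j. lam j * (LINT \<omega>:A|M. E t \<omega> - E s \<omega>)) sums (op_trace Q * (LINT \<omega>:A|M. E t \<omega> - E s \<omega>))"
    by (rule sums_mult2[OF op_trace_sums])
  ultimately show "(LINT \<omega>:A|M. (norm (X t \<omega>))\<^sup>2) - (LINT \<omega>:A|M. (norm (X s \<omega>))\<^sup>2) = op_trace Q * (LINT \<omega>:A|M. E t \<omega> - E s \<omega>)"
    by (rule sums_unique2)
qed

lemma X_integrable: "0 \<le> t \<Longrightarrow> integrable M (X t)"
proof -
  assume t: "0 \<le> t"
  have "integrable M (\<lambda>\<omega>. norm (X t \<omega>))"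
    using X_meas_M[OF t] by (intro integrable_of_square_integrable[OF _ X_norm_square(1)[OF t sets.top]]) auto
  then show ?thesis using X_meas_M[OF t] by (simp add: integrable_norm_iff)
qed

text \<open>
  The martingale identity in the Hilbert space is tested against all vectors, where it is the
  orthogonality of the increments of \<open>X t \<bullet> h\<close>.
\<close>

lemma X_continuous_L2_martingale: "continuous_L2_martingale M G T X"
  unfolding continuous_L2_martingale_def continuous_martingale_def martingale_def
proof (intro conjI ballI allI impI)
  fix s t A assume st: "0 \<le> s \<and> s \<le> t \<and> t \<le> T" and A: "A \<in> sets (G s)"
  then have s: "0 \<le> s" "s \<le> t" "0 \<le> t" by auto
  have A_M: "A \<in> sets M" using A sets_G_le[OF s(1)] by blast
  have int: "integrable M (\<lambda>\<omega>. indicator A \<omega> *\<^sub>R X r \<omega>)" if "0 \<le> r" for r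
    by (intro integrable_mult_indicator A_M X_integrable that)
  have inner: "(LINT \<omega>:A|M. X r \<omega>) \<bullet> h = (LINT \<omega>:A|M. X r \<omega> \<bullet> h)" if "0 \<le> r" for r h
    unfolding set_lebesgue_integral_def
    using integral_inner_left[of h M "\<lambda>\<omega>. indicator A \<omega> *\<^sub>R X r \<omega>"] int[OF that] by simp
  have si: "set_integrable M A (\<lambda>\<omega>. X r \<omega> \<bullet> h)" if "0 \<le> r" for r h
    unfolding set_integrable_def by (intro integrable_mult_indicator A_M X_inner_integrable that)
  have "((LINT \<omega>:A|M. X t \<omega>) - (LINT \<omega>:A|M. X s \<omega>)) \<bullet> h = 0" for h
    using X_increment(2)[OF s(1,2) A, of h] si[OF s(1), of h] si[OF s(3), of h]
    by (simp add: inner_diff_left inner s)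
  from this[of "(LINT \<omega>:A|M. X t \<omega>) - (LINT \<omega>:A|M. X s \<omega>)"]
  show "(LINT \<omega>:A|M. X t \<omega>) = (LINT \<omega>:A|M. X s \<omega>)" by simp
next
  show "AE \<omega> in M. continuous_on {0..T} (\<lambda>t. X t \<omega>)"
    using X_paths by eventually_elim (auto elim: continuous_on_subset)
qed (use X_meas X_integrable X_norm_square(1)[OF _ sets.top] in auto)

lemma E_paths_upto: "AE \<omega> in M. E 0 \<omega> = 0 \<and> continuous_on {0..T} (\<lambda>t. E t \<omega>) \<and> mono_on {0..T} (\<lambda>t. E t \<omega>) \<and> (\<forall>t\<in>{0..T}. 0 \<le> E t \<omega>)"
  using E_paths
proof eventually_elim
  case (elim \<omega>)
  have "0 \<le> E t \<omega>" if "0 \<le> t" for t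
    using mono_onD[of "{0..}" "\<lambda>t. E t \<omega>" 0 t] elim that by simp
  moreover have "continuous_on {0..T} (\<lambda>t. E t \<omega>)"
    by (rule continuous_on_subset[of "{0..}"]) (use elim in auto)
  moreover have "mono_on {0..T} (\<lambda>t. E t \<omega>)"
    by (rule mono_on_subset[of "{0..}"]) (use elim in auto)
  ultimately show ?case using elim by auto
qed

lemma scaled_E_paths:
  assumes "0 \<le> c"
  shows "AE \<omega> in M. c * E 0 \<omega> = 0 \<and> continuous_on {0..T} (\<lambda>t. c * E t \<omega>) \<and> mono_on {0..T} (\<lambda>t. c * E t \<omega>)"
  using E_paths_upto[of T]
proof eventually_elim
  case (elim \<omega>)
  then have "mono_on {0..T} (\<lambda>t. c * E t \<omega>)"
    using assms by (auto simp: mono_on_def mult_left_mono)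
  then show ?case using elim by (auto intro!: continuous_intros)
qed

lemma op_trace_nonneg: "0 \<le> op_trace Q"
  unfolding op_trace_eq_suminf[OF Q_nonneg Q_tc f_onb f_inj eig]
  by (intro suminf_nonneg lam_summable lam_nonneg)

lemma subalgebra_G_upto: "t \<in> {0..T} \<Longrightarrow> subalgebra M (G t)"
  by (rule subalgebra_G) simp

text \<open>The difference of the two compensated processes is a martingale of finite variation.\<close>

lemma compensator_unique:
  assumes c: "0 \<le> c" and int: "\<And>t. t \<in> {0..T} \<Longrightarrow> integrable M (Y t)"
    and m: "martingale M G T (\<lambda>t \<omega>. Y t \<omega> - c * E t \<omega>)" and m': "martingale M G T (\<lambda>t \<omega>. Y t \<omega> - A' t \<omega>)"
    and A': "AE \<omega> in M. A' 0 \<omega> = 0 \<and> continuous_on {0..T} (\<lambda>t. A' t \<omega>) \<and> mono_on {0..T} (\<lambda>t. A' t \<omega>)"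
  shows "indistinguishable M T A' (\<lambda>t \<omega>. c * E t \<omega>)"
proof (rule continuous_finite_variation_martingale_zero[OF prob_space_axioms subalgebra_G_upto _ _ _ scaled_E_paths[OF c] A'])
  have "martingale M G T (\<lambda>t \<omega>. 1 * (Y t \<omega> - c * E t \<omega>) + (- 1) * (Y t \<omega> - A' t \<omega>))"
    by (rule martingale_linear_combination[OF subalgebra_G_upto m m'])
  then show "martingale M G T (\<lambda>t \<omega>. A' t \<omega> - c * E t \<omega>)" by simp
  show "integrable M (\<lambda>\<omega>. c * E t \<omega>)" if "t \<in> {0..T}" for t using that by (intro integrable_mult_right E_int) simp
  show "integrable M (A' t)" if t: "t \<in> {0..T}" for t
  proof -
    have "integrable M (\<lambda>\<omega>. Y t \<omega> - A' t \<omega>)" using m' t by (auto simp: martingale_def)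
    from Bochner_Integration.integrable_diff[OF int[OF t] this] show ?thesis by simp
  qed
qed

lemma X_increasing_process: "is_increasing_process M G T X (\<lambda>t \<omega>. op_trace Q * E t \<omega>)"
  unfolding is_increasing_process_def compensates_norm_square_def
proof (intro conjI allI impI ballI)
  show "(\<lambda>\<omega>. op_trace Q * E t \<omega>) \<in> borel_measurable (G t)" if "t \<in> {0..T}" for t
    using that E_meas_G by simp
  show "AE \<omega> in M. op_trace Q * E 0 \<omega> = 0 \<and> continuous_on {0..T} (\<lambda>t. op_trace Q * E t \<omega>) \<and>
      mono_on {0..T} (\<lambda>t. op_trace Q * E t \<omega>)"
    by (rule scaled_E_paths[OF op_trace_nonneg])
  show "continuous_martingale M G T (\<lambda>t \<omega>. (norm (X t \<omega>))\<^sup>2 - op_trace Q * E t \<omega>)"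
    unfolding continuous_martingale_def
  proof (intro conjI X_norm_square_martingale)
    show "AE \<omega> in M. continuous_on {0..T} (\<lambda>t. (norm (X t \<omega>))\<^sup>2 - op_trace Q * E t \<omega>)"
      using X_paths E_paths_upto[of T]
    proof eventually_elim
      case (elim \<omega>)
      have "continuous_on {0..T} (\<lambda>t. X t \<omega>)"
        by (rule continuous_on_subset[of "{0..}"]) (use elim in auto)
      then show ?case using elim by (intro continuous_intros) auto
    qed
  qed
next
  fix A' assume "(\<forall>t\<in>{0..T}. A' t \<in> borel_measurable (G t)) \<and>
       (AE \<omega> in M. A' 0 \<omega> = 0 \<and> continuous_on {0..T} (\<lambda>t. A' t \<omega>) \<and> mono_on {0..T} (\<lambda>t. A' t \<omega>)) \<and>
       continuous_martingale M G T (\<lambda>t \<omega>. (norm (X t \<omega>))\<^sup>2 - A' t \<omega>)"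
  then show "indistinguishable M T A' (\<lambda>t \<omega>. op_trace Q * E t \<omega>)"
    by (intro compensator_unique[OF op_trace_nonneg _ X_norm_square_martingale])
       (auto simp: continuous_martingale_def intro: X_norm_square(1)[OF _ sets.top])
qed

text \<open>Polarization of the martingales \<open>(X t \<bullet> h)\<^sup>2 - (Q h \<bullet> h) E t\<close>.\<close>

lemma X_tensor_martingale: "martingale M G T (\<lambda>t \<omega>. (X t \<omega> \<bullet> h) * (X t \<omega> \<bullet> g) - (E t \<omega> *\<^sub>R Q) h \<bullet> g)"
proof -
  have "martingale M G T (\<lambda>t \<omega>. 1/4 * ((X t \<omega> \<bullet> (h + g))\<^sup>2 - (Q (h + g) \<bullet> (h + g)) * E t \<omega>)
      + (- 1/4) * ((X t \<omega> \<bullet> (h - g))\<^sup>2 - (Q (h - g) \<bullet> (h - g)) * E t \<omega>))"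
    by (rule martingale_linear_combination[OF subalgebra_G_upto X_inner_square_martingale X_inner_square_martingale])
  also have "(\<lambda>t \<omega>. 1/4 * ((X t \<omega> \<bullet> (h + g))\<^sup>2 - (Q (h + g) \<bullet> (h + g)) * E t \<omega>)
      + (- 1/4) * ((X t \<omega> \<bullet> (h - g))\<^sup>2 - (Q (h - g) \<bullet> (h - g)) * E t \<omega>))
      = (\<lambda>t \<omega>. (X t \<omega> \<bullet> h) * (X t \<omega> \<bullet> g) - (E t \<omega> *\<^sub>R Q) h \<bullet> g)"
  proof (intro ext)
    fix t \<omega>
    have "Q g \<bullet> h = Q h \<bullet> g" using Q_sym by (metis symmetric_op_def inner_commute)
    then have 1: "Q (h + g) \<bullet> (h + g) = Q h \<bullet> h + 2 * (Q h \<bullet> g) + Q g \<bullet> g"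
      "Q (h - g) \<bullet> (h - g) = Q h \<bullet> h - 2 * (Q h \<bullet> g) + Q g \<bullet> g"
      by (simp_all add: blinfun.add_right blinfun.diff_right inner_add_left inner_add_right inner_diff_left inner_diff_right)
    have 2: "(X t \<omega> \<bullet> (h + g))\<^sup>2 = (X t \<omega> \<bullet> h)\<^sup>2 + 2 * ((X t \<omega> \<bullet> h) * (X t \<omega> \<bullet> g)) + (X t \<omega> \<bullet> g)\<^sup>2"
      "(X t \<omega> \<bullet> (h - g))\<^sup>2 = (X t \<omega> \<bullet> h)\<^sup>2 - 2 * ((X t \<omega> \<bullet> h) * (X t \<omega> \<bullet> g)) + (X t \<omega> \<bullet> g)\<^sup>2"
      by (simp_all add: inner_add_right inner_diff_right power2_sum power2_diff)
    show "1/4 * ((X t \<omega> \<bullet> (h + g))\<^sup>2 - (Q (h + g) \<bullet> (h + g)) * E t \<omega>)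
      + (- 1/4) * ((X t \<omega> \<bullet> (h - g))\<^sup>2 - (Q (h - g) \<bullet> (h - g)) * E t \<omega>)
      = (X t \<omega> \<bullet> h) * (X t \<omega> \<bullet> g) - (E t \<omega> *\<^sub>R Q) h \<bullet> g"
      unfolding 1 2 by (simp add: blinfun.scaleR_left field_simps)
  qed
  finally show ?thesis .
qed

lemma trace_norm_continuous:
  assumes "continuous_on {0..T} e" "t \<in> {0..T}"
  shows "((\<lambda>s. trace_norm (e s *\<^sub>R Q - e t *\<^sub>R Q)) \<longlongrightarrow> 0) (at t within {0..T})"
proof -
  obtain a b where rep: "nuclear_rep Q a b" using Q_tc by (auto simp: trace_class_def)
  define C where "C = (\<Sum>i. norm (a i) * norm (b i))"
  have "(e \<longlongrightarrow> e t) (at t within {0..T})" using assms by (auto simp: continuous_on_def)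
  then have "((\<lambda>s. \<bar>e s - e t\<bar> * C) \<longlongrightarrow> \<bar>e t - e t\<bar> * C) (at t within {0..T})" by (intro tendsto_intros)
  then have lim: "((\<lambda>s. \<bar>e s - e t\<bar> * C) \<longlongrightarrow> 0) (at t within {0..T})" by simp
  show ?thesis
  proof (rule tendsto_sandwich[OF _ _ tendsto_const lim])
    show "\<forall>\<^sub>F s in at t within {0..T}. 0 \<le> trace_norm (e s *\<^sub>R Q - e t *\<^sub>R Q)"
      unfolding scaleR_left_diff_distrib[symmetric]
      by (intro always_eventually allI trace_norm_nonneg trace_class_scaleR Q_tc)
    show "\<forall>\<^sub>F s in at t within {0..T}. trace_norm (e s *\<^sub>R Q - e t *\<^sub>R Q) \<le> \<bar>e s - e t\<bar> * C"
      unfolding scaleR_left_diff_distrib[symmetric] C_def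
      by (intro always_eventually allI trace_norm_scaleR_le rep)
  qed
qed

lemma scaled_Q_nonneg: "0 \<le> c \<Longrightarrow> nonneg_op (c *\<^sub>R Q)"
  using Q_nonneg by (simp add: nonneg_op_def blinfun.scaleR_left)

lemma E_Q_compensates: "compensates_tensor_square M G T X (\<lambda>t \<omega>. E t \<omega> *\<^sub>R Q)"
  unfolding compensates_tensor_square_def
proof (intro conjI ballI allI X_tensor_martingale)
  fix t assume "t \<in> {0..T}"
  then have t: "0 \<le> t" by simp
  have "(\<lambda>r. r *\<^sub>R Q) \<in> borel_measurable borel"
    by (intro borel_measurable_continuous_onI continuous_intros)
  from measurable_compose[OF E_meas_G[OF t] this] show "(\<lambda>\<omega>. E t \<omega> *\<^sub>R Q) \<in> borel_measurable (G t)" .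
next
  show "AE \<omega> in M. E 0 \<omega> *\<^sub>R Q = 0 \<and>
        (\<forall>t\<in>{0..T}. symmetric_op (E t \<omega> *\<^sub>R Q) \<and> nonneg_op (E t \<omega> *\<^sub>R Q) \<and> trace_class (E t \<omega> *\<^sub>R Q)) \<and>
        (\<forall>t\<in>{0..T}. ((\<lambda>s. trace_norm (E s \<omega> *\<^sub>R Q - E t \<omega> *\<^sub>R Q)) \<longlongrightarrow> 0) (at t within {0..T}))"
    using E_paths_upto[of T]
  proof eventually_elim
    case (elim \<omega>)
    have "symmetric_op (E t \<omega> *\<^sub>R Q)" for t
      using Q_sym by (simp add: symmetric_op_def blinfun.scaleR_left)
    then show ?case
      using elim by (auto intro!: scaled_Q_nonneg trace_class_scaleR Q_tc trace_norm_continuous)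
  qed
qed

lemma E_Q_nondecreasing: "nondecreasing_op_process M T (\<lambda>t \<omega>. E t \<omega> *\<^sub>R Q)"
  unfolding nondecreasing_op_process_def
  using E_paths_upto[of T]
proof eventually_elim
  case (elim \<omega>)
  have "nonneg_op ((E t \<omega> - E s \<omega>) *\<^sub>R Q)" if "0 \<le> s" "s \<le> t" "t \<le> T" for s t
    using elim that mono_onD[of "{0..T}" "\<lambda>t. E t \<omega>" s t] by (intro scaled_Q_nonneg) auto
  then show ?case by (simp add: scaleR_left_diff_distrib)
qed

text \<open>
  For symmetric operators the diagonal values at \<open>f i + f j\<close> determine all matrix entries. Only
  countably many vectors are involved, so the exceptional null sets can be united.
\<close>

lemma symmetric_op_eqI:
  assumes S: "symmetric_op S" and eq: "\<And>i j. S (f i + f j) \<bullet> (f i + f j) = c * (Q (f i + f j) \<bullet> (f i + f j))"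
  shows "S = c *\<^sub>R Q"
proof -
  \<comment> \<open>The case \<open>i = j\<close> gives four times the diagonal entry.\<close>
  have diag: "S (f i) \<bullet> f i = c * (Q (f i) \<bullet> f i)" for i
    using eq[of i i] by (simp add: blinfun.add_right inner_add_left inner_add_right)
  have off: "(S - c *\<^sub>R Q) (f i) \<bullet> f j = 0" for i j
  proof -
    have "S (f j) \<bullet> f i = S (f i) \<bullet> f j" "Q (f j) \<bullet> f i = Q (f i) \<bullet> f j"
      using S Q_sym by (metis symmetric_op_def inner_commute)+
    then show ?thesis
      using eq[of i j] diag[of i] diag[of j]
      by (simp add: blinfun.add_right inner_add_left inner_add_right blinfun.diff_left blinfun.scaleR_left inner_diff_left algebra_simps)
  qed
  have basis: "(S - c *\<^sub>R Q) (f i) = 0" for i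
    using orthonormal_expansion_sums[OF f_onb f_inj, of "(S - c *\<^sub>R Q) (f i)"] off sums_unique2[OF _ sums_zero]
    by simp
  have "(S - c *\<^sub>R Q) x = 0" for x
  proof -
    have "(\<lambda>j. (S - c *\<^sub>R Q) ((x \<bullet> f j) *\<^sub>R f j)) sums ((S - c *\<^sub>R Q) x)"
      by (intro bounded_linear.sums[OF blinfun.bounded_linear_right] orthonormal_expansion_sums f_onb f_inj)
    then show ?thesis using sums_unique2[OF _ sums_zero] by (simp add: blinfun.scaleR_right basis)
  qed
  then have "S - c *\<^sub>R Q = 0" by (intro blinfun_eqI) simp
  then show ?thesis by simp
qed

text \<open>
  For fixed \<open>h\<close> the real process \<open>V t h \<bullet> h\<close> is continuous and nondecreasing and compensates
  \<open>(X t \<bullet> h)\<^sup>2\<close>, so it equals \<open>(Q h \<bullet> h) E t\<close>.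
\<close>

lemma X_quadratic_variation_unique:
  assumes V: "compensates_tensor_square M G T X V" and mono: "nondecreasing_op_process M T V"
  shows "indistinguishable M T V (\<lambda>t \<omega>. E t \<omega> *\<^sub>R Q)"
proof -
  have form: "AE \<omega> in M. \<forall>t\<in>{0..T}. V t \<omega> h \<bullet> h = (Q h \<bullet> h) * E t \<omega>" for h
  proof -
    have "martingale M G T (\<lambda>t \<omega>. (X t \<omega> \<bullet> h) * (X t \<omega> \<bullet> h) - V t \<omega> h \<bullet> h)"
      using V by (simp add: compensates_tensor_square_def)
    then have m: "martingale M G T (\<lambda>t \<omega>. (X t \<omega> \<bullet> h)\<^sup>2 - V t \<omega> h \<bullet> h)" by (simp add: power2_eq_square)
    have paths: "AE \<omega> in M. V 0 \<omega> h \<bullet> h = 0 \<and> continuous_on {0..T} (\<lambda>t. V t \<omega> h \<bullet> h) \<and> mono_on {0..T} (\<lambda>t. V t \<omega> h \<bullet> h)"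
    proof -
      have "AE \<omega> in M. V 0 \<omega> = 0 \<and>
        (\<forall>t\<in>{0..T}. symmetric_op (V t \<omega>) \<and> nonneg_op (V t \<omega>) \<and> trace_class (V t \<omega>)) \<and>
        (\<forall>t\<in>{0..T}. ((\<lambda>s. trace_norm (V s \<omega> - V t \<omega>)) \<longlongrightarrow> 0) (at t within {0..T}))"
        using V unfolding compensates_tensor_square_def by blast
      with mono[unfolded nondecreasing_op_process_def] show ?thesis
      proof eventually_elim
        case (elim \<omega>)
        have "continuous_on {0..T} (\<lambda>t. V t \<omega> h \<bullet> h)"
          unfolding continuous_on_def
        proof
          fix t assume t: "t \<in> {0..T}"
          have "((\<lambda>s. trace_norm (V s \<omega> - V t \<omega>) * (norm h * norm h)) \<longlongrightarrow> 0 * (norm h * norm h)) (at t within {0..T})"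
            using elim(2) t by (intro tendsto_mult tendsto_const) auto
          then have lim: "((\<lambda>s. trace_norm (V s \<omega> - V t \<omega>) * (norm h * norm h)) \<longlongrightarrow> 0) (at t within {0..T})" by simp
          have ev: "\<forall>\<^sub>F s in at t within {0..T}. norm (V s \<omega> h \<bullet> h - V t \<omega> h \<bullet> h) \<le> trace_norm (V s \<omega> - V t \<omega>) * (norm h * norm h)"
            unfolding eventually_at_filter
          proof (intro always_eventually allI impI)
            fix s assume "s \<in> {0..T}"
            then have "trace_class (V s \<omega> - V t \<omega>)" using elim(2) t by (intro trace_class_diff) auto
            from abs_form_le_trace_norm[OF this, of h h]
            show "norm (V s \<omega> h \<bullet> h - V t \<omega> h \<bullet> h) \<le> trace_norm (V s \<omega> - V t \<omega>) * (norm h * norm h)"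
              by (simp add: blinfun.diff_left inner_diff_left)
          qed
          have "((\<lambda>s. V s \<omega> h \<bullet> h - V t \<omega> h \<bullet> h) \<longlongrightarrow> 0) (at t within {0..T})"
            by (rule Lim_null_comparison[OF ev lim])
          then show "((\<lambda>s. V s \<omega> h \<bullet> h) \<longlongrightarrow> V t \<omega> h \<bullet> h) (at t within {0..T})"
            by (rule Lim_null[THEN iffD2])
        qed
        moreover have "mono_on {0..T} (\<lambda>t. V t \<omega> h \<bullet> h)"
        proof (rule mono_onI)
          fix r s assume "r \<in> {0..T}" "s \<in> {0..T}" "r \<le> s"
          then have "nonneg_op (V s \<omega> - V r \<omega>)" using elim(1) by auto
          then have "0 \<le> (V s \<omega> - V r \<omega>) h \<bullet> h" by (simp add: nonneg_op_def)
          then show "V r \<omega> h \<bullet> h \<le> V s \<omega> h \<bullet> h" by (simp add: blinfun.diff_left inner_diff_left)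
        qed
        ultimately show ?case using elim(2) by simp
      qed
    qed
    have c: "0 \<le> Q h \<bullet> h" using Q_nonneg by (simp add: nonneg_op_def)
    have "indistinguishable M T (\<lambda>t \<omega>. V t \<omega> h \<bullet> h) (\<lambda>t \<omega>. (Q h \<bullet> h) * E t \<omega>)"
      by (rule compensator_unique[OF c _ X_inner_square_martingale m paths]) (simp add: X_inner_square(1))
    then show ?thesis by (simp add: indistinguishable_def)
  qed
  have "AE \<omega> in M. \<forall>i j. \<forall>t\<in>{0..T}. V t \<omega> (f i + f j) \<bullet> (f i + f j) = (Q (f i + f j) \<bullet> (f i + f j)) * E t \<omega>"
    unfolding AE_all_countable using form by blast
  moreover have "AE \<omega> in M. \<forall>t\<in>{0..T}. symmetric_op (V t \<omega>)"
    using V unfolding compensates_tensor_square_def by (elim conjE) (rule AE_mp, assumption, simp)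
  ultimately show ?thesis
    unfolding indistinguishable_def
    by eventually_elim (auto intro!: symmetric_op_eqI simp: mult.commute)
qed

lemma X_quadratic_variation: "is_quadratic_variation M G T X (\<lambda>t \<omega>. E t \<omega> *\<^sub>R Q)"
  unfolding is_quadratic_variation_def
  using E_Q_compensates E_Q_nondecreasing X_quadratic_variation_unique by blast

end

theorem proposition2p9:
  fixes M :: "'w measure"
    and Q :: "'k::{real_inner, banach, second_countable_topology} \<Rightarrow>\<^sub>L 'k"
    and f :: "nat \<Rightarrow> 'k" and lam :: "nat \<Rightarrow> real"
    and w :: "nat \<Rightarrow> real \<Rightarrow> 'w \<Rightarrow> real"
    and U E :: "real \<Rightarrow> 'w \<Rightarrow> real"
    and \<beta> T :: real
  assumes "prob_space M" and "complete_measure M"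
    and "symmetric_op Q" and "nonneg_op Q" and "trace_class Q"
    and "inj f" and "orthonormal_basis (range f)"
    and "\<And>j. Q (f j) = lam j *\<^sub>R f j"
    and "\<And>j. standard_brownian_motion M (w j)"
    and "prob_space.indep_sets M (\<lambda>j. process_sigma M {0..} (w j)) UNIV"
    and "0 < \<beta>" and "\<beta> < 1"
    and "stable_subordinator M \<beta> U"
    and "E = inverse_process U"
    and "prob_space.indep_set M
           (process_sigma M (UNIV \<times> {0..}) (\<lambda>(j, s). w j s)) (process_sigma M {0..} E)"
    and "0 < T"
  shows "continuous_L2_martingale M (time_changed_filtration M w E) T (time_changed_Wiener lam f w E)
       \<and> is_increasing_process M (time_changed_filtration M w E) T (time_changed_Wiener lam f w E)
           (\<lambda>t \<omega>. op_trace Q * E t \<omega>)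
       \<and> is_quadratic_variation M (time_changed_filtration M w E) T (time_changed_Wiener lam f w E)
           (\<lambda>t \<omega>. E t \<omega> *\<^sub>R Q)"
proof -
  interpret wiener_family M w E
    by (intro wiener_family.intro wiener_family_axioms.intro assms)
  have "AE \<omega> in M. E 0 \<omega> = 0 \<and> continuous_on {0..} (\<lambda>t. E t \<omega>) \<and> mono_on {0..} (\<lambda>t. E t \<omega>)"
    unfolding assms(14) by (rule inverse_subordinator_paths[OF assms(1,13,11)])
  moreover have "integrable M (E t)" if "0 \<le> t" for t
    using inverse_subordinator_integrable[OF assms(1,13,11) that] E_meas[OF that] unfolding assms(14) .
  ultimately interpret time_changed_q_wiener M w E Q f lam
    by unfold_locales (use assms in auto)
  show ?thesis
    using X_continuous_L2_martingale X_increasing_process X_quadratic_variation by blast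
qed

end
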